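(* Let $\theta=(\alpha,\beta,\gamma,\delta)\in\mathbb{R}^4$ with $\gamma\ge|\delta|$ and $\beta>0$, and let $\{\varepsilon_t\}_{t\in\mathbb{Z}}$ be i.i.d. real random variables. Assume: (1) (stationarity of EGARCH) $E\log\bigl|\alpha+\gamma|\varepsilon_0|+\delta\varepsilon_0\bigr|<\infty$ and $\beta<1$; (2) (regularity) the distribution of $\varepsilon_0$ is absolutely continuous with respect to Lebesgue measure on $\mathbb{R}$ with continuous density $g$, $E\varepsilon_0=0$, $E\varepsilon_0^2=1$, $g(x)>0$ for all $x\in\mathbb{R}$, and $\sup_{x\in\mathbb{R}}(|x|+1)g(x)<\infty$; (3) $\lambda^y_E:=E\log\bigl|\beta-\tfrac12(\gamma|\varepsilon_0|+\delta\varepsilon_0)\bigr|>0$. Put $H^E(\theta,y,x)=\exp\{\alpha+\beta\log x+(\gamma|y|+\delta y)x^{-1/2}\}$ for $y\in\mathbb{R}$, $x>0$. Then the system $$\sigma_t^2=H^E(\theta,\sigma_{t-1}\varepsilon_{t-1},\sigma_{t-1}^2),\qquad \hat\sigma_t^2=H^E(\theta,\sigma_{t-1}\varepsilon_{t-1},\hat\sigma_{t-1}^2),\qquad t\ge1,$$ has a stationary solution $\{(\overline{\sigma}_t^2,\hat{\overline{\sigma}}_t^2)\}_{t\ge0}$ on an extended probability space such that $$P(\overline{\sigma}_0^2=\hat{\overline{\sigma}}_0^2)=0.$$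
   Context: The EGARCH model is $y_t=\sigma_t\varepsilon_t$, $\log\sigma_t^2=\alpha+\gamma|\varepsilon_{t-1}|+\delta\varepsilon_{t-1}+\beta\log\sigma_{t-1}^2$, $t\in\mathbb{Z}$, with $\sigma_t>0$. Equivalently $\sigma_t^2=H^E(\theta,y_{t-1},\sigma^2_{t-1})$. Under (1) it has a unique strictly stationary solution, denoted $\{\overline{\sigma}_t\}_{t\in\mathbb{Z}}$. The recursive volatility approximation with the true parameter is $\hat\sigma_t^2=H^E(\theta,y_{t-1},\hat\sigma_{t-1}^2)$, $t\ge1$. A stationary solution of the system on an extended probability space means: on an enlargement of the original probability space (for example its product with another probability space, on which the $\varepsilon_t$ are still defined), a strictly stationary process of pairs of positive random variables satisfying both equations of the system for all $t\ge1$, whose first component is the stationary EGARCH volatility $\overline{\sigma}_t^2$ and whose initial pair $(\overline{\sigma}_0^2,\hat{\overline{\sigma}}_0^2)$ is independent of $\{\varepsilon_t,\,t\ge0\}$. *)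

theory Defs
  imports "HOL-Probability.Probability"
begin

text \<open>The parameter is \<open>\<theta> = (\<alpha>, \<beta>, \<gamma>, \<delta>)\<close>; only meant for \<open>x > 0\<close>.\<close>

definition HE :: "real \<times> real \<times> real \<times> real \<Rightarrow> real \<Rightarrow> real \<Rightarrow> real" where
  "HE = (\<lambda>(\<alpha>, \<beta>, \<gamma>, \<delta>) y x. exp (\<alpha> + \<beta> * ln x + (\<gamma> * \<bar>y\<bar> + \<delta> * y) * x powr (- 1 / 2)))"

text \<open>
  \<open>E log |Z| < \<infinity>\<close> for the expectation with values in \<open>[-\<infinity>, \<infinity>]\<close>, i.e. the positive part of
  \<open>log |Z|\<close> has a finite integral: \<open>ennreal\<close> sends negative reals to \<open>0\<close>, and at \<open>Z = 0\<close>
  the convention \<open>ln 0 = 0\<close> gives the positive part of \<open>log 0 = -\<infinity>\<close>.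
\<close>

definition expectation_log_abs_finite :: "'a measure \<Rightarrow> ('a \<Rightarrow> real) \<Rightarrow> bool" where
  "expectation_log_abs_finite M Z \<longleftrightarrow> (\<integral>\<^sup>+ \<omega>. ennreal (ln \<bar>Z \<omega>\<bar>) \<partial>M) < \<infinity>"

text \<open>Shift invariance of the law of the whole path, on the product sigma-algebra.\<close>

definition strictly_stationary ::
    "'a measure \<Rightarrow> ('t::comm_monoid_add \<Rightarrow> 'a \<Rightarrow> 'b::topological_space) \<Rightarrow> bool" where
  "strictly_stationary M X \<longleftrightarrow>
     (\<forall>t. X t \<in> borel_measurable M) \<and>
     (\<forall>h. distr M (PiM UNIV (\<lambda>_. borel)) (\<lambda>\<omega> t. X (t + h) \<omega>) =
          distr M (PiM UNIV (\<lambda>_. borel)) (\<lambda>\<omega> t. X t \<omega>))"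

definition iid :: "'a measure \<Rightarrow> (int \<Rightarrow> 'a \<Rightarrow> real) \<Rightarrow> bool" where
  "iid M \<epsilon> \<longleftrightarrow>
     prob_space.indep_vars M (\<lambda>_. borel) \<epsilon> UNIV \<and>
     (\<forall>t. distr M borel (\<epsilon> t) = distr M borel (\<epsilon> 0))"

text \<open>
  Strictly stationary EGARCH volatility \<open>\<sigma>\<close> (not squared). Under the stationarity condition it
  is unique up to null sets, also without demanding that it be a function of the past innovations.
\<close>

definition stationary_egarch_volatility ::
    "'a measure \<Rightarrow> real \<times> real \<times> real \<times> real \<Rightarrow> (int \<Rightarrow> 'a \<Rightarrow> real) \<Rightarrow> (int \<Rightarrow> 'a \<Rightarrow> real) \<Rightarrow> bool" where
  "stationary_egarch_volatility M = (\<lambda>(\<alpha>, \<beta>, \<gamma>, \<delta>) \<epsilon> \<sigma>.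
     strictly_stationary M \<sigma> \<and>
     (\<forall>t. \<forall>\<omega>\<in>space M. \<sigma> t \<omega> > 0) \<and>
     (AE \<omega> in M. \<forall>t. ln ((\<sigma> t \<omega>)\<^sup>2) =
        \<alpha> + \<gamma> * \<bar>\<epsilon> (t - 1) \<omega>\<bar> + \<delta> * \<epsilon> (t - 1) \<omega> + \<beta> * ln ((\<sigma> (t - 1) \<omega>)\<^sup>2)))"

text \<open>
  Random variables \<open>Z\<close> on \<open>M\<close> are regarded as random variables on the enlargement \<open>N\<close> by
  composing with the measure-preserving map \<open>\<pi>\<close>.
\<close>

definition prob_space_extension :: "'a measure \<Rightarrow> 'b measure \<Rightarrow> ('b \<Rightarrow> 'a) \<Rightarrow> bool" where
  "prob_space_extension M N \<pi> \<longleftrightarrow> prob_space N \<and> \<pi> \<in> measurable N M \<and> distr N M \<pi> = M"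

text \<open>The library's \<open>indep_var\<close> requires both variables to have the same type.\<close>

definition independent_rvs ::
    "'a measure \<Rightarrow> 'b measure \<Rightarrow> ('a \<Rightarrow> 'b) \<Rightarrow> 'c measure \<Rightarrow> ('a \<Rightarrow> 'c) \<Rightarrow> bool" where
  "independent_rvs M S X T Y \<longleftrightarrow>
     X \<in> measurable M S \<and> Y \<in> measurable M T \<and>
     prob_space.indep_set M {X -` A \<inter> space M | A. A \<in> sets S} {Y -` B \<inter> space M | B. B \<in> sets T}"

text \<open>
  \<open>v t\<close> and \<open>w t\<close> are the two squared volatilities at time \<open>t \<ge> 0\<close>, defined on the enlargement
  \<open>N\<close> of the space \<open>M\<close> carrying \<open>\<epsilon>\<close>; the equation at time \<open>t + 1\<close> uses \<open>\<epsilon>\<close> at time \<open>t\<close>.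
\<close>

definition stationary_system_solution ::
    "'a measure \<Rightarrow> real \<times> real \<times> real \<times> real \<Rightarrow> (int \<Rightarrow> 'a \<Rightarrow> real) \<Rightarrow> 'b measure \<Rightarrow> ('b \<Rightarrow> 'a) \<Rightarrow>
     (nat \<Rightarrow> 'b \<Rightarrow> real) \<Rightarrow> (nat \<Rightarrow> 'b \<Rightarrow> real) \<Rightarrow> bool" where
  "stationary_system_solution M \<theta> \<epsilon> N \<pi> v w \<longleftrightarrow>
     prob_space_extension M N \<pi> \<and>
     strictly_stationary N (\<lambda>t \<omega>. (v t \<omega>, w t \<omega>)) \<and>
     (\<forall>t. \<forall>\<omega>\<in>space N. v t \<omega> > 0 \<and> w t \<omega> > 0) \<and>
     (AE \<omega> in N. \<forall>t.
        v (Suc t) \<omega> = HE \<theta> (sqrt (v t \<omega>) * \<epsilon> (int t) (\<pi> \<omega>)) (v t \<omega>) \<and>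
        w (Suc t) \<omega> = HE \<theta> (sqrt (v t \<omega>) * \<epsilon> (int t) (\<pi> \<omega>)) (w t \<omega>)) \<and>
     (\<exists>\<sigma>. stationary_egarch_volatility M \<theta> \<epsilon> \<sigma> \<and>
          (AE \<omega> in N. \<forall>t. v t \<omega> = (\<sigma> (int t) (\<pi> \<omega>))\<^sup>2)) \<and>
     independent_rvs N borel (\<lambda>\<omega>. (v 0 \<omega>, w 0 \<omega>))
       (PiM UNIV (\<lambda>_. borel)) (\<lambda>\<omega> t. \<epsilon> (int t) (\<pi> \<omega>))"

end

theory Submission
  imports Defs
begin

text \<open>
  Let \<open>d t = ln (w t) - ln (v t)\<close> be the gap of the two log volatilities and
  \<open>k t = \<gamma> \<bar>\<epsilon> t\<bar> + \<delta> \<epsilon> t\<close>. Then \<open>d (t + 1) = \<beta> d t + k t (exp (- d t / 2) - 1)\<close>, so the gap is by itself a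
  Markov chain, with fixed point \<open>0\<close>. The derivative at \<open>0\<close> is \<open>\<beta> - k t / 2\<close>, so the last hypothesis says
  that \<open>0\<close> is repelling on average: \<open>(ln \<bar>d\<bar>)\<^sup>2\<close> has a negative drift near \<open>0\<close> (the bounded density controls the
  singularity of the logarithm), while \<open>\<beta> < 1\<close> and the second moment give a drift away from \<open>\<plusminus>\<infinity>\<close>. Hence the
  averaged laws of the gap are tight in \<open>\<real> - {0}\<close>.

  The stationary volatility is a function of the past innovations, so the initial gap has to be coupled
  with that past. Start the gap at \<open>1\<close> at time \<open>- j\<close> and let \<open>d j p\<close> be its value at time \<open>0\<close>, given
  the past \<open>p\<close>. Suitable averages over \<open>j\<close> of the point masses at \<open>d j p\<close> converge weakly for
  almost every \<open>p\<close>; the quantile function of the limit turns an independent uniform variable into the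
  initial gap, and the averaging makes the joint law with the past invariant under one time step.
\<close>

section \<open>Almost invariant averages\<close>

text \<open>The extension has to carry the given innovations, and the first component has to be the
  given stationary volatility. So the limit is needed as a conditional law of the gap for each
  single past. A subsequence along which averaged laws converge need not converge past by past;
  convex combinations of the averages can be made to do so, simultaneously at all rational
  thresholds. The class of weights is therefore closed under convex combinations and still inherits
  every bound on Cesaro means. At \<open>0\<close> the squared logarithm, rather than the logarithm,
  serves as Lyapunov function: a step lowers \<open>- ln \<bar>d\<bar>\<close> by at least a fixed
  amount on average, and squaring turns this into a drift proportional to
  \<open>- ln \<bar>d\<bar>\<close>. This is unbounded at \<open>0\<close>, so the averaged time
  spent near \<open>0\<close> tends to zero with the size of the neighbourhood, and the limit has no
  mass there. At infinity the two signs need different functions, since a gap \<open>- u\<close> may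
  be thrown to one of order \<open>exp (u / 2)\<close>.\<close>

text \<open>Antitone weights are mixtures of uniform weights on initial segments. Their total variation is
  the first weight, which therefore bounds the effect of a shift.\<close>
definition cesaro_weights :: "nat \<Rightarrow> nat \<Rightarrow> (nat \<Rightarrow> real) set" where
  "cesaro_weights n k = {b. antimono b \<and> (\<forall>j. 0 \<le> b j) \<and> (\<forall>j>k. b j = 0) \<and>
     (\<Sum>j\<le>k. b j) = 1 \<and> b 0 \<le> 1 / real (Suc n)}"

lemma cesaro_weights_mono_left: "n \<le> n' \<Longrightarrow> cesaro_weights n' k \<subseteq> cesaro_weights n k"
proof -
  assume "n \<le> n'"
  then have "1 / real (Suc n') \<le> 1 / real (Suc n)" by (simp add: field_simps)
  then show ?thesis unfolding cesaro_weights_def by auto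
qed

lemma cesaro_weights_sum_eq:
  assumes "b \<in> cesaro_weights n k" "k \<le> k'"
  shows "(\<Sum>j\<le>k'. b j * a j) = (\<Sum>j\<le>k. b j * a j)"
proof (rule sum.mono_neutral_right)
  show "\<forall>i\<in>{..k'} - {..k}. b i * a i = 0"
    using assms by (auto simp: cesaro_weights_def)
qed (use assms in auto)

lemma cesaro_weights_mono_right:
  assumes "k \<le> k'" shows "cesaro_weights n k \<subseteq> cesaro_weights n k'"
proof
  fix b assume b: "b \<in> cesaro_weights n k"
  from cesaro_weights_sum_eq[OF b assms, of "\<lambda>_. 1"] b assms
  show "b \<in> cesaro_weights n k'" by (auto simp: cesaro_weights_def)
qed

lemma cesaro_weights_midpoint:
  assumes "b \<in> cesaro_weights n k" "c \<in> cesaro_weights n k"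
  shows "(\<lambda>j. (b j + c j) / 2) \<in> cesaro_weights n k"
  using assms unfolding cesaro_weights_def
  by (auto simp: antimono_def add_mono sum.distrib simp flip: sum_divide_distrib)

lemma cesaro_weights_uniform:
  "(\<lambda>j. if j \<le> n then 1 / real (Suc n) else 0) \<in> cesaro_weights n n"
  unfolding cesaro_weights_def by (auto simp: antimono_def)

lemma cesaro_weights_nonneg: "b \<in> cesaro_weights n k \<Longrightarrow> 0 \<le> b j"
  by (simp add: cesaro_weights_def)

lemma cesaro_weights_sum: "b \<in> cesaro_weights n k \<Longrightarrow> (\<Sum>j\<le>k. b j) = 1"
  by (simp add: cesaro_weights_def)

text \<open>Summation by parts: the increments \<open>b j - b (Suc j)\<close> are nonnegative, so a
  bound on the partial sums of \<open>a\<close> carries over. The drift condition supplies exactly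
  such bounds on partial sums.\<close>

lemma cesaro_weights_bound:
  assumes b: "b \<in> cesaro_weights n k"
    and a: "\<And>m. (\<Sum>j\<le>m. a j) \<le> B * real (Suc m)"
  shows "(\<Sum>j\<le>k. b j * a j) \<le> B"
proof -
  have parts: "(\<Sum>j\<le>m. b j * c j) = (\<Sum>j\<le>m. (b j - b (Suc j)) * (\<Sum>i\<le>j. c i)) + b (Suc m) * (\<Sum>i\<le>m. c i)"
    for m and c :: "nat \<Rightarrow> real"
    by (induction m) (auto simp: algebra_simps)
  have 0: "b (Suc k) = 0" using b by (simp add: cesaro_weights_def)
  have a': "(\<Sum>i\<le>m. a i) \<le> (\<Sum>i\<le>m. B)" for m using a[of m] by (simp add: mult.commute)
  have "(\<Sum>j\<le>k. b j * a j) = (\<Sum>j\<le>k. (b j - b (Suc j)) * (\<Sum>i\<le>j. a i))"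
    unfolding parts using 0 by simp
  also have "\<dots> \<le> (\<Sum>j\<le>k. (b j - b (Suc j)) * (\<Sum>i\<le>j. B))"
    by (rule sum_mono, rule mult_left_mono[OF a']) (use b in \<open>auto simp: cesaro_weights_def antimono_def\<close>)
  \<comment> \<open>The same summation by parts, read backwards for the constant sequence
    \<open>B\<close>.\<close>
  also have "\<dots> = (\<Sum>j\<le>k. b j * B)"
    unfolding parts using 0 by simp
  also have "\<dots> = B" using b by (simp add: cesaro_weights_def flip: sum_distrib_right)
  finally show ?thesis .
qed

lemma cesaro_weights_almost_invariant:
  assumes b: "b \<in> cesaro_weights n k" and a: "\<And>j. \<bar>a j\<bar> \<le> B"
  shows "\<bar>(\<Sum>j\<le>k. b j * a (Suc j)) - (\<Sum>j\<le>k. b j * a j)\<bar> \<le> 2 * B / real (Suc n)"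
proof -
  \<comment> \<open>The shift is moved onto the weights. Their increments telescope to
    \<open>b 0\<close>, and the boundary term contributes \<open>b 0\<close> once more, whence the
    factor 2.\<close>
  have *: "(\<Sum>j\<le>m. b j * a (Suc j)) - (\<Sum>j\<le>m. b j * a j)
      = (\<Sum>j\<le>m. (b j - b (Suc j)) * a (Suc j)) + b (Suc m) * a (Suc m) - b 0 * a 0" for m
    by (induction m) (auto simp: algebra_simps)
  have tel: "(\<Sum>j\<le>m. b j - b (Suc j)) = b 0 - b (Suc m)" for m
    by (induction m) auto
  have 0: "b (Suc k) = 0" using b by (simp add: cesaro_weights_def)
  have b0: "0 \<le> b 0" "b 0 \<le> 1 / real (Suc n)" using b by (auto simp: cesaro_weights_def)
  have B: "0 \<le> B" using a[of 0] by simp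
  have "\<bar>\<Sum>j\<le>k. (b j - b (Suc j)) * a (Suc j)\<bar> \<le> (\<Sum>j\<le>k. \<bar>(b j - b (Suc j)) * a (Suc j)\<bar>)"
    by (rule sum_abs)
  also have "\<dots> \<le> (\<Sum>j\<le>k. (b j - b (Suc j)) * B)"
    unfolding abs_mult
    by (intro sum_mono mult_mono) (use a b in \<open>auto simp: cesaro_weights_def antimono_def\<close>)
  also have "\<dots> = b 0 * B" using tel[of k] 0 by (simp flip: sum_distrib_right)
  finally have 1: "\<bar>\<Sum>j\<le>k. (b j - b (Suc j)) * a (Suc j)\<bar> \<le> b 0 * B" .
  have 2: "\<bar>b 0 * a 0\<bar> \<le> b 0 * B"
    unfolding abs_mult by (intro mult_mono) (use a b0 in auto)
  have "\<bar>(\<Sum>j\<le>k. b j * a (Suc j)) - (\<Sum>j\<le>k. b j * a j)\<bar> \<le> 2 * (b 0 * B)"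
    unfolding * using 1 2 0 by auto
  also have "\<dots> \<le> 2 * (1 / real (Suc n) * B)"
    using b0 B by (intro mult_left_mono mult_right_mono) auto
  finally show ?thesis by simp
qed

text \<open>A replacement for weak compactness: norm-minimal elements of the nested convex sets of
  averages form a Cauchy sequence by the parallelogram law.\<close>
lemma (in finite_measure) AE_convergent_cesaro_weights:
  fixes f :: "nat \<Rightarrow> 'a \<Rightarrow> real"
  assumes f[measurable]: "\<And>j. f j \<in> borel_measurable M"
    and f_bd: "\<And>j x. x \<in> space M \<Longrightarrow> \<bar>f j x\<bar> \<le> 1"
  obtains b K where "\<And>n. b n \<in> cesaro_weights n (K n)"
    and "AE x in M. convergent (\<lambda>n. \<Sum>j\<le>K n. b n j * f j x)"
proof -
  define V where "V = (\<lambda>b k. \<integral>x. (\<Sum>j\<le>k. b j * f j x)\<^sup>2 \<partial>M)"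
  \<comment> \<open>All supports \<open>k\<close> compete, only the restriction indexed by
    \<open>n\<close> tightens; hence \<open>I\<close> increases and, bounded by the total mass,
    converges.\<close>
  define I where "I n = Inf {V b k | b k. b \<in> cesaro_weights n k}" for n
  let ?m = "measure M (space M)"
  have g_bd: "\<bar>\<Sum>j\<le>k. b j * f j x\<bar> \<le> 1" if "b \<in> cesaro_weights n k" "x \<in> space M" for b n k x
  proof -
    have "\<bar>\<Sum>j\<le>k. b j * f j x\<bar> \<le> (\<Sum>j\<le>k. \<bar>b j * f j x\<bar>)" by (rule sum_abs)
    also have "\<dots> \<le> (\<Sum>j\<le>k. b j * 1)"
      unfolding abs_mult
      by (intro sum_mono mult_mono) (use f_bd that in \<open>auto simp: cesaro_weights_def\<close>)
    finally show ?thesis using that by (simp add: cesaro_weights_def)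
  qed
  have g_sq: "(\<Sum>j\<le>k. b j * f j x)\<^sup>2 \<le> 1" if "b \<in> cesaro_weights n k" "x \<in> space M" for b n k x
    using g_bd[OF that] by (simp add: abs_square_le_1)
  have int_sq: "integrable M (\<lambda>x. (\<Sum>j\<le>k. b j * f j x)\<^sup>2)" if "b \<in> cesaro_weights n k" for b n k
    by (rule integrable_const_bound[where B = 1]) (use g_sq[OF that] in auto)
  have V0: "0 \<le> V b k" for b k unfolding V_def by simp
  have V1: "V b k \<le> ?m" if "b \<in> cesaro_weights n k" for b n k
  proof -
    have "V b k \<le> (\<integral>x. 1 \<partial>M)" unfolding V_def
      by (rule integral_mono) (use int_sq[OF that] g_sq[OF that] in auto)
    then show ?thesis by simp
  qed
  have ne: "{V b k | b k. b \<in> cesaro_weights n k} \<noteq> {}" for n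
    using cesaro_weights_uniform[of n] by blast
  have bdd: "bdd_below {V b k | b k. b \<in> cesaro_weights n k}" for n
    using V0 by (intro bdd_belowI[where m = 0]) auto
  have I_le: "I n \<le> V b k" if "b \<in> cesaro_weights n k" for b n k
    unfolding I_def by (rule cInf_lower) (use that bdd in auto)
  have I_nonneg: "0 \<le> I n" for n
    unfolding I_def by (rule cInf_greatest[OF ne]) (use V0 in auto)
  have I_mono: "I n \<le> I n'" if "n \<le> n'" for n n'
    unfolding I_def
    by (rule cInf_superset_mono[OF ne bdd]) (use cesaro_weights_mono_left[OF that] in blast)
  have "\<exists>b k. b \<in> cesaro_weights n k \<and> V b k < I n + 1 / real (Suc n)" for n
  proof -
    have "Inf {V b k | b k. b \<in> cesaro_weights n k} < I n + 1 / real (Suc n)" by (simp add: I_def)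
    from this[unfolded cInf_less_iff[OF ne bdd]] show ?thesis by blast
  qed
  then obtain B K where BK: "\<And>n. B n \<in> cesaro_weights n (K n)"
    and VB: "\<And>n. V (B n) (K n) < I n + 1 / real (Suc n)"
    by metis
  define G where "G n x = (\<Sum>j\<le>K n. B n j * f j x)" for n x
  have G[measurable]: "G n \<in> borel_measurable M" for n unfolding G_def by measurable
  have I_bd: "I n \<le> ?m" for n
    using I_le[OF BK] V1[OF BK] by (meson order_trans)
  have "convergent I"
    using I_bd I_mono I_nonneg by (intro Bseq_mono_convergent BseqI'[of _ ?m]) auto
  then obtain Il where Il: "I \<longlonglongrightarrow> Il" by (auto simp: convergent_def)
  have I_Il: "I n \<le> Il" for n
    by (rule LIMSEQ_le_const[OF Il]) (use I_mono in auto)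
  \<comment> \<open>From the parallelogram law: \<open>2 * (I m - I n)\<close> with
    \<open>I m\<close> replaced by the limit, plus at most \<open>2 / real (Suc n)\<close> for the
    slack of each of the two near-minimizers.\<close>
  define e where "e n = 2 * (Il - I n) + 4 / real (Suc n)" for n
  have e0: "e \<longlonglongrightarrow> 0"
  proof -
    have "(\<lambda>n. 2 * (Il - I n) + 4 * inverse (real (Suc n))) \<longlonglongrightarrow> 2 * (Il - Il) + 4 * 0"
      by (intro tendsto_intros Il LIMSEQ_inverse_real_of_nat)
    then show ?thesis by (simp add: e_def[abs_def] divide_inverse)
  qed
  have diff: "(\<integral>x. (G n x - G m x)\<^sup>2 \<partial>M) \<le> e n" if "n \<le> m" for n m
  proof -
    let ?k = "max (K n) (K m)"
    have bn: "B n \<in> cesaro_weights n ?k" using BK cesaro_weights_mono_right[of "K n" ?k n] by auto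
    have bm: "B m \<in> cesaro_weights n ?k"
      using BK cesaro_weights_mono_right[of "K m" ?k m] cesaro_weights_mono_left[OF that, of ?k] by auto
    have Gn: "G n x = (\<Sum>j\<le>?k. B n j * f j x)" for x
      unfolding G_def by (rule cesaro_weights_sum_eq[OF BK, symmetric]) auto
    have Gm: "G m x = (\<Sum>j\<le>?k. B m j * f j x)" for x
      unfolding G_def by (rule cesaro_weights_sum_eq[OF BK, symmetric]) auto
    let ?c = "\<lambda>j. (B n j + B m j) / 2"
    have c: "?c \<in> cesaro_weights n ?k" by (rule cesaro_weights_midpoint[OF bn bm])
    have mid: "(\<Sum>j\<le>?k. ?c j * f j x) = (G n x + G m x) / 2" for x
      unfolding Gn Gm by (simp add: add_divide_distrib sum.distrib sum_divide_distrib algebra_simps)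
    have i1: "integrable M (\<lambda>x. (G n x)\<^sup>2)" and i2: "integrable M (\<lambda>x. (G m x)\<^sup>2)"
      unfolding G_def by (rule int_sq[OF BK])+
    have i3: "integrable M (\<lambda>x. ((G n x + G m x) / 2)\<^sup>2)"
      using int_sq[OF c] unfolding mid .
    have lin: "D \<le> 2 * (l - i) + q"
 if "i \<le> X" "Y < i + u" "Z < j + v" "v \<le> u" "D = 2 * Y + 2 * Z - 4 * X" "q = 4 * u" "j \<le> l"
      for i X Y u Z j v D q l :: real using that by argo
    \<comment> \<open>As \<open>n \<le> m\<close>, both weights lie in the class of
      \<open>n\<close>, and so does their midpoint, which cannot beat the infimum.\<close>
    have "I n \<le> (\<integral>x. ((G n x + G m x) / 2)\<^sup>2 \<partial>M)"
      using I_le[OF c] unfolding V_def mid .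
    moreover have "(\<integral>x. (G n x)\<^sup>2 \<partial>M) < I n + 1 / real (Suc n)" "(\<integral>x. (G m x)\<^sup>2 \<partial>M) < I m + 1 / real (Suc m)"
      using VB unfolding V_def G_def by auto
    moreover have "1 / real (Suc m) \<le> 1 / real (Suc n)" using that by (simp add: field_simps)
    moreover have "(\<lambda>x. (G n x - G m x)\<^sup>2)
        = (\<lambda>x. 2 * (G n x)\<^sup>2 + 2 * (G m x)\<^sup>2 - 4 * ((G n x + G m x) / 2)\<^sup>2)"
      by (auto simp: fun_eq_iff power2_eq_square field_simps)
    then have "(\<integral>x. (G n x - G m x)\<^sup>2 \<partial>M) = 2 * (\<integral>x. (G n x)\<^sup>2 \<partial>M) + 2 * (\<integral>x. (G m x)\<^sup>2 \<partial>M)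
        - 4 * (\<integral>x. ((G n x + G m x) / 2)\<^sup>2 \<partial>M)"
      using i1 i2 i3 by (simp del: power_divide)
    moreover have "4 / real (Suc n) = 4 * (1 / real (Suc n))" by simp
    moreover note I_Il[of m]
    ultimately show ?thesis unfolding e_def by (rule lin)
  qed
  \<comment> \<open>Mean square convergence gives almost sure convergence along a subsequence; the
    rate \<open>(1/4) ^ i\<close> makes the increments summable in mean.\<close>
  have "\<exists>n\<ge>N. e n \<le> (1/4) ^ i" for i N
  proof -
    have "eventually (\<lambda>n. e n < (1/4) ^ i) sequentially"
      using e0 by (rule order_tendstoD) simp
    then obtain N' where "\<And>n. n \<ge> N' \<Longrightarrow> e n < (1/4) ^ i" by (auto simp: eventually_sequentially)
    then show ?thesis by (intro exI[of _ "max N N'"]) (simp add: less_imp_le)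
  qed
  then obtain pick where pick: "\<And>N i. N \<le> pick N i" "\<And>N i. e (pick N i) \<le> (1/4) ^ i" by metis
  define r where "r = rec_nat (pick 0 0) (\<lambda>i N. pick (Suc N) (Suc i))"
  have r': "Suc (r i) \<le> r (Suc i)" for i by (simp add: r_def pick)
  have r: "e (r i) \<le> (1/4) ^ i" for i
    by (cases i) (simp_all only: r_def nat.rec pick(2))
  have rm: "strict_mono r" using r' by (intro strict_monoI_Suc) (auto simp: Suc_le_eq)
  let ?D = "\<lambda>i x. \<bar>G (r (Suc i)) x - G (r i) x\<bar>"
  have D_int: "(\<integral>\<^sup>+x. ennreal (?D i x) \<partial>M) \<le> ennreal ((1 + ?m) * (1/2)^i)" for i
  proof -
    \<comment> \<open>Young's inequality with weight \<open>2 ^ i\<close>: the squared increment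
      integrates to at most \<open>(1/4) ^ i\<close>, so both terms are of order
      \<open>(1/2) ^ i\<close>.\<close>
    have pt: "?D i x \<le> 2^i * (G (r i) x - G (r (Suc i)) x)\<^sup>2 + (1/2)^i" for x
    proof -
      have *: "y \<le> c * y\<^sup>2 + h" if "0 < c" "c * h = 1" "0 \<le> y" for y c h :: real
      proof -
        have "c * (c * y\<^sup>2 + h) = (c * y)\<^sup>2 + 1"
          using that by (simp add: algebra_simps power2_eq_square)
        moreover have "0 \<le> (c * y)\<^sup>2 - 2 * (c * y) + 1"
          using zero_le_power2[of "c * y - 1"] by (simp add: power2_diff)
        moreover have "0 \<le> c * y" using that by simp
        ultimately have "c * y \<le> c * (c * y\<^sup>2 + h)" by linarith
        then show ?thesis using that by simp
      qed
      have "?D i x \<le> 2^i * (?D i x)\<^sup>2 + (1/2)^i"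
        by (rule *) (simp_all flip: power_mult_distrib)
      also have "(?D i x)\<^sup>2 = (G (r i) x - G (r (Suc i)) x)\<^sup>2"
        by (simp add: power2_commute)
      finally show ?thesis .
    qed
    have i: "integrable M (\<lambda>x. (G (r i) x - G (r (Suc i)) x)\<^sup>2)"
    proof (rule integrable_const_bound[where B = 4])
      show "AE x in M. norm ((G (r i) x - G (r (Suc i)) x)\<^sup>2) \<le> 4"
      proof (rule AE_I2)
        fix x assume x: "x \<in> space M"
        have "\<bar>G (r i) x - G (r (Suc i)) x\<bar> \<le> 2"
          using g_bd[OF BK x, of "r i"] g_bd[OF BK x, of "r (Suc i)"] unfolding G_def by linarith
        then have "(G (r i) x - G (r (Suc i)) x)\<^sup>2 \<le> 2\<^sup>2" by (metis abs_le_square_iff abs_numeral)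
        then show "norm ((G (r i) x - G (r (Suc i)) x)\<^sup>2) \<le> 4" by simp
      qed
    qed simp
    have "(\<integral>\<^sup>+x. ennreal (?D i x) \<partial>M) \<le> (\<integral>\<^sup>+x. ennreal (2^i * (G (r i) x - G (r (Suc i)) x)\<^sup>2 + (1/2)^i) \<partial>M)"
      by (intro nn_integral_mono ennreal_leI pt)
    also have "\<dots> = ennreal (\<integral>x. 2^i * (G (r i) x - G (r (Suc i)) x)\<^sup>2 + (1/2)^i \<partial>M)"
      by (rule nn_integral_eq_integral) (use i in auto)
    also have "(\<integral>x. 2^i * (G (r i) x - G (r (Suc i)) x)\<^sup>2 + (1/2)^i \<partial>M)
        = 2^i * (\<integral>x. (G (r i) x - G (r (Suc i)) x)\<^sup>2 \<partial>M) + (1/2)^i * ?m"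
      using i by (simp add: mult.commute)
    also have "\<dots> \<le> 2^i * (1/4)^i + (1/2)^i * ?m"
      using diff[of "r i" "r (Suc i)"] r[of i] r'[of i]
      by (intro add_right_mono mult_left_mono) auto
    also have "\<dots> = (1 + ?m) * (1/2)^i"
      by (simp add: algebra_simps flip: power_mult_distrib)
    finally show ?thesis by (simp add: ennreal_leI)
  qed
  have "(\<integral>\<^sup>+x. (\<Sum>i. ennreal (?D i x)) \<partial>M) = (\<Sum>i. \<integral>\<^sup>+x. ennreal (?D i x) \<partial>M)"
    by (rule nn_integral_suminf) simp
  also have "\<dots> \<le> (\<Sum>i. ennreal ((1 + ?m) * (1/2)^i))"
    by (intro suminf_le D_int) auto
  also have "\<dots> < \<infinity>"
    by (subst suminf_ennreal2) (auto intro!: summable_mult summable_geometric)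
  finally have "AE x in M. (\<Sum>i. ennreal (?D i x)) \<noteq> \<infinity>"
    by (intro nn_integral_noteq_infinite) auto
  then have conv: "AE x in M. convergent (\<lambda>i. G (r i) x)"
  proof eventually_elim
    fix x assume "(\<Sum>i. ennreal (?D i x)) \<noteq> \<infinity>"
    then have "summable (\<lambda>i. ?D i x)" by (intro summable_suminf_not_top) auto
    then have "summable (\<lambda>i. G (r (Suc i)) x - G (r i) x)" by (rule summable_rabs_cancel)
    then have "convergent (\<lambda>i. G (r 0) x + (\<Sum>j<i. G (r (Suc j)) x - G (r j) x))"
      by (intro convergent_add convergent_const) (simp add: summable_iff_convergent)
    moreover have "G (r 0) x + (\<Sum>j<i. G (r (Suc j)) x - G (r j) x) = G (r i) x" for i
      using sum_lessThan_telescope[of "\<lambda>j. G (r j) x" i] by simp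
    ultimately show "convergent (\<lambda>i. G (r i) x)" by simp
  qed
  show thesis
  proof (rule that[of "\<lambda>n. B (r n)" "\<lambda>n. K (r n)"])
    \<comment> \<open>Thinning only helps: \<open>n \<le> r n\<close>, so the selected weights
      satisfy the stricter bound on the first weight.\<close>
    show "B (r n) \<in> cesaro_weights n (K (r n))" for n
      using BK[of "r n"] cesaro_weights_mono_left[of n "r n"] seq_suble[OF rm] by auto
    show "AE x in M. convergent (\<lambda>n. \<Sum>j\<le>K (r n). B (r n) j * f j x)"
      using conv unfolding G_def .
  qed
qed

section \<open>Random weak limits\<close>

text \<open>\<open>H\<close> is compared with the limit distribution function at strictly separated
  points only, because at a rational atom the limit of the values may lie anywhere between the left
  and the right limit. At a continuity point, rationals on either side suffice.\<close>

lemma weak_conv_m_quantile: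
  assumes \<mu>: "\<And>n. real_distribution (\<mu> n)" and \<kappa>: "real_distribution \<kappa>"
    and lim: "\<And>x. x \<in> \<rat> \<Longrightarrow> (\<lambda>n. cdf (\<mu> n) x) \<longlonglongrightarrow> H x"
    and le: "\<And>x y. x \<in> \<rat> \<Longrightarrow> x < y \<Longrightarrow> H x \<le> cdf \<kappa> y"
    and ge: "\<And>x y. x \<in> \<rat> \<Longrightarrow> y < x \<Longrightarrow> cdf \<kappa> y \<le> H x"
  shows "weak_conv_m \<mu> \<kappa>"
  unfolding weak_conv_m_def weak_conv_def
proof (intro allI impI)
  fix y assume y: "isCont (cdf \<kappa>) y"
  interpret \<mu>: real_distribution "\<mu> n" for n by (rule \<mu>)
  interpret \<kappa>: real_distribution \<kappa> by (rule \<kappa>)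
  show "(\<lambda>n. cdf (\<mu> n) y) \<longlonglongrightarrow> cdf \<kappa> y"
  proof (rule order_tendstoI)
    fix c assume "c < cdf \<kappa> y"
    then have "eventually (\<lambda>z. c < cdf \<kappa> z) (at_left y)"
      using y by (intro order_tendstoD(1)[of "cdf \<kappa>" "cdf \<kappa> y"]) (auto simp: isCont_def filterlim_at_split)
    then obtain z0 where "z0 < y" and z0: "\<And>z. z0 < z \<Longrightarrow> z < y \<Longrightarrow> c < cdf \<kappa> z"
      unfolding eventually_at_left_field by blast
    from dense[OF this(1)] obtain z where "z0 < z" "z < y" by blast
    with z0 have z: "z < y" "c < cdf \<kappa> z" by blast+
    \<comment> \<open>The chain is \<open>c < cdf \<kappa> z \<le> H x\<close>, where
      \<open>H x\<close> is the limit of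
      \<open>cdf (\<mu> n) x \<le> cdf (\<mu> n) y\<close>.\<close>
    obtain x where x: "x \<in> \<rat>" "z < x" "x < y" using Rats_dense_in_real[OF z(1)] by auto
    have "c < H x" using ge[OF x(1,2)] z by simp
    then have "eventually (\<lambda>n. c < cdf (\<mu> n) x) sequentially" by (rule order_tendstoD(1)[OF lim[OF x(1)]])
    then show "eventually (\<lambda>n. c < cdf (\<mu> n) y) sequentially"
    proof eventually_elim
      case (elim n)
      then show ?case using \<mu>.cdf_nondecreasing[of x y n] x by simp
    qed
  next
    fix c assume "cdf \<kappa> y < c"
    then have "eventually (\<lambda>z. cdf \<kappa> z < c) (at_right y)"
      using y by (intro order_tendstoD(2)[of "cdf \<kappa>" "cdf \<kappa> y"]) (auto simp: isCont_def filterlim_at_split)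
    then obtain z0 where "y < z0" and z0: "\<And>z. y < z \<Longrightarrow> z < z0 \<Longrightarrow> cdf \<kappa> z < c"
      unfolding eventually_at_right_field by blast
    from dense[OF this(1)] obtain z where "y < z" "z < z0" by blast
    with z0 have z: "y < z" "cdf \<kappa> z < c" by blast+
    obtain x where x: "x \<in> \<rat>" "y < x" "x < z" using Rats_dense_in_real[OF z(1)] by auto
    have "H x < c" using le[OF x(1,3)] z by simp
    then have "eventually (\<lambda>n. cdf (\<mu> n) x < c) sequentially" by (rule order_tendstoD(2)[OF lim[OF x(1)]])
    then show "eventually (\<lambda>n. cdf (\<mu> n) y < c) sequentially"
    proof eventually_elim
      case (elim n)
      then show ?case using \<mu>.cdf_nondecreasing[of y x n] x by simp
    qed
  qed
qed

section \<open>Uniform law on the unit interval and finitely supported laws\<close>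

definition unit_uniform :: "real measure" where
  "unit_uniform = uniform_measure lborel {0<..<1}"

lemma sets_unit_uniform[measurable_cong, simp]: "sets unit_uniform = sets borel"
  by (simp add: unit_uniform_def)

lemma space_unit_uniform[simp]: "space unit_uniform = UNIV"
  by (simp add: unit_uniform_def)

lemma prob_space_unit_uniform: "prob_space unit_uniform"
  unfolding unit_uniform_def by (rule prob_space_uniform_measure) auto

lemma AE_unit_uniform: "AE u in unit_uniform. 0 < u \<and> u < 1"
  unfolding unit_uniform_def by (rule AE_uniform_measureI) auto

lemma measure_unit_uniform:
  assumes "0 \<le> h" "h \<le> 1"
  shows "measure unit_uniform {0<..<h} = h"
proof -
  have "{0<..<1} \<inter> {0<..<h} = {0<..<h}" using assms by auto
  then show ?thesis using assms
    unfolding unit_uniform_def by (subst measure_uniform_measure) auto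
qed

definition weighted_points :: "nat \<Rightarrow> (nat \<Rightarrow> real) \<Rightarrow> (nat \<Rightarrow> real) \<Rightarrow> real measure" where
  "weighted_points k b x = distr (point_measure {..k} (\<lambda>j. ennreal (b j))) borel x"

lemma
  fixes f :: "real \<Rightarrow> real"
  assumes "\<And>j. 0 \<le> b j" "(\<Sum>j\<le>k. b j) = 1"
  shows real_distribution_weighted_points: "real_distribution (weighted_points k b x)"
    and cdf_weighted_points: "cdf (weighted_points k b x) y = (\<Sum>j\<le>k. b j * of_bool (x j \<le> y))"
    and integral_weighted_points: "f \<in> borel_measurable borel \<Longrightarrow>
      integral\<^sup>L (weighted_points k b x) f = (\<Sum>j\<le>k. b j * f (x j))"
proof -
  let ?p = "point_measure {..k} (\<lambda>j. ennreal (b j))"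
  interpret p: prob_space ?p
    by (rule prob_spaceI) (simp add: space_point_measure emeasure_point_measure_finite2 assms sum_ennreal)
  have x[measurable]: "x \<in> measurable ?p borel" by (simp add: measurable_def space_point_measure sets_point_measure)
  show rd: "real_distribution (weighted_points k b x)"
    unfolding weighted_points_def by (rule p.real_distribution_distr) simp
  show i: "integral\<^sup>L (weighted_points k b x) f = (\<Sum>j\<le>k. b j * f (x j))"
    if [measurable]: "f \<in> borel_measurable borel" for f :: "real \<Rightarrow> real"
    unfolding weighted_points_def
    by (subst integral_distr) (simp_all add: lebesgue_integral_point_measure_finite assms)
  interpret rd: real_distribution "weighted_points k b x" by (rule rd)
  have "cdf (weighted_points k b x) y = integral\<^sup>L (weighted_points k b x) (indicator {..y})"
    by (simp add: cdf_def)
  also have "\<dots> = (\<Sum>j\<le>k. b j * indicator {..y} (x j))" by (rule i) simp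
  finally show "cdf (weighted_points k b x) y = (\<Sum>j\<le>k. b j * of_bool (x j \<le> y))"
    by (simp add: indicator_def)
qed

text \<open>The convergence is stable: a test function may depend on \<open>\<omega>\<close> in any
  measurable way and has to be continuous in the last variable only. \<open>D\<close> is the
  quantile function of the random limit law; tightness in the mean keeps that law from losing mass
  for almost every \<open>\<omega>\<close>.\<close>

lemma (in prob_space) random_weak_limit:
  fixes X :: "nat \<Rightarrow> 'a \<Rightarrow> real"
  assumes X[measurable]: "\<And>j. X j \<in> borel_measurable M"
    and tight: "\<And>e. 0 < e \<Longrightarrow> \<exists>R::nat. \<forall>m. (\<Sum>j\<le>m. prob {\<omega> \<in> space M. real R \<le> \<bar>X j \<omega>\<bar>}) \<le> e * real (Suc m)"
  obtains b K D where "\<And>n. b n \<in> cesaro_weights n (K n)"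
    and "D \<in> borel_measurable (M \<Otimes>\<^sub>M unit_uniform)"
    and "\<And>f B. f \<in> borel_measurable (M \<Otimes>\<^sub>M borel) \<Longrightarrow> (\<And>\<omega> x. \<omega> \<in> space M \<Longrightarrow> \<bar>f (\<omega>, x)\<bar> \<le> B) \<Longrightarrow>
      (\<And>\<omega>. \<omega> \<in> space M \<Longrightarrow> continuous_on UNIV (\<lambda>x. f (\<omega>, x))) \<Longrightarrow>
      (\<lambda>n. \<Sum>j\<le>K n. b n j * (\<integral>\<omega>. f (\<omega>, X j \<omega>) \<partial>M)) \<longlonglongrightarrow>
        (\<integral>\<omega>. \<integral>u. f (\<omega>, D (\<omega>, u)) \<partial>unit_uniform \<partial>M)"
proof -
  interpret U: prob_space unit_uniform by (rule prob_space_unit_uniform)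
  define q :: "nat \<Rightarrow> real" where "q = from_nat_into \<rat>"
  have q_range: "range q = \<rat>"
    unfolding q_def by (rule range_from_nat_into) (auto simp: countable_rat)
  \<comment> \<open>The geometric law charges every index, so almost sure convergence on the product
    with \<open>\<nu>\<close> is convergence at all rational thresholds at once, with one choice of
    weights.\<close>
  define \<nu> where "\<nu> = measure_pmf (geometric_pmf (1/2))"
  have \<nu>_sets[measurable_cong]: "sets \<nu> = sets (count_space UNIV)" by (simp add: \<nu>_def)
  have q_meas[measurable]: "q \<in> borel_measurable \<nu>" by (simp add: \<nu>_def)
  interpret \<nu>: prob_space \<nu> unfolding \<nu>_def by (rule measure_pmf.prob_space_axioms)
  interpret MN: pair_prob_space M \<nu> by unfold_locales
  define F where "F j = (\<lambda>z. if X j (fst z) \<le> q (snd z) then 1 else 0 :: real)" for j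
  have F_meas: "F j \<in> borel_measurable (M \<Otimes>\<^sub>M \<nu>)" for j unfolding F_def by measurable
  obtain b K where b: "\<And>n. b n \<in> cesaro_weights n (K n)"
    and conv: "AE z in M \<Otimes>\<^sub>M \<nu>. convergent (\<lambda>n. \<Sum>j\<le>K n. b n j * F j z)"
    by (rule MN.AE_convergent_cesaro_weights[of F]) (use F_meas in \<open>auto simp: F_def\<close>)
  define G where "G n x \<omega> = (\<Sum>j\<le>K n. b n j * of_bool (X j \<omega> \<le> x))" for n x \<omega>
  define H where "H x \<omega> = lim (\<lambda>n. G n x \<omega>)" for x \<omega>
  have G_meas[measurable]: "G n x \<in> borel_measurable M" for n x
    unfolding G_def of_bool_def by measurable
  have H_meas[measurable]: "H x \<in> borel_measurable M" for x
    unfolding H_def by measurable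
  have b_nn: "0 \<le> b n j" for n j by (rule cesaro_weights_nonneg[OF b])
  have b_sum: "(\<Sum>j\<le>K n. b n j) = 1" for n by (rule cesaro_weights_sum[OF b])
  have G_mono: "G n x \<omega> \<le> G n y \<omega>" if "x \<le> y" for n x y \<omega>
    unfolding G_def by (intro sum_mono mult_left_mono) (use that b_nn in auto)
  have G_bd: "0 \<le> G n x \<omega>" "G n x \<omega> \<le> 1" for n x \<omega>
  proof -
    show "0 \<le> G n x \<omega>" unfolding G_def by (intro sum_nonneg mult_nonneg_nonneg) (use b_nn in auto)
    have "G n x \<omega> \<le> (\<Sum>j\<le>K n. b n j * 1)"
      unfolding G_def by (intro sum_mono mult_left_mono) (use b_nn in auto)
    then show "G n x \<omega> \<le> 1" by (simp add: b_sum)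
  qed
  have "AE \<omega> in M. AE i in \<nu>. convergent (\<lambda>n. \<Sum>j\<le>K n. b n j * F j (\<omega>, i))"
    using MN.AE_pair[OF conv] by simp
  then have conv_AE: "AE \<omega> in M. \<forall>x\<in>\<rat>. convergent (\<lambda>n. G n x \<omega>)"
  proof eventually_elim
    case (elim \<omega>)
    then have "\<forall>i. convergent (\<lambda>n. \<Sum>j\<le>K n. b n j * F j (\<omega>, i))"
      unfolding \<nu>_def AE_measure_pmf_iff by (simp add: set_pmf_geometric)
    moreover have "(\<Sum>j\<le>K n. b n j * F j (\<omega>, i)) = G n (q i) \<omega>" for n i
      by (simp add: G_def F_def of_bool_def)
    ultimately show ?case unfolding q_range[symmetric] by simp
  qed
  have H_lim: "(\<lambda>n. G n x \<omega>) \<longlonglongrightarrow> H x \<omega>" if "convergent (\<lambda>n. G n x \<omega>)" for x \<omega>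
    using that unfolding H_def by (rule convergent_LIMSEQ_iff[THEN iffD1])
  \<comment> \<open>The mass that the limiting distribution function leaves outside the interval
    from \<open>- real R\<close> to \<open>real R\<close>, including what has escaped to
    infinity.\<close>
  define tl where "tl R \<omega> = 1 - H (real R) \<omega> + H (- real R) \<omega>" for R :: nat and \<omega>
  have tl_meas[measurable]: "tl R \<in> borel_measurable M" for R unfolding tl_def by measurable
  have tl_lim: "AE \<omega> in M. \<forall>R. (\<lambda>n. 1 - G n (real R) \<omega> + G n (- real R) \<omega>) \<longlonglongrightarrow> tl R \<omega>"
    using conv_AE
  proof eventually_elim
    case (elim \<omega>)
    show ?case unfolding tl_def
      by (intro allI tendsto_intros H_lim) (use elim in auto)
  qed
  have Gd_bd: "\<bar>1 - G n (real R) \<omega> + G n (- real R) \<omega>\<bar> \<le> 1" for n R \<omega>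
    using G_bd(2)[of n "real R" \<omega>] G_bd(1)[of n "- real R" \<omega>] G_mono[of "- real R" "real R" n \<omega>] by simp
  have tl_int: "integrable M (tl R)" for R
  proof (rule integrable_const_bound[where B = 1])
    show "AE \<omega> in M. norm (tl R \<omega>) \<le> 1"
      using tl_lim
    proof eventually_elim
      case (elim \<omega>)
      then have "(\<lambda>n. \<bar>1 - G n (real R) \<omega> + G n (- real R) \<omega>\<bar>) \<longlonglongrightarrow> \<bar>tl R \<omega>\<bar>"
        by (intro tendsto_intros) auto
      then show ?case using Gd_bd[of _ R \<omega>] by (auto intro: LIMSEQ_le_const2)
    qed
  qed simp
  have tl_small: "\<exists>R. (\<integral>\<omega>. tl R \<omega> \<partial>M) \<le> e" if e: "0 < e" for e
  proof -
    obtain R :: nat where R: "\<And>m. (\<Sum>j\<le>m. prob {\<omega> \<in> space M. real R \<le> \<bar>X j \<omega>\<bar>}) \<le> e * real (Suc m)"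
      using tight[OF e] by auto
    have ind: "integrable M (\<lambda>\<omega>. of_bool (real R \<le> \<bar>X j \<omega>\<bar>) :: real)" for j
      by (rule integrable_const_bound[where B = 1]) (auto simp: of_bool_def)
    have ind_int: "(\<integral>\<omega>. of_bool (real R \<le> \<bar>X j \<omega>\<bar>) \<partial>M) = prob {\<omega> \<in> space M. real R \<le> \<bar>X j \<omega>\<bar>}" for j
    proof -
      have "(\<integral>\<omega>. of_bool (real R \<le> \<bar>X j \<omega>\<bar>) \<partial>M) = (\<integral>\<omega>. indicator {\<omega> \<in> space M. real R \<le> \<bar>X j \<omega>\<bar>} \<omega> \<partial>M)"
        by (rule Bochner_Integration.integral_cong) (auto simp: indicator_def)
      also have "\<dots> = prob ({\<omega> \<in> space M. real R \<le> \<bar>X j \<omega>\<bar>} \<inter> space M)"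
        by (rule Bochner_Integration.integral_indicator)
      also have "{\<omega> \<in> space M. real R \<le> \<bar>X j \<omega>\<bar>} \<inter> space M = {\<omega> \<in> space M. real R \<le> \<bar>X j \<omega>\<bar>}" by auto
      finally show ?thesis .
    qed
    have le: "(\<integral>\<omega>. 1 - G n (real R) \<omega> + G n (- real R) \<omega> \<partial>M) \<le> e" for n
    proof -
      have "(\<integral>\<omega>. 1 - G n (real R) \<omega> + G n (- real R) \<omega> \<partial>M) \<le> (\<integral>\<omega>. (\<Sum>j\<le>K n. b n j * of_bool (real R \<le> \<bar>X j \<omega>\<bar>)) \<partial>M)"
      proof (rule integral_mono)
        show "integrable M (\<lambda>\<omega>. 1 - G n (real R) \<omega> + G n (- real R) \<omega>)"
          by (rule integrable_const_bound[where B = 1]) (use Gd_bd in auto)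
        show "integrable M (\<lambda>\<omega>. (\<Sum>j\<le>K n. b n j * of_bool (real R \<le> \<bar>X j \<omega>\<bar>)))"
          by (intro Bochner_Integration.integrable_sum integrable_mult_right ind)
        fix \<omega>
        \<comment> \<open>The left side is the weighted frequency of
          \<open>X j \<omega> > real R\<close> or \<open>X j \<omega> \<le> - real R\<close>; both
          imply \<open>real R \<le> \<bar>X j \<omega>\<bar>\<close>.\<close>
        have "1 - G n (real R) \<omega> + G n (- real R) \<omega>
            = (\<Sum>j\<le>K n. b n j * (1 - of_bool (X j \<omega> \<le> real R) + of_bool (X j \<omega> \<le> - real R)))"
          unfolding G_def
          by (simp add: b_sum algebra_simps sum.distrib sum_subtractf)
        also have "\<dots> \<le> (\<Sum>j\<le>K n. b n j * of_bool (real R \<le> \<bar>X j \<omega>\<bar>))"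
          by (intro sum_mono mult_left_mono b_nn) (auto simp: of_bool_def)
        finally show "1 - G n (real R) \<omega> + G n (- real R) \<omega> \<le> (\<Sum>j\<le>K n. b n j * of_bool (real R \<le> \<bar>X j \<omega>\<bar>))" .
      qed
      also have "\<dots> = (\<Sum>j\<le>K n. b n j * prob {\<omega> \<in> space M. real R \<le> \<bar>X j \<omega>\<bar>})"
        by (subst Bochner_Integration.integral_sum) (auto intro: ind simp: ind_int)
      also have "\<dots> \<le> e" by (rule cesaro_weights_bound[OF b R])
      finally show ?thesis .
    qed
    have "(\<lambda>n. \<integral>\<omega>. 1 - G n (real R) \<omega> + G n (- real R) \<omega> \<partial>M) \<longlonglongrightarrow> (\<integral>\<omega>. tl R \<omega> \<partial>M)"
      by (rule integral_dominated_convergence[where w = "\<lambda>_. 1"])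
         (use tl_lim Gd_bd in \<open>auto elim: eventually_mono\<close>)
    then have "(\<integral>\<omega>. tl R \<omega> \<partial>M) \<le> e" by (rule LIMSEQ_le_const2) (use le in auto)
    then show ?thesis by blast
  qed
  have tl_nn: "AE \<omega> in M. \<forall>R. 0 \<le> tl R \<omega>"
    using tl_lim
  proof eventually_elim
    case (elim \<omega>)
    have "0 \<le> 1 - G n (real R) \<omega> + G n (- real R) \<omega>" for n R
      using G_bd(2)[of n "real R" \<omega>] G_bd(1)[of n "- real R" \<omega>] by linarith
    then show ?case using elim by (auto intro: LIMSEQ_le_const)
  qed
  \<comment> \<open>No fixed \<open>R\<close> serves every \<open>\<omega>\<close>, but the infimum
    over \<open>R\<close> has expectation zero and thus vanishes almost surely.\<close>
  have small: "(\<integral>\<^sup>+\<omega>. (INF R. ennreal (tl R \<omega>)) \<partial>M) \<le> ennreal e" if e: "0 < e" for e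
  proof -
    obtain R where R: "(\<integral>\<omega>. tl R \<omega> \<partial>M) \<le> e" using tl_small[OF e] by blast
    have "(\<integral>\<^sup>+\<omega>. (INF R. ennreal (tl R \<omega>)) \<partial>M) \<le> (\<integral>\<^sup>+\<omega>. ennreal (tl R \<omega>) \<partial>M)"
      by (intro nn_integral_mono INF_lower) auto
    also have "\<dots> = ennreal (\<integral>\<omega>. tl R \<omega> \<partial>M)"
      by (rule nn_integral_eq_integral[OF tl_int]) (use tl_nn in \<open>auto elim: eventually_mono\<close>)
    finally show ?thesis using R by (meson ennreal_leI order_trans)
  qed
  have "(\<integral>\<^sup>+\<omega>. (INF R. ennreal (tl R \<omega>)) \<partial>M) \<le> 0"
    by (rule ennreal_le_epsilon) (use small in simp)
  then have "(\<integral>\<^sup>+\<omega>. (INF R. ennreal (tl R \<omega>)) \<partial>M) = 0" by simp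
  then have "AE \<omega> in M. (INF R. ennreal (tl R \<omega>)) = 0"
    by (subst (asm) nn_integral_0_iff_AE) simp_all
  then have tight_AE: "AE \<omega> in M. \<forall>e>0. \<exists>R. tl R \<omega> < e"
  proof eventually_elim
    case (elim \<omega>)
    show ?case
    proof (intro allI impI)
      fix e :: real assume "0 < e"
      then have "(INF R. ennreal (tl R \<omega>)) < ennreal e" using elim by simp
      then obtain R where "ennreal (tl R \<omega>) < ennreal e" unfolding INF_less_iff by blast
      then show "\<exists>R. tl R \<omega> < e" using ennreal_leI[of e "tl R \<omega>"] by (auto simp: not_le[symmetric])
    qed
  qed
  have "AE \<omega> in M. (\<forall>x\<in>\<rat>. convergent (\<lambda>n. G n x \<omega>)) \<and> (\<forall>e>0. \<exists>R. tl R \<omega> < e)"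
    using conv_AE tight_AE by eventually_elim auto
  then obtain N where N: "{\<omega> \<in> space M. \<not> ((\<forall>x\<in>\<rat>. convergent (\<lambda>n. G n x \<omega>)) \<and> (\<forall>e>0. \<exists>R. tl R \<omega> < e))} \<subseteq> N"
    "emeasure M N = 0" "N \<in> sets M"
    by (rule AE_E)
  note [measurable] = N(3)
  have good: "(\<lambda>n. G n x \<omega>) \<longlonglongrightarrow> H x \<omega>" if "\<omega> \<in> space M" "\<omega> \<notin> N" "x \<in> \<rat>" for \<omega> x
    using that N(1) by (auto intro: H_lim)
  have good_tl: "\<exists>R. tl R \<omega> < e" if "\<omega> \<in> space M" "\<omega> \<notin> N" "0 < e" for \<omega> e
    using that N(1) by blast
  have H_mono: "H x \<omega> \<le> H y \<omega>" if "\<omega> \<in> space M" "\<omega> \<notin> N" "x \<in> \<rat>" "y \<in> \<rat>" "x \<le> y" for \<omega> x y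
    by (rule LIMSEQ_le[OF good good]) (use that G_mono in auto)
  have H_bd: "0 \<le> H x \<omega>" "H x \<omega> \<le> 1" if "\<omega> \<in> space M" "\<omega> \<notin> N" "x \<in> \<rat>" for \<omega> x
    using LIMSEQ_le_const[OF good[OF that], of 0] LIMSEQ_le_const2[OF good[OF that], of 1] G_bd by auto
  \<comment> \<open>Quantile function over rational arguments. The strict inequality turns
    \<open>D < y\<close> into a countable union, which yields joint measurability and the comparison
    with \<open>H\<close>. The value 0 on the exceptional set is arbitrary.\<close>
  define D where "D = (\<lambda>(\<omega>, u). if \<omega> \<in> N \<or> u \<le> 0 \<or> 1 \<le> u then 0 else Inf {x \<in> \<rat>. u < H x \<omega>})"
  have D_less: "D (\<omega>, u) < y \<longleftrightarrow> (\<exists>x\<in>\<rat>. x < y \<and> u < H x \<omega>)"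
    if \<omega>: "\<omega> \<in> space M" "\<omega> \<notin> N" and u: "0 < u" "u < 1" for \<omega> u y
  proof -
    \<comment> \<open>A tail below \<open>1 - u\<close> makes the set of admissible rationals
      nonempty; a tail below \<open>u\<close>, used next, bounds it from below.\<close>
    obtain R1 where R1: "tl R1 \<omega> < 1 - u" using good_tl[OF \<omega>, of "1 - u"] u by auto
    have "u < H (real R1) \<omega>" using R1 H_bd(1)[OF \<omega>, of "- real R1"] unfolding tl_def by auto
    then have ne: "{x \<in> \<rat>. u < H x \<omega>} \<noteq> {}" by (auto intro!: exI[of _ "real R1"])
    obtain R2 where R2: "tl R2 \<omega> < u" using good_tl[OF \<omega> u(1)] by auto
    have R2': "H (- real R2) \<omega> < u" using R2 H_bd(2)[OF \<omega>, of "real R2"] unfolding tl_def by auto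
    have "- real R2 \<le> x" if "x \<in> \<rat>" "u < H x \<omega>" for x
    proof (rule ccontr)
      assume "\<not> - real R2 \<le> x"
      then have "H x \<omega> \<le> H (- real R2) \<omega>" using that by (intro H_mono[OF \<omega>]) auto
      then show False using R2' that by simp
    qed
    then have "bdd_below {x \<in> \<rat>. u < H x \<omega>}" by (intro bdd_belowI[of _ "- real R2"]) auto
    from cInf_less_iff[OF ne this] show ?thesis using u \<omega> by (auto simp: D_def)
  qed
  have D_meas[measurable]: "D \<in> borel_measurable (M \<Otimes>\<^sub>M unit_uniform)"
  proof (rule borel_measurableI_less)
    fix y :: real
    have "{z \<in> space (M \<Otimes>\<^sub>M unit_uniform). D z < y} =
        {z \<in> space (M \<Otimes>\<^sub>M unit_uniform). if fst z \<in> N \<or> snd z \<le> 0 \<or> 1 \<le> snd z then 0 < y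
           else \<exists>i. q i < y \<and> snd z < H (q i) (fst z)}" (is "?L = ?R")
    proof (rule Collect_cong, rule conj_cong[OF refl])
      fix z assume z: "z \<in> space (M \<Otimes>\<^sub>M unit_uniform)"
      obtain \<omega> u where zz: "z = (\<omega>, u)" by (cases z)
      have \<omega>: "\<omega> \<in> space M" using z zz by (simp add: space_pair_measure)
      show "(D z < y) = (if fst z \<in> N \<or> snd z \<le> 0 \<or> 1 \<le> snd z then 0 < y
           else \<exists>i. q i < y \<and> snd z < H (q i) (fst z))"
      proof (cases "\<omega> \<in> N \<or> u \<le> 0 \<or> 1 \<le> u")
        case True then show ?thesis by (simp add: zz D_def)
      next
        case False
        then have "D (\<omega>, u) < y \<longleftrightarrow> (\<exists>x\<in>\<rat>. x < y \<and> u < H x \<omega>)" by (intro D_less \<omega>) auto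
        also have "\<dots> \<longleftrightarrow> (\<exists>i. q i < y \<and> u < H (q i) \<omega>)" unfolding q_range[symmetric] by auto
        finally show ?thesis using False by (simp add: zz)
      qed
    qed
    also have "\<dots> \<in> sets (M \<Otimes>\<^sub>M unit_uniform)" by measurable
    finally show "?L \<in> sets (M \<Otimes>\<^sub>M unit_uniform)" .
  qed
  have wc: "weak_conv_m (\<lambda>n. weighted_points (K n) (b n) (\<lambda>j. X j \<omega>)) (distr unit_uniform borel (\<lambda>u. D (\<omega>, u)))"
    if \<omega>: "\<omega> \<in> space M" "\<omega> \<notin> N" for \<omega>
  proof (rule weak_conv_m_quantile[where H = "\<lambda>x. H x \<omega>"])
    have [measurable]: "(\<lambda>u. D (\<omega>, u)) \<in> borel_measurable unit_uniform"
      using \<omega>(1) by measurable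
    show "real_distribution (weighted_points (K n) (b n) (\<lambda>j. X j \<omega>))" for n
      by (rule real_distribution_weighted_points[OF b_nn b_sum])
    show "real_distribution (distr unit_uniform borel (\<lambda>u. D (\<omega>, u)))"
      by (rule U.real_distribution_distr) measurable
    have cdf: "cdf (distr unit_uniform borel (\<lambda>u. D (\<omega>, u))) y = U.prob {u. D (\<omega>, u) \<le> y}" for y
      unfolding cdf_def by (subst measure_distr) (auto simp: vimage_def)
    have [measurable]: "{u. D (\<omega>, u) \<le> y} \<in> U.events" for y
    proof -
      have "{u \<in> space unit_uniform. D (\<omega>, u) \<le> y} \<in> U.events" by measurable
      then show ?thesis by simp
    qed
    show "(\<lambda>n. cdf (weighted_points (K n) (b n) (\<lambda>j. X j \<omega>)) x) \<longlonglongrightarrow> H x \<omega>" if "x \<in> \<rat>" for x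
      using good[OF \<omega> that] by (simp add: cdf_weighted_points[OF b_nn b_sum] G_def)
    show "H x \<omega> \<le> cdf (distr unit_uniform borel (\<lambda>u. D (\<omega>, u))) y" if "x \<in> \<rat>" "x < y" for x y
    proof -
      have "H x \<omega> = U.prob {0<..<H x \<omega>}" using measure_unit_uniform H_bd[OF \<omega> that(1)] by simp
      also have "\<dots> \<le> U.prob {u. D (\<omega>, u) \<le> y}"
      proof (rule U.finite_measure_mono)
        show "{0<..<H x \<omega>} \<subseteq> {u. D (\<omega>, u) \<le> y}"
        proof
          fix u assume u: "u \<in> {0<..<H x \<omega>}"
          then have "D (\<omega>, u) < y"
            using H_bd[OF \<omega> that(1)] that by (subst D_less[OF \<omega>]) auto
          then show "u \<in> {u. D (\<omega>, u) \<le> y}" by simp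
        qed
      qed measurable
      finally show ?thesis by (simp add: cdf)
    qed
    show "cdf (distr unit_uniform borel (\<lambda>u. D (\<omega>, u))) y \<le> H x \<omega>" if "x \<in> \<rat>" "y < x" for x y
    proof -
      have "U.prob {u. D (\<omega>, u) \<le> y} \<le> U.prob {0<..<H x \<omega>}"
      proof (rule U.finite_measure_mono_AE)
        show "AE u in unit_uniform. u \<in> {u. D (\<omega>, u) \<le> y} \<longrightarrow> u \<in> {0<..<H x \<omega>}"
          using AE_unit_uniform
        proof eventually_elim
          case (elim u)
          show ?case
          proof
            assume "u \<in> {u. D (\<omega>, u) \<le> y}"
            then have "D (\<omega>, u) < x" using that by simp
            then obtain x' where "x' \<in> \<rat>" "x' < x" "u < H x' \<omega>" using D_less[OF \<omega>] elim by auto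
            then show "u \<in> {0<..<H x \<omega>}" using H_mono[OF \<omega>, of x' x] that elim by auto
          qed
        qed
      qed simp
      also have "\<dots> = H x \<omega>" using measure_unit_uniform H_bd[OF \<omega> that(1)] by simp
      finally show ?thesis by (simp add: cdf)
    qed
  qed
  show thesis
  proof (rule that[of b K D])
    show "b n \<in> cesaro_weights n (K n)" for n by (rule b)
    show "D \<in> borel_measurable (M \<Otimes>\<^sub>M unit_uniform)" by (rule D_meas)
    fix f :: "'a \<times> real \<Rightarrow> real" and B
    assume f[measurable]: "f \<in> borel_measurable (M \<Otimes>\<^sub>M borel)"
      and f_bd: "\<And>\<omega> x. \<omega> \<in> space M \<Longrightarrow> \<bar>f (\<omega>, x)\<bar> \<le> B"
      and f_cont: "\<And>\<omega>. \<omega> \<in> space M \<Longrightarrow> continuous_on UNIV (\<lambda>x. f (\<omega>, x))"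
    \<comment> \<open>Weak convergence is used for each fixed \<open>\<omega>\<close>; the outer
      integral follows by dominated convergence.\<close>
    have lim_\<omega>: "(\<lambda>n. \<Sum>j\<le>K n. b n j * f (\<omega>, X j \<omega>)) \<longlonglongrightarrow> (\<integral>u. f (\<omega>, D (\<omega>, u)) \<partial>unit_uniform)"
      if \<omega>: "\<omega> \<in> space M" "\<omega> \<notin> N" for \<omega>
    proof -
      have [measurable]: "(\<lambda>u. D (\<omega>, u)) \<in> borel_measurable unit_uniform" "(\<lambda>x. f (\<omega>, x)) \<in> borel_measurable borel"
        using \<omega>(1) by measurable
      have "(\<lambda>n. integral\<^sup>L (weighted_points (K n) (b n) (\<lambda>j. X j \<omega>)) (\<lambda>x. f (\<omega>, x)))
          \<longlonglongrightarrow> integral\<^sup>L (distr unit_uniform borel (\<lambda>u. D (\<omega>, u))) (\<lambda>x. f (\<omega>, x))"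
        by (rule weak_conv_imp_integral_bdd_continuous_conv[OF _ _ wc[OF \<omega>], where B = B])
           (use f_cont[OF \<omega>(1)] f_bd[OF \<omega>(1)] in
             \<open>auto intro!: real_distribution_weighted_points b_nn b_sum U.real_distribution_distr simp: continuous_on_eq_continuous_at\<close>)
      then show ?thesis
        by (simp add: integral_weighted_points[OF b_nn b_sum] integral_distr)
    qed
    have int: "integrable M (\<lambda>\<omega>. f (\<omega>, X j \<omega>))" for j
      by (rule integrable_const_bound[where B = B]) (use f_bd in auto)
    have "(\<lambda>n. \<integral>\<omega>. (\<Sum>j\<le>K n. b n j * f (\<omega>, X j \<omega>)) \<partial>M) \<longlonglongrightarrow> (\<integral>\<omega>. \<integral>u. f (\<omega>, D (\<omega>, u)) \<partial>unit_uniform \<partial>M)"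
    proof (rule integral_dominated_convergence[where w = "\<lambda>_. B"])
      show "(\<lambda>\<omega>. \<integral>u. f (\<omega>, D (\<omega>, u)) \<partial>unit_uniform) \<in> borel_measurable M" by measurable
      have "AE \<omega> in M. \<omega> \<notin> N" using N by (intro AE_not_in) (auto simp: null_sets_def)
      then show "AE \<omega> in M. (\<lambda>n. \<Sum>j\<le>K n. b n j * f (\<omega>, X j \<omega>)) \<longlonglongrightarrow> (\<integral>u. f (\<omega>, D (\<omega>, u)) \<partial>unit_uniform)"
        using AE_space by eventually_elim (rule lim_\<omega>)
      show "AE \<omega> in M. norm (\<Sum>j\<le>K n. b n j * f (\<omega>, X j \<omega>)) \<le> B" for n
      proof (rule AE_I2)
        fix \<omega> assume \<omega>: "\<omega> \<in> space M"
        have "\<bar>\<Sum>j\<le>K n. b n j * f (\<omega>, X j \<omega>)\<bar> \<le> (\<Sum>j\<le>K n. \<bar>b n j * f (\<omega>, X j \<omega>)\<bar>)" by (rule sum_abs)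
        also have "\<dots> \<le> (\<Sum>j\<le>K n. b n j * B)"
          unfolding abs_mult using b_nn f_bd[OF \<omega>] by (intro sum_mono mult_mono) auto
        also have "\<dots> = B" by (simp add: b_sum flip: sum_distrib_right)
        finally show "norm (\<Sum>j\<le>K n. b n j * f (\<omega>, X j \<omega>)) \<le> B" by simp
      qed
    qed auto
    moreover have "(\<integral>\<omega>. (\<Sum>j\<le>K n. b n j * f (\<omega>, X j \<omega>)) \<partial>M) = (\<Sum>j\<le>K n. b n j * (\<integral>\<omega>. f (\<omega>, X j \<omega>) \<partial>M))" for n
      by (subst Bochner_Integration.integral_sum) (auto intro: int)
    ultimately show "(\<lambda>n. \<Sum>j\<le>K n. b n j * (\<integral>\<omega>. f (\<omega>, X j \<omega>) \<partial>M)) \<longlonglongrightarrow> (\<integral>\<omega>. \<integral>u. f (\<omega>, D (\<omega>, u)) \<partial>unit_uniform \<partial>M)"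
      by simp
  qed
qed

section \<open>Laws determined by test functions continuous in the real coordinate\<close>

lemma cts_step_LIMSEQ: "(\<lambda>n. cts_step x (x + 1 / real (Suc n)) y) \<longlonglongrightarrow> indicator {..x} y"
proof (cases "y \<le> x")
  case False
  then have "eventually (\<lambda>n. inverse (real (Suc n)) < y - x) sequentially"
    by (intro order_tendstoD(2)[OF LIMSEQ_inverse_real_of_nat]) simp
  then have "eventually (\<lambda>n. cts_step x (x + 1 / real (Suc n)) y = indicator {..x} y) sequentially"
    by eventually_elim (use False in \<open>auto simp: cts_step_def inverse_eq_divide\<close>)
  then show ?thesis by (rule tendsto_eventually)
qed (simp add: cts_step_def)

lemma cts_step_bound: "a < b \<Longrightarrow> 0 \<le> cts_step a b x \<and> cts_step a b x \<le> 1"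
  by (auto simp: cts_step_def divide_simps)

lemma continuous_on_cts_step: "a < b \<Longrightarrow> continuous_on UNIV (cts_step a b)"
  by (intro uniformly_continuous_imp_continuous cts_step_uniformly_continuous)

text \<open>Weak limits control only functions continuous in the gap. That is enough: continuous
  steps decrease to half lines, half lines determine the measure on rectangles over a fixed
  \<open>A\<close>, and rectangles generate.\<close>

lemma measure_pair_real_eqI:
  fixes L L' :: "('b \<times> real) measure"
  assumes "prob_space L" "prob_space L'"
    and sets: "sets L = sets (S \<Otimes>\<^sub>M borel)" "sets L' = sets (S \<Otimes>\<^sub>M borel)"
    and eq: "\<And>A (\<psi> :: real \<Rightarrow> real). A \<in> sets S \<Longrightarrow> continuous_on UNIV \<psi> \<Longrightarrow> (\<And>x. \<bar>\<psi> x\<bar> \<le> 1) \<Longrightarrow>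
      (\<integral>z. indicator A (fst z) * \<psi> (snd z) \<partial>L) = (\<integral>z. indicator A (fst z) * \<psi> (snd z) \<partial>L')"
  shows "L = L'"
proof -
  have sp: "space L = space S \<times> UNIV" "space L' = space S \<times> UNIV"
    using sets_eq_imp_space_eq[OF sets(1)] sets_eq_imp_space_eq[OF sets(2)] by (auto simp: space_pair_measure)
  have half: "(\<lambda>n. \<integral>z. indicator A (fst z) * cts_step x (x + 1 / real (Suc n)) (snd z) \<partial>Q) \<longlonglongrightarrow> measure Q (A \<times> {..x})"
    if Q: "prob_space Q" and sQ: "sets Q = sets (S \<Otimes>\<^sub>M borel)" and A[measurable]: "A \<in> sets S" for Q A x
  proof -
    interpret Q: prob_space Q by (rule Q)
    note [measurable_cong] = sQ
    have [measurable]: "cts_step x (x + 1 / real (Suc n)) \<in> borel_measurable borel" for n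
      by (intro borel_measurable_continuous_onI continuous_on_cts_step) simp
    have "(\<lambda>n. \<integral>z. indicator A (fst z) * cts_step x (x + 1 / real (Suc n)) (snd z) \<partial>Q)
        \<longlonglongrightarrow> (\<integral>z. (indicator A (fst z) * indicator {..x} (snd z) :: real) \<partial>Q)"
    proof (rule integral_dominated_convergence[where w = "\<lambda>_. 1"])
      show "AE z in Q. (\<lambda>n. indicator A (fst z) * cts_step x (x + 1 / real (Suc n)) (snd z))
          \<longlonglongrightarrow> indicator A (fst z) * indicator {..x} (snd z)"
        by (intro AE_I2 tendsto_mult tendsto_const cts_step_LIMSEQ)
      show "AE z in Q. norm (indicator A (fst z) * cts_step x (x + 1 / real (Suc n)) (snd z)) \<le> 1" for n
        using cts_step_bound[of x "x + 1 / real (Suc n)"] by (auto split: split_indicator)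
      show "(\<lambda>z. indicator A (fst z) * cts_step x (x + 1 / real (Suc n)) (snd z)) \<in> borel_measurable Q" for n
        by measurable
      show "(\<lambda>z. indicator A (fst z) * indicator {..x} (snd z) :: real) \<in> borel_measurable Q"
        by measurable
    qed simp
    also have "(\<integral>z. (indicator A (fst z) * indicator {..x} (snd z) :: real) \<partial>Q) = (\<integral>z. (indicator (A \<times> {..x}) z :: real) \<partial>Q)"
      by (rule Bochner_Integration.integral_cong) (auto split: split_indicator)
    also have "\<dots> = measure Q ((A \<times> {..x}) \<inter> space Q)" by (rule Bochner_Integration.integral_indicator)
    also have "(A \<times> {..x}) \<inter> space Q = A \<times> {..x}"
      using sets.sets_into_space[OF A] sets_eq_imp_space_eq[OF sQ] by (auto simp: space_pair_measure)
    finally show ?thesis .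
  qed
  have atMost: "measure L (A \<times> {..x}) = measure L' (A \<times> {..x})" if A: "A \<in> sets S" for A x
  proof (rule LIMSEQ_unique[OF half[OF assms(1) sets(1) A]])
    have "(\<integral>z. indicator A (fst z) * cts_step x (x + 1 / real (Suc n)) (snd z) \<partial>L)
        = (\<integral>z. indicator A (fst z) * cts_step x (x + 1 / real (Suc n)) (snd z) \<partial>L')" for n
      by (rule eq[where \<psi> = "cts_step x (x + 1 / real (Suc n))", OF A continuous_on_cts_step])
         (use cts_step_bound[of x "x + 1 / real (Suc n)"] in auto)
    then show "(\<lambda>n. \<integral>z. indicator A (fst z) * cts_step x (x + 1 / real (Suc n)) (snd z) \<partial>L) \<longlonglongrightarrow> measure L' (A \<times> {..x})"
      using half[OF assms(2) sets(2) A] by simp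
  qed
  \<comment> \<open>The mass of \<open>A \<times> B\<close> as a finite measure in \<open>B\<close>,
    so that equal distribution functions settle all Borel \<open>B\<close>.\<close>
  define slice where "slice Q A = distr (density Q (indicator (A \<times> UNIV))) borel snd" for Q :: "('b \<times> real) measure" and A
  have slice: "finite_borel_measure (slice Q A)" "B \<in> sets borel \<Longrightarrow> emeasure (slice Q A) B = emeasure Q (A \<times> B)"
    if Q: "prob_space Q" and sQ: "sets Q = sets (S \<Otimes>\<^sub>M borel)" and A[measurable]: "A \<in> sets S" for Q A B
  proof -
    interpret Q: prob_space Q by (rule Q)
    note [measurable_cong] = sQ
    have e: "emeasure (slice Q A) B = emeasure Q (A \<times> B)" if [measurable]: "B \<in> sets borel" for B
    proof -
      have "emeasure (slice Q A) B = emeasure (density Q (indicator (A \<times> UNIV))) (snd -` B \<inter> space Q)"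
        unfolding slice_def by (subst emeasure_distr) auto
      also have "\<dots> = (\<integral>\<^sup>+z. indicator (A \<times> UNIV) z * indicator (snd -` B \<inter> space Q) z \<partial>Q)"
        by (rule emeasure_density) auto
      also have "\<dots> = (\<integral>\<^sup>+z. indicator (A \<times> B) z \<partial>Q)"
        by (intro nn_integral_cong) (auto split: split_indicator)
      also have "\<dots> = emeasure Q (A \<times> B)"
        by (rule nn_integral_indicator) measurable
      finally show ?thesis .
    qed
    then show "B \<in> sets borel \<Longrightarrow> emeasure (slice Q A) B = emeasure Q (A \<times> B)" .
    have "finite_measure (slice Q A)"
      by (rule finite_measureI) (use e[of UNIV] in \<open>simp add: slice_def Q.emeasure_finite\<close>)
    then show "finite_borel_measure (slice Q A)"
      by (intro finite_borel_measure.intro finite_borel_measure_axioms.intro) (auto simp: slice_def)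
  qed
  have rect: "emeasure L (A \<times> B) = emeasure L' (A \<times> B)" if A: "A \<in> sets S" and B: "B \<in> sets borel" for A B
  proof -
    have "cdf (slice L A) = cdf (slice L' A)"
      unfolding cdf_def measure_def
      using atMost[OF A] by (simp add: fun_eq_iff slice(2)[OF assms(1) sets(1) A] slice(2)[OF assms(2) sets(2) A] measure_def)
    then have "slice L A = slice L' A"
      by (intro cdf_unique' slice(1)[OF assms(1) sets(1) A] slice(1)[OF assms(2) sets(2) A])
    then show ?thesis
      using slice(2)[OF assms(1) sets(1) A B] slice(2)[OF assms(2) sets(2) A B] by simp
  qed
  interpret L': prob_space L' by (rule assms)
  show ?thesis
  proof (rule measure_eqI_generator_eq[OF Int_stable_pair_measure_generator[of S borel],
        where \<Omega> = "space S \<times> UNIV" and A = "\<lambda>_. space S \<times> UNIV"])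
    show "{a \<times> b |a b. a \<in> sets S \<and> b \<in> sets (borel :: real measure)} \<subseteq> Pow (space S \<times> UNIV)"
      using pair_measure_closed[of S "borel :: real measure"] by simp
    show "sets L = sigma_sets (space S \<times> UNIV) {a \<times> b |a b. a \<in> sets S \<and> b \<in> sets (borel :: real measure)}"
      "sets L' = sigma_sets (space S \<times> UNIV) {a \<times> b |a b. a \<in> sets S \<and> b \<in> sets (borel :: real measure)}"
      unfolding sets sets_pair_measure by simp_all
    show "range (\<lambda>_::nat. space S \<times> UNIV) \<subseteq> {a \<times> b |a b. a \<in> sets S \<and> b \<in> sets (borel :: real measure)}"
      by (auto intro!: exI[of _ "space S"] exI[of _ "UNIV :: real set"])
  qed (auto simp: rect L'.emeasure_finite)
qed

section \<open>Drift of the gap\<close>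

text \<open>Negative part of the logarithm. Since \<open>ln 0 = 0\<close>, its value at
  \<open>0\<close> is \<open>0\<close> and not infinite: bounds on it say nothing about mass at the
  point \<open>0\<close> itself, which has to be excluded separately.\<close>

definition neg_log :: "real \<Rightarrow> real" where
  "neg_log x = max 0 (- ln \<bar>x\<bar>)"

lemma neg_log_nonneg: "0 \<le> neg_log x"
  by (simp add: neg_log_def)

lemma neg_log_measurable[measurable]: "neg_log \<in> borel_measurable borel"
  unfolding neg_log_def[abs_def] by measurable

text \<open>From \<open>ln y \<le> y - 1\<close> at \<open>y = x powr (-1/4)\<close>, an exponent
  small enough for its square to remain integrable at \<open>0\<close>.\<close>

lemma neg_log_sq_le: "(neg_log x)\<^sup>2 \<le> 16 * (indicator {0..1} x * x powr (-1/2) + indicator {0..1} (-x) * (-x) powr (-1/2))"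
proof -
  have *: "(neg_log x)\<^sup>2 \<le> 16 * x powr (-1/2)" if x: "0 < x" "x \<le> 1" for x :: real
  proof -
    have "ln (x powr (-1/4)) \<le> x powr (-1/4) - 1" using x by (intro ln_le_minus_one) auto
    then have "- ln x \<le> 4 * x powr (-1/4)" using x by (simp add: ln_powr)
    moreover have "ln x \<le> 0" using x by simp
    ultimately have "(- ln x)\<^sup>2 \<le> (4 * x powr (-1/4))\<^sup>2" by (intro power_mono) auto
    also have "\<dots> = 16 * x powr (-1/2)" using x
      by (simp add: power_mult_distrib power2_eq_square flip: powr_add)
    finally show ?thesis using x by (simp add: neg_log_def max_def)
  qed
  show ?thesis
  proof (cases "x = 0 \<or> \<bar>x\<bar> > 1")
    case True
    then have "neg_log x = 0" by (auto simp: neg_log_def max_def)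
    then show ?thesis by simp
  next
    case False
    then consider "0 < x" "x \<le> 1" | "0 < -x" "-x \<le> 1" by linarith
    then show ?thesis
    proof cases
      case 1 then show ?thesis using *[of x] by simp
    next
      case 2
      have "neg_log x = neg_log (-x)" by (simp add: neg_log_def)
      then show ?thesis using 2 *[of "-x"] by simp
    qed
  qed
qed

lemma nn_integral_neg_log_sq_le: "(\<integral>\<^sup>+x. ennreal ((neg_log x)\<^sup>2) \<partial>lborel) \<le> 64"
proof -
  let ?h = "\<lambda>x::real. ennreal (indicator {0..1} x * x powr (-1/2))"
  have I: "(\<integral>\<^sup>+x. ?h x \<partial>lborel) = 2"
  proof -
    have hi: "((\<lambda>x::real. x powr (-1/2)) has_integral 2) {0..1}"
      using has_integral_powr_from_0[of "-1/2" 1] by simp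
    have "(\<integral>\<^sup>+x. ?h x \<partial>lborel) = (\<integral>\<^sup>+x. ennreal (x powr (-1/2)) * indicator {0..1} x \<partial>lborel)"
      by (intro nn_integral_cong) (auto split: split_indicator)
    also have "\<dots> = ennreal 2"
      by (rule nn_integral_has_integral_lebesgue'[OF _ hi]) auto
    finally show ?thesis by simp
  qed
  have I': "(\<integral>\<^sup>+x. ?h (-x) \<partial>lborel) = 2"
    using nn_integral_real_affine[of ?h "-1" 0] I by simp
  have "(\<integral>\<^sup>+x. ennreal ((neg_log x)\<^sup>2) \<partial>lborel) \<le> (\<integral>\<^sup>+x. 16 * (?h x + ?h (-x)) \<partial>lborel)"
  proof (rule nn_integral_mono)
    fix x :: real
    have "ennreal ((neg_log x)\<^sup>2) \<le> ennreal (16 * (indicator {0..1} x * x powr (-1/2) + indicator {0..1} (-x) * (-x) powr (-1/2)))"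
      by (rule ennreal_leI[OF neg_log_sq_le])
    also have "\<dots> = 16 * (?h x + ?h (-x))"
      by (simp add: ennreal_mult ennreal_plus)
    finally show "ennreal ((neg_log x)\<^sup>2) \<le> 16 * (?h x + ?h (-x))" .
  qed
  also have "\<dots> = 16 * (2 + 2)"
    using I I' by (simp add: nn_integral_cmult nn_integral_add)
  finally show ?thesis by simp
qed

lemma nn_integral_neg_log_affine_le:
  assumes "a \<noteq> 0"
  shows "(\<integral>\<^sup>+x. ennreal ((neg_log (b + a * x))\<^sup>2) \<partial>lborel) \<le> ennreal (64 / \<bar>a\<bar>)"
proof -
  let ?f = "\<lambda>x. ennreal ((neg_log x)\<^sup>2)"
  have "ennreal \<bar>a\<bar> * (\<integral>\<^sup>+x. ?f (b + a * x) \<partial>lborel) \<le> 64"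
    using nn_integral_real_affine[of ?f a b] assms nn_integral_neg_log_sq_le by simp
  then have "ennreal (1 / \<bar>a\<bar>) * (ennreal \<bar>a\<bar> * (\<integral>\<^sup>+x. ?f (b + a * x) \<partial>lborel)) \<le> ennreal (1 / \<bar>a\<bar>) * 64"
    by (rule mult_left_mono) simp
  then show ?thesis
    using assms by (simp add: ennreal_mult[symmetric] mult.assoc[symmetric] flip: ennreal_numeral)
qed

lemma ln_abs_sq_le: "(ln \<bar>y\<bar>)\<^sup>2 \<le> (neg_log y)\<^sup>2 + y\<^sup>2" for y :: real
proof (cases "1 \<le> \<bar>y\<bar>")
  case True
  then have "0 \<le> ln \<bar>y\<bar>" "ln \<bar>y\<bar> \<le> \<bar>y\<bar>" using ln_le_minus_one[of "\<bar>y\<bar>"] by simp_all linarith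
  then have "(ln \<bar>y\<bar>)\<^sup>2 \<le> \<bar>y\<bar>\<^sup>2" by (intro power_mono)
  then show ?thesis by (simp add: add_increasing)
next
  case False
  then have "ln \<bar>y\<bar> \<le> 0" by (cases "y = 0") auto
  then show ?thesis by (simp add: neg_log_def max_def)
qed

lemma neg_log_antimono: "0 < \<bar>x\<bar> \<Longrightarrow> \<bar>x\<bar> \<le> \<bar>y\<bar> \<Longrightarrow> neg_log y \<le> neg_log x"
  unfolding neg_log_def by (intro max.mono) auto

text \<open>The cut-off at \<open>e\<close> removes the singularity; this allows expected logarithms
  at nearby slopes to be compared.\<close>

lemma ln_max_lipschitz:
  fixes x y e :: real
  assumes "0 < e"
  shows "\<bar>ln (max x e) - ln (max y e)\<bar> \<le> \<bar>x - y\<bar> / e"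
proof -
  have *: "ln a - ln b \<le> \<bar>a - b\<bar> / e" if "e \<le> a" "e \<le> b" for a b
  proof -
    have "ln a - ln b = ln (a / b)" using that assms by (simp add: ln_div)
    also have "\<dots> \<le> a / b - 1" using that assms by (intro ln_le_minus_one) simp
    also have "\<dots> = (a - b) / b" using that assms by (simp add: field_simps)
    also have "\<dots> \<le> \<bar>a - b\<bar> / b" using that assms by (intro divide_right_mono) auto
    also have "\<dots> \<le> \<bar>a - b\<bar> / e" using that assms by (intro divide_left_mono) auto
    finally show ?thesis .
  qed
  have "\<bar>max x e - max y e\<bar> / e \<le> \<bar>x - y\<bar> / e"
    using assms by (intro divide_right_mono) auto
  with *[of "max x e" "max y e"] *[of "max y e" "max x e"] show ?thesis
    by (auto simp: abs_minus_commute abs_le_iff)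
qed

text \<open>The gap chain depends on the law of a single innovation only, and
  \<open>\<alpha>\<close> cancels in it. In the application \<open>G\<close> bounds
  \<open>(\<bar>x\<bar> + 1) * g x\<close>, which dominates \<open>g x\<close>.\<close>

locale egarch_noise = P: prob_space P for P :: "real measure" +
  fixes g :: "real \<Rightarrow> real" and G \<beta> \<gamma> \<delta> :: real
  assumes P_density: "P = density lborel (\<lambda>x. ennreal (g x))"
    and g_measurable[measurable]: "g \<in> borel_measurable borel"
    and g_le: "\<And>x. g x \<le> G"
    and second_moment: "integrable P (\<lambda>x. x\<^sup>2)"
    and \<gamma>_ge: "\<bar>\<delta>\<bar> \<le> \<gamma>" and \<beta>_pos: "0 < \<beta>" and \<beta>_less_1: "\<beta> < 1"
    and log_integrable: "integrable P (\<lambda>x. ln \<bar>\<beta> - 1 / 2 * (\<gamma> * \<bar>x\<bar> + \<delta> * x)\<bar>)"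
    and lyapunov_pos: "0 < (\<integral>x. ln \<bar>\<beta> - 1 / 2 * (\<gamma> * \<bar>x\<bar> + \<delta> * x)\<bar> \<partial>P)"
begin

lemma sets_P[measurable_cong, simp]: "sets P = sets borel"
  by (simp add: P_density)

lemma space_P[simp]: "space P = UNIV"
  by (simp add: P_density)

section \<open>Innovation effects under a bounded density\<close>

definition news :: "real \<Rightarrow> real" where
  "news s = \<gamma> * \<bar>s\<bar> + \<delta> * s"

lemma news_measurable[measurable]: "news \<in> borel_measurable borel"
  unfolding news_def[abs_def] by measurable

lemma news_nonneg: "0 \<le> news s"
proof -
  have "\<bar>\<delta> * s\<bar> \<le> \<gamma> * \<bar>s\<bar>" using \<gamma>_ge by (auto simp: abs_mult intro: mult_right_mono)
  then show ?thesis unfolding news_def by linarith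
qed

lemma news_cases: "news s = (\<gamma> + \<delta>) * s \<or> news s = (\<delta> - \<gamma>) * s"
  by (cases "s \<ge> 0") (auto simp: news_def algebra_simps)

lemma news_le: "news s \<le> 2 * \<gamma> * \<bar>s\<bar>"
proof -
  have "\<bar>\<delta> * s\<bar> \<le> \<gamma> * \<bar>s\<bar>" using \<gamma>_ge by (auto simp: abs_mult intro: mult_right_mono)
  then show ?thesis unfolding news_def by linarith
qed

lemma news_sq_integrable: "integrable P (\<lambda>s. (news s)\<^sup>2)"
proof (rule Bochner_Integration.integrable_bound)
  show "integrable P (\<lambda>s. (2 * \<gamma>)\<^sup>2 * s\<^sup>2)" using second_moment by simp
  show "AE s in P. norm ((news s)\<^sup>2) \<le> norm ((2 * \<gamma>)\<^sup>2 * s\<^sup>2)"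
    using power_mono[OF news_le news_nonneg, of _ 2] by (auto simp: power_mult_distrib)
qed simp

lemma news_integrable: "integrable P news"
proof (rule Bochner_Integration.integrable_bound)
  show "integrable P (\<lambda>s. 1 + (news s)\<^sup>2)" using news_sq_integrable by simp
  have "\<bar>news s\<bar> \<le> 1 + (news s)\<^sup>2" for s
    using zero_le_power2[of "news s - 1"] news_nonneg[of s] zero_le_power2[of "news s"]
    by (simp add: power2_diff)
  then show "AE s in P. norm (news s) \<le> norm (1 + (news s)\<^sup>2)" by (auto intro: order_trans)
qed simp

lemma nn_integral_P_le:
  assumes [measurable]: "f \<in> borel_measurable borel"
  shows "(\<integral>\<^sup>+x. f x \<partial>P) \<le> ennreal G * (\<integral>\<^sup>+x. f x \<partial>lborel)"
proof -
  have "(\<integral>\<^sup>+x. f x \<partial>P) = (\<integral>\<^sup>+x. ennreal (g x) * f x \<partial>lborel)"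
    unfolding P_density by (subst nn_integral_density) auto
  also have "\<dots> \<le> (\<integral>\<^sup>+x. ennreal G * f x \<partial>lborel)"
    by (intro nn_integral_mono mult_right_mono ennreal_leI g_le) simp
  also have "\<dots> = ennreal G * (\<integral>\<^sup>+x. f x \<partial>lborel)"
    by (rule nn_integral_cmult) simp
  finally show ?thesis .
qed

lemma G_nonneg: "0 \<le> G"
proof (rule ccontr)
  assume "\<not> 0 \<le> G"
  then have "ennreal G = 0" by (simp add: ennreal_neg)
  with nn_integral_P_le[of "\<lambda>_. 1"] P.emeasure_space_1 show False by simp
qed

lemma AE_P_neq: "AE s in P. s \<noteq> c"
proof (rule AE_I)
  show "{s \<in> space P. \<not> s \<noteq> c} \<subseteq> {c}" by auto
  have "emeasure P {c} = (\<integral>\<^sup>+x. indicator {c} x \<partial>P)" by simp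
  also have "\<dots> \<le> ennreal G * (\<integral>\<^sup>+x. indicator {c} x \<partial>lborel)" by (rule nn_integral_P_le) simp
  finally show "emeasure P {c} = 0" by simp
qed simp

text \<open>On each half line \<open>news\<close> is linear, and a zero slope never meets a nonzero
  \<open>c\<close>. For \<open>c = 0\<close> this can fail, namely if
  \<open>\<gamma> = \<bar>\<delta>\<bar>\<close>.\<close>

lemma AE_news_neq:
  assumes "c \<noteq> 0" shows "AE s in P. news s \<noteq> c"
  using AE_P_neq[of "c / (\<gamma> + \<delta>)"] AE_P_neq[of "c / (\<delta> - \<gamma>)"]
proof eventually_elim
  case (elim s)
  show ?case
  proof
    assume c: "news s = c"
    from news_cases[of s] show False
    proof
      assume "news s = (\<gamma> + \<delta>) * s"
      then show False using elim(1) c assms by auto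
    next
      assume "news s = (\<delta> - \<gamma>) * s"
      then show False using elim(2) c assms by auto
    qed
  qed
qed

definition neg_log_const :: real where
  "neg_log_const = G * 64 * (1 / \<bar>\<gamma> + \<delta>\<bar> + 1 / \<bar>\<delta> - \<gamma>\<bar>)"

lemma neg_log_const_nonneg: "0 \<le> neg_log_const"
  unfolding neg_log_const_def using G_nonneg by (intro mult_nonneg_nonneg add_nonneg_nonneg) auto

text \<open>If \<open>\<gamma> = \<bar>\<delta>\<bar>\<close>, then \<open>news\<close> vanishes on a half line, whence the first term of the bound;
  there the junk value \<open>1 / 0 = 0\<close> makes \<open>neg_log_const\<close> the right constant.\<close>
lemma nn_integral_neg_log_news_le:
  assumes q: "q \<noteq> 0"
  shows "(\<integral>\<^sup>+s. ennreal ((neg_log (b + q * news s))\<^sup>2) \<partial>P) \<le> ennreal ((neg_log b)\<^sup>2 + neg_log_const / \<bar>q\<bar>)"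
proof -
  let ?t = "\<lambda>a s. if a = 0 then 0 else (neg_log (b + (q * a) * s))\<^sup>2"
  have part: "(\<integral>\<^sup>+s. ennreal (?t a s) \<partial>P) \<le> ennreal (G * (64 * (1 / \<bar>a\<bar>) / \<bar>q\<bar>))" for a
  proof (cases "a = 0")
    case False
    have "(\<integral>\<^sup>+s. ennreal (?t a s) \<partial>P) \<le> ennreal G * (\<integral>\<^sup>+s. ennreal (?t a s) \<partial>lborel)"
      by (rule nn_integral_P_le) simp
    also have "\<dots> \<le> ennreal G * ennreal (64 / \<bar>q * a\<bar>)"
      using nn_integral_neg_log_affine_le[of "q * a" b] False q by (intro mult_left_mono) auto
    also have "\<dots> = ennreal (G * (64 * (1 / \<bar>a\<bar>) / \<bar>q\<bar>))"
      using G_nonneg by (simp add: ennreal_mult'[symmetric] abs_mult mult.commute)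
    finally show ?thesis .
  qed simp
  have "(\<integral>\<^sup>+s. ennreal ((neg_log (b + q * news s))\<^sup>2) \<partial>P)
      \<le> (\<integral>\<^sup>+s. ennreal ((neg_log b)\<^sup>2) + (ennreal (?t (\<gamma> + \<delta>) s) + ennreal (?t (\<delta> - \<gamma>) s)) \<partial>P)"
  proof (rule nn_integral_mono)
    fix s
    have "(neg_log (b + q * news s))\<^sup>2 \<le> (neg_log b)\<^sup>2 + (?t (\<gamma> + \<delta>) s + ?t (\<delta> - \<gamma>) s)"
      using news_cases[of s] by (auto simp: mult.assoc)
    then have "ennreal ((neg_log (b + q * news s))\<^sup>2) \<le> ennreal ((neg_log b)\<^sup>2 + (?t (\<gamma> + \<delta>) s + ?t (\<delta> - \<gamma>) s))"
      by (rule ennreal_leI)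
    then show "ennreal ((neg_log (b + q * news s))\<^sup>2) \<le> ennreal ((neg_log b)\<^sup>2) + (ennreal (?t (\<gamma> + \<delta>) s) + ennreal (?t (\<delta> - \<gamma>) s))"
      by (simp add: ennreal_plus[symmetric] del: ennreal_plus)
  qed
  also have "\<dots> = ennreal ((neg_log b)\<^sup>2) + ((\<integral>\<^sup>+s. ennreal (?t (\<gamma> + \<delta>) s) \<partial>P) + (\<integral>\<^sup>+s. ennreal (?t (\<delta> - \<gamma>) s) \<partial>P))"
    by (simp add: nn_integral_add P.emeasure_space_1[simplified])
  also have "\<dots> \<le> ennreal ((neg_log b)\<^sup>2) + (ennreal (G * (64 * (1 / \<bar>\<gamma> + \<delta>\<bar>) / \<bar>q\<bar>)) + ennreal (G * (64 * (1 / \<bar>\<delta> - \<gamma>\<bar>) / \<bar>q\<bar>)))"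
    by (intro add_left_mono add_mono part)
  also have "\<dots> = ennreal ((neg_log b)\<^sup>2 + neg_log_const / \<bar>q\<bar>)"
    using G_nonneg by (simp add: neg_log_const_def ennreal_plus[symmetric] add_divide_distrib distrib_left del: ennreal_plus)
  finally show ?thesis .
qed

section \<open>The gap chain near its fixed point\<close>

definition gap_map :: "real \<Rightarrow> real \<Rightarrow> real" where
  "gap_map d s = \<beta> * d + news s * (exp (- d / 2) - 1)"

lemma gap_map_measurable[measurable]: "(\<lambda>(d, s). gap_map d s) \<in> borel_measurable (borel \<Otimes>\<^sub>M borel)"
  unfolding gap_map_def by measurable

lemma gap_map_0: "gap_map 0 s = 0" by (simp add: gap_map_def)

text \<open>Since \<open>d\<close> and \<open>exp (- d / 2) - 1\<close> are both nonzero, reaching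
  \<open>0\<close> would prescribe a nonzero value of \<open>news s\<close>.\<close>

lemma AE_gap_map_neq_0:
  assumes "d \<noteq> 0" shows "AE s in P. gap_map d s \<noteq> 0"
proof -
  have e: "exp (- d / 2) - 1 \<noteq> 0" using assms by simp
  have "AE s in P. news s \<noteq> - \<beta> * d / (exp (- d / 2) - 1)"
    by (rule AE_news_neq) (use assms \<beta>_pos e in auto)
  then show ?thesis
    by eventually_elim (use e in \<open>auto simp: gap_map_def field_simps\<close>)
qed

text \<open>Bounds the second moment of \<open>ln \<bar>\<beta> - news s * c\<bar>\<close> uniformly
  for \<open>c\<close> between 1/4 and 1. The terms stem from a possible half line without news,
  from the singularity of the logarithm (with \<open>1 / c \<le> 4\<close>), and from large
  arguments.\<close>

definition ln_sq_const :: real where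
  "ln_sq_const = (neg_log \<beta>)\<^sup>2 + 4 * neg_log_const + (2 * \<beta>\<^sup>2 + 2 * (\<integral>s. (news s)\<^sup>2 \<partial>P))"

lemma ln_sq_const_nonneg: "0 \<le> ln_sq_const"
  unfolding ln_sq_const_def using neg_log_const_nonneg by (intro add_nonneg_nonneg mult_nonneg_nonneg integral_nonneg_AE) auto

lemma nn_integral_ln_sq_le:
  assumes c: "1/4 \<le> c" "c \<le> 1"
  shows "(\<integral>\<^sup>+s. ennreal ((ln \<bar>\<beta> - news s * c\<bar>)\<^sup>2) \<partial>P) \<le> ennreal ln_sq_const"
proof -
  have "(\<integral>\<^sup>+s. ennreal ((ln \<bar>\<beta> - news s * c\<bar>)\<^sup>2) \<partial>P)
    \<le> (\<integral>\<^sup>+s. ennreal ((neg_log (\<beta> + (-c) * news s))\<^sup>2) + ennreal (2 * \<beta>\<^sup>2 + 2 * (news s)\<^sup>2) \<partial>P)"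
  proof (rule nn_integral_mono)
    fix s
    have "(\<beta> - news s * c)\<^sup>2 \<le> 2 * \<beta>\<^sup>2 + 2 * (news s * c)\<^sup>2"
      using zero_le_power2[of "\<beta> + news s * c"] by (simp add: power2_eq_square algebra_simps)
    moreover have "(news s * c)\<^sup>2 \<le> (news s * 1)\<^sup>2"
      using c news_nonneg[of s] by (intro power_mono mult_left_mono mult_nonneg_nonneg) auto
    moreover have "\<beta> + (-c) * news s = \<beta> - news s * c" by simp
    ultimately have "(ln \<bar>\<beta> - news s * c\<bar>)\<^sup>2 \<le> (neg_log (\<beta> + (-c) * news s))\<^sup>2 + (2 * \<beta>\<^sup>2 + 2 * (news s)\<^sup>2)"
      using ln_abs_sq_le[of "\<beta> - news s * c"] by (simp only: mult_1_right)
    then have "ennreal ((ln \<bar>\<beta> - news s * c\<bar>)\<^sup>2) \<le> ennreal ((neg_log (\<beta> + (-c) * news s))\<^sup>2 + (2 * \<beta>\<^sup>2 + 2 * (news s)\<^sup>2))"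
      by (rule ennreal_leI)
    also have "\<dots> = ennreal ((neg_log (\<beta> + (-c) * news s))\<^sup>2) + ennreal (2 * \<beta>\<^sup>2 + 2 * (news s)\<^sup>2)"
      by (rule ennreal_plus) auto
    finally show "ennreal ((ln \<bar>\<beta> - news s * c\<bar>)\<^sup>2) \<le> ennreal ((neg_log (\<beta> + (-c) * news s))\<^sup>2) + ennreal (2 * \<beta>\<^sup>2 + 2 * (news s)\<^sup>2)" .
  qed
  also have "\<dots> = (\<integral>\<^sup>+s. ennreal ((neg_log (\<beta> + (-c) * news s))\<^sup>2) \<partial>P) + (\<integral>\<^sup>+s. ennreal (2 * \<beta>\<^sup>2 + 2 * (news s)\<^sup>2) \<partial>P)"
    by (rule nn_integral_add) auto
  also have "(\<integral>\<^sup>+s. ennreal (2 * \<beta>\<^sup>2 + 2 * (news s)\<^sup>2) \<partial>P) = ennreal (2 * \<beta>\<^sup>2 + 2 * (\<integral>s. (news s)\<^sup>2 \<partial>P))"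
    using news_sq_integrable by (subst nn_integral_eq_integral) (auto simp: P.prob_space[simplified])
  also have "(\<integral>\<^sup>+s. ennreal ((neg_log (\<beta> + (-c) * news s))\<^sup>2) \<partial>P) \<le> ennreal ((neg_log \<beta>)\<^sup>2 + neg_log_const / \<bar>-c\<bar>)"
    by (rule nn_integral_neg_log_news_le) (use c in auto)
  also have "\<dots> \<le> ennreal ((neg_log \<beta>)\<^sup>2 + 4 * neg_log_const)"
  proof (intro ennreal_leI add_left_mono)
    have "neg_log_const / c \<le> neg_log_const / (1/4)" by (rule divide_left_mono) (use c neg_log_const_nonneg in auto)
    then show "neg_log_const / \<bar>-c\<bar> \<le> 4 * neg_log_const" using c by simp
  qed
  also have "ennreal ((neg_log \<beta>)\<^sup>2 + 4 * neg_log_const) + ennreal (2 * \<beta>\<^sup>2 + 2 * (\<integral>s. (news s)\<^sup>2 \<partial>P)) = ennreal ln_sq_const"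
    unfolding ln_sq_const_def using neg_log_const_nonneg by (intro ennreal_plus[symmetric]) auto
  finally show ?thesis by (simp add: add_right_mono)
qed

lemma
  assumes c: "1/4 \<le> c" "c \<le> 1"
  shows ln_sq_integrable: "integrable P (\<lambda>s. (ln \<bar>\<beta> - news s * c\<bar>)\<^sup>2)"
    and integral_ln_sq_le: "(\<integral>s. (ln \<bar>\<beta> - news s * c\<bar>)\<^sup>2 \<partial>P) \<le> ln_sq_const"
    and ln_integrable: "integrable P (\<lambda>s. ln \<bar>\<beta> - news s * c\<bar>)"
proof -
  have m: "(\<lambda>s. ln \<bar>\<beta> - news s * c\<bar>) \<in> borel_measurable P" by measurable
  show i: "integrable P (\<lambda>s. (ln \<bar>\<beta> - news s * c\<bar>)\<^sup>2)"
    using nn_integral_ln_sq_le[OF c] by (intro integrableI_bounded) (auto simp: top_unique intro: le_less_trans)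
  have "ennreal (\<integral>s. (ln \<bar>\<beta> - news s * c\<bar>)\<^sup>2 \<partial>P) \<le> ennreal ln_sq_const"
    using nn_integral_ln_sq_le[OF c] nn_integral_eq_integral[OF i] by simp
  then show "(\<integral>s. (ln \<bar>\<beta> - news s * c\<bar>)\<^sup>2 \<partial>P) \<le> ln_sq_const"
    using ln_sq_const_nonneg by (simp add: ennreal_le_iff)
  show "integrable P (\<lambda>s. ln \<bar>\<beta> - news s * c\<bar>)"
    by (rule P.square_integrable_imp_integrable[OF m i])
qed

definition lyap_exp :: real where
  "lyap_exp = (\<integral>x. ln \<bar>\<beta> - 1 / 2 * (\<gamma> * \<bar>x\<bar> + \<delta> * x)\<bar> \<partial>P)"

text \<open>Lower semicontinuity of the expected logarithm at the slope 1/2. Cut off at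
  \<open>e\<close>, the logarithm is Lipschitz in \<open>c\<close>; the error of the cut-off is
  controlled by the uniform second moment.\<close>

lemma integral_ln_ge:
  obtains \<eta> where "0 < \<eta>" "\<And>c. \<bar>c - 1/2\<bar> < \<eta> \<Longrightarrow> lyap_exp / 2 \<le> (\<integral>s. ln \<bar>\<beta> - news s * c\<bar> \<partial>P)"
proof -
  have l: "0 < lyap_exp" using lyapunov_pos by (simp add: lyap_exp_def)
  \<comment> \<open>The cut-off is at \<open>ln e = - m\<close>, with \<open>m\<close> so large that
    the second-moment error is at most a quarter of \<open>lyap_exp\<close>.\<close>
  define m where "m = 4 * (ln_sq_const + 1) / lyap_exp"
  have m: "0 < m" using ln_sq_const_nonneg l by (simp add: m_def)
  have C1m: "ln_sq_const / m \<le> lyap_exp / 4" using ln_sq_const_nonneg l by (simp add: m_def field_simps)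
  define E where "E = (\<integral>s. news s \<partial>P)"
  have E: "0 \<le> E" unfolding E_def by (intro integral_nonneg_AE) (simp add: news_nonneg)
  define e where "e = exp (- m)"
  have e: "0 < e" "ln e = - m" by (auto simp: e_def)
  define T where "T = (\<lambda>c s. ln (max \<bar>\<beta> - news s * c\<bar> e))"
  \<comment> \<open>The second entry keeps the Lipschitz error below another quarter of
    \<open>lyap_exp\<close>; the first keeps \<open>c\<close> between 1/4 and 1.\<close>
  define \<eta> where "\<eta> = min (1/4) (lyap_exp * e / (4 * (E + 1)))"
  have \<eta>: "0 < \<eta>" using l e E by (simp add: \<eta>_def)
  show thesis
  proof (rule that[OF \<eta>])
    fix c assume c: "\<bar>c - 1/2\<bar> < \<eta>"
    then have "\<bar>c - 1/2\<bar> < 1/4" by (simp add: \<eta>_def)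
    then have c': "1/4 \<le> c" "c \<le> 1" by linarith+
    have half: "1/4 \<le> (1/2::real)" "1/2 \<le> (1::real)" by auto
    \<comment> \<open>Below the cut-off \<open>ln ?y < - m\<close>, so the quadratic term outweighs
      \<open>ln ?y\<close> and the right side is nonnegative, while the left side is
      \<open>- m\<close>.\<close>
    have T_le: "T c s \<le> ln \<bar>\<beta> - news s * c\<bar> + (ln \<bar>\<beta> - news s * c\<bar>)\<^sup>2 / m" for c s
    proof -
      let ?y = "\<bar>\<beta> - news s * c\<bar>"
      consider "?y = 0" | "?y \<ge> e" | "?y > 0" "?y < e" by linarith
      then show ?thesis
      proof cases
        case 1 then show ?thesis using e m by (simp add: T_def)
      next
        case 2 then show ?thesis using e m by (simp add: T_def max_def)
      next
        case 3
        then have "ln ?y < - m" using ln_less_cancel_iff[of ?y e] e by simp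
        then have "m * (- ln ?y) \<le> (- ln ?y) * (- ln ?y)" using m by (intro mult_right_mono) auto
        then have "- ln ?y \<le> (ln ?y)\<^sup>2 / m" using m by (simp add: field_simps power2_eq_square)
        then show ?thesis using 3 e m by (simp add: T_def max_def)
      qed
    qed
    have T_diff: "\<bar>T (1/2) s - T c s\<bar> \<le> news s * (\<bar>c - 1/2\<bar> / e)" for s
    proof -
      have "\<bar>T (1/2) s - T c s\<bar> \<le> \<bar>\<bar>\<beta> - news s * (1/2)\<bar> - \<bar>\<beta> - news s * c\<bar>\<bar> / e"
        unfolding T_def by (rule ln_max_lipschitz[OF e(1)])
      also have "\<dots> \<le> \<bar>news s * (c - 1/2)\<bar> / e"
        using e by (intro divide_right_mono) (auto simp: algebra_simps abs_if split: if_splits)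
      finally show ?thesis using news_nonneg[of s] by (simp add: abs_mult)
    qed
    \<comment> \<open>The exclusion of zero matters: there \<open>ln 0 = 0\<close> exceeds the
      cut-off value \<open>- m\<close>.\<close>
    have T_ge: "ln \<bar>\<beta> - news s * c\<bar> \<le> T c s" if "\<beta> - news s * c \<noteq> 0" for c s
      unfolding T_def using that e by simp
    have T_int: "integrable P (T c)" if "1/4 \<le> c" "c \<le> 1" for c
    proof (rule Bochner_Integration.integrable_bound)
      show "integrable P (\<lambda>s. m + \<bar>ln \<bar>\<beta> - news s * c\<bar>\<bar>)" using ln_integrable[OF that] by simp
      show "T c \<in> borel_measurable P" unfolding T_def by measurable
      have "\<bar>T c s\<bar> \<le> m + \<bar>ln \<bar>\<beta> - news s * c\<bar>\<bar>" for s
        using e m by (auto simp: T_def max_def)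
      then show "AE s in P. norm (T c s) \<le> norm (m + \<bar>ln \<bar>\<beta> - news s * c\<bar>\<bar>)"
        using m by auto
    qed
    have "lyap_exp = (\<integral>s. ln \<bar>\<beta> - news s * (1/2)\<bar> \<partial>P)"
      unfolding lyap_exp_def news_def by (simp add: mult.commute)
    also have "\<dots> \<le> (\<integral>s. T (1/2) s \<partial>P)"
    proof (rule integral_mono_AE[OF ln_integrable[OF half] T_int[OF half]])
      have "AE s in P. news s \<noteq> 2 * \<beta>" using \<beta>_pos by (intro AE_news_neq) simp
      then show "AE s in P. ln \<bar>\<beta> - news s * (1/2)\<bar> \<le> T (1/2) s"
      proof eventually_elim
        case (elim s)
        then have "\<beta> - news s * (1/2) \<noteq> 0" by simp
        then show ?case by (rule T_ge)
      qed
    qed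
    also have "\<dots> \<le> (\<integral>s. news s * (\<bar>c - 1/2\<bar> / e) + (ln \<bar>\<beta> - news s * c\<bar> + (ln \<bar>\<beta> - news s * c\<bar>)\<^sup>2 / m) \<partial>P)"
    proof (rule integral_mono[OF T_int[OF half]])
      show "integrable P (\<lambda>s. news s * (\<bar>c - 1/2\<bar> / e) + (ln \<bar>\<beta> - news s * c\<bar> + (ln \<bar>\<beta> - news s * c\<bar>)\<^sup>2 / m))"
        using news_integrable ln_sq_integrable[OF c'] ln_integrable[OF c'] by simp
      show "T (1/2) s \<le> news s * (\<bar>c - 1/2\<bar> / e) + (ln \<bar>\<beta> - news s * c\<bar> + (ln \<bar>\<beta> - news s * c\<bar>)\<^sup>2 / m)" for s
        using T_diff[of s] T_le[of c s] by linarith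
    qed
    also have "\<dots> = E * (\<bar>c - 1/2\<bar> / e) + ((\<integral>s. ln \<bar>\<beta> - news s * c\<bar> \<partial>P) + (\<integral>s. (ln \<bar>\<beta> - news s * c\<bar>)\<^sup>2 \<partial>P) / m)"
      using news_integrable ln_sq_integrable[OF c'] ln_integrable[OF c'] by (simp add: E_def)
    also have "(\<integral>s. (ln \<bar>\<beta> - news s * c\<bar>)\<^sup>2 \<partial>P) / m \<le> ln_sq_const / m"
      using integral_ln_sq_le[OF c'] m by (intro divide_right_mono) auto
    also note C1m
    also have "E * (\<bar>c - 1/2\<bar> / e) \<le> lyap_exp / 4"
    proof -
      have "\<bar>c - 1/2\<bar> \<le> lyap_exp * e / (4 * (E + 1))" using c by (simp add: \<eta>_def)
      then have "E * (\<bar>c - 1/2\<bar> / e) \<le> E * (lyap_exp * e / (4 * (E + 1)) / e)"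
        using E e by (intro mult_left_mono divide_right_mono) auto
      also have "\<dots> = E / (E + 1) * (lyap_exp / 4)" using e by simp
      also have "\<dots> \<le> 1 * (lyap_exp / 4)" using E l by (intro mult_right_mono) auto
      finally show ?thesis by simp
    qed
    finally show "lyap_exp / 2 \<le> (\<integral>s. ln \<bar>\<beta> - news s * c\<bar> \<partial>P)" by simp
  qed
qed

text \<open>Near \<open>0\<close> a step multiplies the gap by \<open>\<beta> - news s * c\<close>,
  where \<open>c\<close> is the difference quotient of \<open>- exp (- d / 2)\<close> and close to
  1/2. The logarithm of this factor has mean at least \<open>lyap_exp / 2\<close>; in the expanded
  square it is multiplied by twice \<open>neg_log d\<close>.\<close>

lemma neg_log_drift_small:
  obtains r where "0 < r" "r \<le> 1"
    "\<And>d. \<bar>d\<bar> < r \<Longrightarrow> (\<integral>\<^sup>+s. ennreal ((neg_log (gap_map d s))\<^sup>2) \<partial>P) + ennreal (lyap_exp * neg_log d) \<le> ennreal ((neg_log d)\<^sup>2 + ln_sq_const)"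
proof -
  obtain \<eta> where \<eta>: "0 < \<eta>" and ln_ge: "\<And>c. \<bar>c - 1/2\<bar> < \<eta> \<Longrightarrow> lyap_exp / 2 \<le> (\<integral>s. ln \<bar>\<beta> - news s * c\<bar> \<partial>P)"
    by (rule integral_ln_ge) blast
  have l: "0 < lyap_exp" using lyapunov_pos by (simp add: lyap_exp_def)
  have "((\<lambda>d::real. - exp (- d / 2)) has_field_derivative 1/2) (at 0)"
    by (auto intro!: derivative_eq_intros)
  then have "((\<lambda>d::real. (1 - exp (- d / 2)) / d) \<longlongrightarrow> 1/2) (at 0)"
    by (simp add: has_field_derivative_iff)
  then have "eventually (\<lambda>d::real. dist ((1 - exp (- d / 2)) / d) (1/2) < min \<eta> (1/4)) (at 0)"
    using \<eta> by (intro tendstoD) auto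
  then obtain r0 where r0: "0 < r0"
    "\<And>d::real. d \<noteq> 0 \<Longrightarrow> \<bar>d\<bar> < r0 \<Longrightarrow> \<bar>(1 - exp (- d / 2)) / d - 1/2\<bar> < min \<eta> (1/4)"
    by (auto simp: eventually_at dist_real_def)
  show thesis
  proof (rule that[of "min r0 1"])
    fix d :: real assume d: "\<bar>d\<bar> < min r0 1"
    show "(\<integral>\<^sup>+s. ennreal ((neg_log (gap_map d s))\<^sup>2) \<partial>P) + ennreal (lyap_exp * neg_log d) \<le> ennreal ((neg_log d)\<^sup>2 + ln_sq_const)"
    proof (cases "d = 0")
      case True
      then show ?thesis using ln_sq_const_nonneg by (simp add: gap_map_0 neg_log_def)
    next
      case False
      define c where "c = (1 - exp (- d / 2)) / d"
      have c\<eta>: "\<bar>c - 1/2\<bar> < \<eta>" and "\<bar>c - 1/2\<bar> < 1/4"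
        using r0(2)[OF False] d by (auto simp: c_def)
      then have c: "1/4 \<le> c" "c \<le> 1" by linarith+
      have gap_map: "gap_map d s = d * (\<beta> - news s * c)" for s
        using False by (simp add: gap_map_def c_def field_simps)
      define X where "X = (\<lambda>s. ln \<bar>\<beta> - news s * c\<bar>)"
      have X1: "integrable P X" and X2: "integrable P (\<lambda>s. (X s)\<^sup>2)"
        unfolding X_def by (rule ln_integrable[OF c], rule ln_sq_integrable[OF c])
      have EX: "lyap_exp / 2 \<le> (\<integral>s. X s \<partial>P)" unfolding X_def by (rule ln_ge[OF c\<eta>])
      have EX2: "(\<integral>s. (X s)\<^sup>2 \<partial>P) \<le> ln_sq_const" unfolding X_def by (rule integral_ln_sq_le[OF c])
      define l where "l = neg_log d"
      have l: "l = - ln \<bar>d\<bar>" and l0: "0 \<le> l" using d False by (auto simp: l_def neg_log_def)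
      have pt: "(neg_log (gap_map d s))\<^sup>2 \<le> (l - X s)\<^sup>2" for s
      proof (cases "\<beta> - news s * c = 0")
        case True
        then have "gap_map d s = 0" by (simp only: gap_map mult_zero_right)
        then show ?thesis by (simp add: neg_log_def)
      next
        case nz: False
        then have "neg_log (gap_map d s) = max 0 (l - X s)"
          using False by (simp add: gap_map neg_log_def X_def l abs_mult ln_mult)
        then show ?thesis by (simp add: max_def)
      qed
      have i: "integrable P (\<lambda>s. (l - X s)\<^sup>2)"
        using X1 X2 by (simp add: power2_diff)
      have "(\<integral>\<^sup>+s. ennreal ((neg_log (gap_map d s))\<^sup>2) \<partial>P) \<le> (\<integral>\<^sup>+s. ennreal ((l - X s)\<^sup>2) \<partial>P)"
        by (intro nn_integral_mono ennreal_leI pt)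
      also have "\<dots> = ennreal (\<integral>s. (l - X s)\<^sup>2 \<partial>P)"
        by (rule nn_integral_eq_integral[OF i]) simp
      also have "(\<integral>s. (l - X s)\<^sup>2 \<partial>P) = l\<^sup>2 + (\<integral>s. (X s)\<^sup>2 \<partial>P) - 2 * l * (\<integral>s. X s \<partial>P)"
        using X1 X2 by (simp add: power2_diff P.prob_space[simplified])
      also have "\<dots> \<le> l\<^sup>2 + ln_sq_const - lyap_exp * l"
        using EX2 mult_left_mono[OF EX, of "2 * l"] l0 by (simp add: mult.commute)
      finally have le: "(\<integral>\<^sup>+s. ennreal ((neg_log (gap_map d s))\<^sup>2) \<partial>P) \<le> ennreal (l\<^sup>2 + ln_sq_const - lyap_exp * l)"
        by (simp add: ennreal_leI)
      \<comment> \<open>The bound is nonnegative, so \<open>ennreal\<close> does not truncate it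
        when \<open>lyap_exp * l\<close> is brought to the other side.\<close>
      have "0 \<le> (\<integral>s. (l - X s)\<^sup>2 \<partial>P)" by simp
      also have "(\<integral>s. (l - X s)\<^sup>2 \<partial>P) = l\<^sup>2 + (\<integral>s. (X s)\<^sup>2 \<partial>P) - 2 * l * (\<integral>s. X s \<partial>P)"
        using X1 X2 by (simp add: power2_diff P.prob_space[simplified])
      also have "\<dots> \<le> l\<^sup>2 + ln_sq_const - lyap_exp * l"
        using EX2 mult_left_mono[OF EX, of "2 * l"] l0 by (simp add: mult.commute)
      finally have nn: "0 \<le> l\<^sup>2 + ln_sq_const - lyap_exp * l" .
      have "(\<integral>\<^sup>+s. ennreal ((neg_log (gap_map d s))\<^sup>2) \<partial>P) + ennreal (lyap_exp * l) \<le> ennreal (l\<^sup>2 + ln_sq_const - lyap_exp * l) + ennreal (lyap_exp * l)"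
        by (intro add_right_mono le)
      also have "\<dots> = ennreal (l\<^sup>2 + ln_sq_const)"
        using nn l0 \<open>0 < lyap_exp\<close> by (subst ennreal_plus[symmetric]) auto
      finally show ?thesis by (simp add: l_def)
    qed
  qed (use r0 in auto)
qed

text \<open>Away from \<open>0\<close> neither \<open>\<beta> * d\<close> nor the coefficient of
  \<open>news s\<close> is small, so the expected square is bounded outright.\<close>

lemma neg_log_drift:
  obtains C where "0 \<le> C"
    "\<And>d. (\<integral>\<^sup>+s. ennreal ((neg_log (gap_map d s))\<^sup>2) \<partial>P) + ennreal (lyap_exp * neg_log d) \<le> ennreal ((neg_log d)\<^sup>2 + C)"
proof -
  obtain r where r: "0 < r" "r \<le> 1" and small:
    "\<And>d. \<bar>d\<bar> < r \<Longrightarrow> (\<integral>\<^sup>+s. ennreal ((neg_log (gap_map d s))\<^sup>2) \<partial>P) + ennreal (lyap_exp * neg_log d) \<le> ennreal ((neg_log d)\<^sup>2 + ln_sq_const)"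
    by (rule neg_log_drift_small) blast
  have l: "0 < lyap_exp" using lyapunov_pos by (simp add: lyap_exp_def)
  define q where "q = 1 - exp (- r / 2)"
  have q: "0 < q" using r by (simp add: q_def)
  define C where "C = (neg_log (\<beta> * r))\<^sup>2 + neg_log_const / q + lyap_exp * neg_log r"
  have C: "0 \<le> C" unfolding C_def using q neg_log_const_nonneg l neg_log_nonneg by (intro add_nonneg_nonneg) auto
  have large: "(\<integral>\<^sup>+s. ennreal ((neg_log (gap_map d s))\<^sup>2) \<partial>P) + ennreal (lyap_exp * neg_log d) \<le> ennreal C"
    if d: "r \<le> \<bar>d\<bar>" for d
  proof -
    \<comment> \<open>The positive side is the worse one: for negative \<open>d\<close> the distance
      is at least \<open>exp (r / 2) - 1 \<ge> 1 - exp (- r / 2)\<close>.\<close>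
    have qd: "q \<le> \<bar>exp (- d / 2) - 1\<bar>"
    proof (cases "0 \<le> d")
      case True
      then have "exp (- d / 2) \<le> exp (- r / 2)" using d by simp
      then show ?thesis unfolding q_def by linarith
    next
      case False
      then have "exp (r / 2) \<le> exp (- d / 2)" using d by simp
      moreover have "0 \<le> (exp (r / 2) - exp (- r / 2))" using r by simp
      moreover have "2 \<le> exp (r / 2) + exp (- r / 2)"
        using exp_ge_add_one_self[of "r / 2"] exp_ge_add_one_self[of "- r / 2"] by linarith
      ultimately show ?thesis unfolding q_def by linarith
    qed
    then have q0: "exp (- d / 2) - 1 \<noteq> 0" using q by auto
    have "(\<integral>\<^sup>+s. ennreal ((neg_log (gap_map d s))\<^sup>2) \<partial>P) = (\<integral>\<^sup>+s. ennreal ((neg_log (\<beta> * d + (exp (- d / 2) - 1) * news s))\<^sup>2) \<partial>P)"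
      by (simp add: gap_map_def mult.commute)
    also have "\<dots> \<le> ennreal ((neg_log (\<beta> * d))\<^sup>2 + neg_log_const / \<bar>exp (- d / 2) - 1\<bar>)"
      by (rule nn_integral_neg_log_news_le[OF q0])
    also have "\<dots> \<le> ennreal ((neg_log (\<beta> * r))\<^sup>2 + neg_log_const / q)"
    proof (intro ennreal_leI add_mono power_mono neg_log_nonneg)
      show "neg_log (\<beta> * d) \<le> neg_log (\<beta> * r)"
        using r d \<beta>_pos by (intro neg_log_antimono) (auto simp: abs_mult)
      have "0 < \<bar>exp (- d / 2) - 1\<bar>" using q0 by simp
      then show "neg_log_const / \<bar>exp (- d / 2) - 1\<bar> \<le> neg_log_const / q"
        using q qd neg_log_const_nonneg by (intro divide_left_mono mult_pos_pos)
    qed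
    finally have "(\<integral>\<^sup>+s. ennreal ((neg_log (gap_map d s))\<^sup>2) \<partial>P) \<le> ennreal ((neg_log (\<beta> * r))\<^sup>2 + neg_log_const / q)" .
    moreover have "ennreal (lyap_exp * neg_log d) \<le> ennreal (lyap_exp * neg_log r)"
      using l r d by (intro ennreal_leI mult_left_mono neg_log_antimono) auto
    ultimately have "(\<integral>\<^sup>+s. ennreal ((neg_log (gap_map d s))\<^sup>2) \<partial>P) + ennreal (lyap_exp * neg_log d)
        \<le> ennreal ((neg_log (\<beta> * r))\<^sup>2 + neg_log_const / q) + ennreal (lyap_exp * neg_log r)"
      by (rule add_mono)
    also have "\<dots> = ennreal C"
      unfolding C_def using q neg_log_const_nonneg l neg_log_nonneg by (intro ennreal_plus[symmetric]) auto
    finally show ?thesis .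
  qed
  show thesis
  proof (rule that[of "max C ln_sq_const"])
    show "0 \<le> max C ln_sq_const" using C by simp
    fix d
    show "(\<integral>\<^sup>+s. ennreal ((neg_log (gap_map d s))\<^sup>2) \<partial>P) + ennreal (lyap_exp * neg_log d) \<le> ennreal ((neg_log d)\<^sup>2 + max C ln_sq_const)"
    proof (cases "\<bar>d\<bar> < r")
      case True
      show ?thesis by (rule order_trans[OF small[OF True]]) (auto intro: ennreal_leI)
    next
      case False
      then have "r \<le> \<bar>d\<bar>" by simp
      show ?thesis by (rule order_trans[OF large[OF \<open>r \<le> \<bar>d\<bar>\<close>]]) (auto intro!: ennreal_leI add_increasing)
    qed
  qed
qed

section \<open>Drift of large gaps\<close>

definition lyap_fun :: "real \<Rightarrow> real" where
  "lyap_fun d = (ln (1 + max d 0))\<^sup>2 + 1 / (1 - \<beta>\<^sup>2) * (max (- d) 0)\<^sup>2"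

lemma lyap_fun_measurable[measurable]: "lyap_fun \<in> borel_measurable borel"
  unfolding lyap_fun_def[abs_def] by measurable

lemma \<beta>_sq: "0 < 1 - \<beta>\<^sup>2"
  using \<beta>_pos \<beta>_less_1 by (simp add: power_less_one_iff abs_square_less_1)

lemma lyap_fun_nonneg: "0 \<le> lyap_fun d"
  unfolding lyap_fun_def using \<beta>_sq by (intro add_nonneg_nonneg mult_nonneg_nonneg) auto

text \<open>For \<open>d \<ge> 1\<close> the quotient \<open>(1 + d) / (1 + \<beta> * d)\<close> is
  at least its value \<open>2 / (1 + \<beta>)\<close> at 1, and factoring the difference of squares
  gives the drift. For \<open>d \<le> 1\<close> the constant with \<open>ln 2\<close> pays for
  it.\<close>

lemma ln_contraction:
  assumes "0 \<le> d"
  shows "(ln (1 + \<beta> * d))\<^sup>2 + ln (2 / (1 + \<beta>)) * ln (1 + d) \<le> (ln (1 + d))\<^sup>2 + ln (2 / (1 + \<beta>)) * ln 2"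
proof -
  define a where "a = ln (2 / (1 + \<beta>))"
  have a: "0 \<le> a" using \<beta>_pos \<beta>_less_1 by (simp add: a_def)
  have l1: "0 \<le> ln (1 + \<beta> * d)" "ln (1 + \<beta> * d) \<le> ln (1 + d)"
    using assms \<beta>_pos mult_right_mono[of \<beta> 1 d] \<beta>_less_1 by (auto simp: add_pos_nonneg)
  show ?thesis
  proof (cases "d \<le> 1")
    case True
    then have "a * ln (1 + d) \<le> a * ln 2" using assms a by (intro mult_left_mono) auto
    moreover have "(ln (1 + \<beta> * d))\<^sup>2 \<le> (ln (1 + d))\<^sup>2" using l1 by (intro power_mono)
    ultimately show ?thesis unfolding a_def by linarith
  next
    case False
    have "2 / (1 + \<beta>) \<le> (1 + d) / (1 + \<beta> * d)"
    proof -
      have "0 \<le> (1 - \<beta>) * (d - 1)" using False \<beta>_less_1 by simp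
      then show ?thesis using False \<beta>_pos by (simp add: field_simps add_pos_pos)
    qed
    then have "a \<le> ln ((1 + d) / (1 + \<beta> * d))"
      unfolding a_def using \<beta>_pos by (intro ln_mono) auto
    also have "\<dots> = ln (1 + d) - ln (1 + \<beta> * d)"
    proof -
      have "0 < 1 + \<beta> * d" using assms \<beta>_pos by (intro add_pos_nonneg) auto
      then show ?thesis using assms by (simp add: ln_div)
    qed
    finally have "a * ln (1 + d) \<le> (ln (1 + d) - ln (1 + \<beta> * d)) * (ln (1 + d) + ln (1 + \<beta> * d))"
      using a l1 by (intro mult_mono) auto
    then have "(ln (1 + \<beta> * d))\<^sup>2 + a * ln (1 + d) \<le> (ln (1 + d))\<^sup>2"
      by (simp add: power2_eq_square algebra_simps)
    moreover have "0 \<le> a * ln 2" using a by simp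
    ultimately show ?thesis unfolding a_def by linarith
  qed
qed

text \<open>A positive gap contracts and falls no lower than \<open>- news s\<close>. A gap
  \<open>- u\<close> contracts from below but may jump up to
  \<open>exp (u / 2) * (1 + news s)\<close>; positive gaps are therefore weighed by a squared
  logarithm, on whose scale the jump costs about \<open>u\<^sup>2 / 4\<close>, comparable to the
  quadratic part.\<close>

lemma lyap_fun_gap_map_le:
  "lyap_fun (gap_map d s) + ln (2 / (1 + \<beta>)) * ln (1 + \<bar>d\<bar>)
     \<le> lyap_fun d + (ln (2 / (1 + \<beta>)) * ln 2 + (ln (2 / (1 + \<beta>)))\<^sup>2) + (1 / (1 - \<beta>\<^sup>2) + 2) * (news s)\<^sup>2"
proof -
  \<comment> \<open>Chosen to solve \<open>A * \<beta>\<^sup>2 = A - 1\<close>: the contraction of a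
    negative gap then releases exactly \<open>u\<^sup>2\<close>.\<close>
  define A where "A = 1 / (1 - \<beta>\<^sup>2)"
  have A: "0 < A" "A * (1 - \<beta>\<^sup>2) = 1" using \<beta>_sq by (auto simp: A_def)
  define a where "a = ln (2 / (1 + \<beta>))"
  have a: "0 \<le> a" using \<beta>_pos \<beta>_less_1 by (simp add: a_def)
  have k: "0 \<le> news s" by (rule news_nonneg)
  have "lyap_fun (gap_map d s) + a * ln (1 + \<bar>d\<bar>) \<le> lyap_fun d + (a * ln 2 + a\<^sup>2) + (A + 2) * (news s)\<^sup>2"
  proof (cases "0 \<le> d")
    case True
    have e: "- 1 \<le> exp (- d / 2) - 1" "exp (- d / 2) - 1 \<le> 0" using True by auto
    have u: "gap_map d s \<le> \<beta> * d" using mult_nonneg_nonpos[OF k e(2)] by (simp add: gap_map_def)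
    have lo: "- news s \<le> gap_map d s"
      using mult_left_mono[OF e(1) k] mult_nonneg_nonneg[of \<beta> d] True \<beta>_pos unfolding gap_map_def by linarith
    have "max (gap_map d s) 0 \<le> \<beta> * d" using u True \<beta>_pos by simp
    then have "(ln (1 + max (gap_map d s) 0))\<^sup>2 \<le> (ln (1 + \<beta> * d))\<^sup>2"
      by (intro power_mono ln_mono) auto
    moreover have "A * (max (- gap_map d s) 0)\<^sup>2 \<le> A * (news s)\<^sup>2"
      using lo k A by (intro mult_left_mono power_mono) auto
    moreover have "lyap_fun d = (ln (1 + d))\<^sup>2" using True by (simp add: lyap_fun_def max_def)
    moreover have "(ln (1 + \<beta> * d))\<^sup>2 + a * ln (1 + d) \<le> (ln (1 + d))\<^sup>2 + a * ln 2"
      unfolding a_def by (rule ln_contraction[OF True])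
    moreover have "lyap_fun (gap_map d s) = (ln (1 + max (gap_map d s) 0))\<^sup>2 + A * (max (- gap_map d s) 0)\<^sup>2"
      by (simp add: lyap_fun_def A_def)
    moreover have "(A + 2) * (news s)\<^sup>2 = A * (news s)\<^sup>2 + 2 * (news s)\<^sup>2" by (simp add: algebra_simps)
    moreover have abs: "\<bar>d\<bar> = d" using True by simp
    moreover have "0 \<le> (news s)\<^sup>2" "0 \<le> a\<^sup>2" by simp_all
    ultimately show ?thesis unfolding abs by linarith
  next
    case False
    define u where "u = - d"
    have u: "0 < u" using False by (simp add: u_def)
    have gap_map: "gap_map d s = - (\<beta> * u) + news s * (exp (u / 2) - 1)" by (simp add: gap_map_def u_def)
    have e: "0 \<le> exp (u / 2) - 1" using u by simp
    have bu: "0 \<le> \<beta> * u" using u \<beta>_pos by simp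
    have lo: "- gap_map d s \<le> \<beta> * u" using mult_nonneg_nonneg[OF k e] by (simp add: gap_map)
    have "gap_map d s \<le> news s * exp (u / 2)" using bu k by (simp add: gap_map algebra_simps)
    moreover have "0 \<le> news s * exp (u / 2)" using k by simp
    ultimately have "1 + max (gap_map d s) 0 \<le> exp (u / 2) + news s * exp (u / 2)"
      using e by linarith
    also have "\<dots> = exp (u / 2) * (1 + news s)" by (simp add: algebra_simps)
    finally have "1 + max (gap_map d s) 0 \<le> exp (u / 2) * (1 + news s)" .
    then have "ln (1 + max (gap_map d s) 0) \<le> ln (exp (u / 2) * (1 + news s))"
      by (intro ln_mono) auto
    also have "\<dots> = u / 2 + ln (1 + news s)" using k by (simp add: ln_mult)
    also have "\<dots> \<le> u / 2 + news s" using ln_add_one_self_le_self[OF k] by simp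
    finally have "(ln (1 + max (gap_map d s) 0))\<^sup>2 \<le> (u / 2 + news s)\<^sup>2" by (intro power_mono) auto
    also have "\<dots> \<le> u\<^sup>2 / 2 + 2 * (news s)\<^sup>2"
      using zero_le_power2[of "u / 2 - news s"] by (simp add: power2_eq_square field_simps)
    finally have 1: "(ln (1 + max (gap_map d s) 0))\<^sup>2 \<le> u\<^sup>2 / 2 + 2 * (news s)\<^sup>2" .
    have 2: "A * (max (- gap_map d s) 0)\<^sup>2 \<le> A * (\<beta> * u)\<^sup>2"
      using lo bu A by (intro mult_left_mono power_mono) auto
    \<comment> \<open>Of the \<open>u\<^sup>2\<close> released here, one half absorbs the jump in
      \<open>1\<close>, the other the logarithmic weight in \<open>5\<close>.\<close>
    have 3: "A * (\<beta> * u)\<^sup>2 = A * u\<^sup>2 - u\<^sup>2"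
    proof -
      have "A * (\<beta> * u)\<^sup>2 = A * u\<^sup>2 - (A * (1 - \<beta>\<^sup>2)) * u\<^sup>2" by (simp add: power_mult_distrib algebra_simps)
      then show ?thesis using A by simp
    qed
    have 4: "lyap_fun d = A * u\<^sup>2" using False by (simp add: lyap_fun_def A_def u_def max_def)
    have 5: "a * ln (1 + \<bar>d\<bar>) \<le> u\<^sup>2 / 2 + a\<^sup>2"
    proof -
      have "a * ln (1 + \<bar>d\<bar>) \<le> a * u"
        using ln_add_one_self_le_self[of u] u a by (intro mult_left_mono) (auto simp: u_def)
      also have "\<dots> \<le> u\<^sup>2 / 2 + a\<^sup>2"
      proof -
        have "2 * (a * u) \<le> a\<^sup>2 + u\<^sup>2" using sum_squares_bound[of a u] by (simp only: mult.assoc)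
        moreover have "0 \<le> a\<^sup>2" by simp
        ultimately show ?thesis by linarith
      qed
      finally show ?thesis .
    qed
    have 6: "(A + 2) * (news s)\<^sup>2 = A * (news s)\<^sup>2 + 2 * (news s)\<^sup>2" by (simp add: algebra_simps)
    have 7: "0 \<le> A * (news s)\<^sup>2" "0 \<le> a * ln 2" using A a by auto
    have 8: "lyap_fun (gap_map d s) = (ln (1 + max (gap_map d s) 0))\<^sup>2 + A * (max (- gap_map d s) 0)\<^sup>2"
      by (simp add: lyap_fun_def A_def)
    show ?thesis using 1 2 3 4 5 6 7 8 by linarith
  qed
  then show ?thesis by (simp only: a_def A_def)
qed

text \<open>Unbounded at infinity and on approach to \<open>0\<close>, so its sublevel sets, with
  the point \<open>0\<close> removed, are compact.\<close>

definition gap_weight :: "real \<Rightarrow> real" where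
  "gap_weight d = neg_log d + ln (1 + \<bar>d\<bar>)"

lemma gap_weight_measurable[measurable]: "gap_weight \<in> borel_measurable borel"
  unfolding gap_weight_def[abs_def] by measurable

text \<open>The estimates for \<open>0\<close> and for infinity both hold for every
  \<open>d\<close>, so they add up; \<open>a\<close> is the smaller of the two rates.\<close>

lemma drift:
  obtains V a C where "V \<in> borel_measurable borel" "0 < a" "0 \<le> C" "\<And>d. 0 \<le> V d"
    "\<And>d. (\<integral>\<^sup>+s. ennreal (V (gap_map d s)) \<partial>P) + ennreal (a * gap_weight d) \<le> ennreal (V d + C)"
proof -
  obtain C where C: "0 \<le> C" and C_le:
    "\<And>d. (\<integral>\<^sup>+s. ennreal ((neg_log (gap_map d s))\<^sup>2) \<partial>P) + ennreal (lyap_exp * neg_log d) \<le> ennreal ((neg_log d)\<^sup>2 + C)"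
    by (rule neg_log_drift) blast
  define b where "b = ln (2 / (1 + \<beta>))"
  have b: "0 < b" using \<beta>_pos \<beta>_less_1 by (simp add: b_def)
  have l: "0 < lyap_exp" using lyapunov_pos by (simp add: lyap_exp_def)
  define D where "D = (b * ln 2 + b\<^sup>2)"
  define A where "A = 1 / (1 - \<beta>\<^sup>2) + 2"
  have A: "0 \<le> A" using \<beta>_sq by (simp add: A_def)
  define K where "K = (\<integral>s. (news s)\<^sup>2 \<partial>P)"
  have K: "0 \<le> K" by (simp add: K_def)
  have D: "0 \<le> D" using b by (simp add: D_def)
  have lyap_fun_le: "(\<integral>\<^sup>+s. ennreal (lyap_fun (gap_map d s)) \<partial>P) + ennreal (b * ln (1 + \<bar>d\<bar>)) \<le> ennreal (lyap_fun d + D + A * K)" for d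
  proof -
    have "(\<integral>\<^sup>+s. ennreal (lyap_fun (gap_map d s)) \<partial>P) + ennreal (b * ln (1 + \<bar>d\<bar>))
        = (\<integral>\<^sup>+s. ennreal (lyap_fun (gap_map d s)) + ennreal (b * ln (1 + \<bar>d\<bar>)) \<partial>P)"
      by (subst nn_integral_add) (auto simp: P.emeasure_space_1[simplified])
    also have "\<dots> \<le> (\<integral>\<^sup>+s. ennreal (lyap_fun d + D + A * (news s)\<^sup>2) \<partial>P)"
    proof (rule nn_integral_mono)
      fix s
      have "lyap_fun (gap_map d s) + b * ln (1 + \<bar>d\<bar>) \<le> lyap_fun d + D + A * (news s)\<^sup>2"
        using lyap_fun_gap_map_le[of d s] unfolding D_def A_def b_def by simp
      then have "ennreal (lyap_fun (gap_map d s) + b * ln (1 + \<bar>d\<bar>)) \<le> ennreal (lyap_fun d + D + A * (news s)\<^sup>2)"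
        by (rule ennreal_leI)
      then show "ennreal (lyap_fun (gap_map d s)) + ennreal (b * ln (1 + \<bar>d\<bar>)) \<le> ennreal (lyap_fun d + D + A * (news s)\<^sup>2)"
        using lyap_fun_nonneg b by (subst ennreal_plus[symmetric]) auto
    qed
    also have "\<dots> = ennreal (\<integral>s. lyap_fun d + D + A * (news s)\<^sup>2 \<partial>P)"
      using news_sq_integrable lyap_fun_nonneg[of d] D A by (intro nn_integral_eq_integral) auto
    also have "(\<integral>s. lyap_fun d + D + A * (news s)\<^sup>2 \<partial>P) = lyap_fun d + D + A * K"
      using news_sq_integrable by (simp add: K_def P.prob_space[simplified])
    finally show ?thesis .
  qed
  show thesis
  proof (rule that[of "\<lambda>d. (neg_log d)\<^sup>2 + lyap_fun d" "min lyap_exp b" "C + D + A * K"])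
    show "(\<lambda>d. (neg_log d)\<^sup>2 + lyap_fun d) \<in> borel_measurable borel" by measurable
    show "0 < min lyap_exp b" "0 \<le> C + D + A * K" using l b C D A K by auto
    show "0 \<le> (neg_log d)\<^sup>2 + lyap_fun d" for d using lyap_fun_nonneg by simp
    fix d
    have "min lyap_exp b * gap_weight d \<le> lyap_exp * neg_log d + b * ln (1 + \<bar>d\<bar>)"
      unfolding gap_weight_def distrib_left by (intro add_mono mult_right_mono) (auto simp: neg_log_nonneg)
    then have "ennreal (min lyap_exp b * gap_weight d) \<le> ennreal (lyap_exp * neg_log d + b * ln (1 + \<bar>d\<bar>))"
      by (rule ennreal_leI)
    also have "\<dots> = ennreal (lyap_exp * neg_log d) + ennreal (b * ln (1 + \<bar>d\<bar>))"
      using l b neg_log_nonneg by (intro ennreal_plus) auto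
    finally have 1: "ennreal (min lyap_exp b * gap_weight d) \<le> ennreal (lyap_exp * neg_log d) + ennreal (b * ln (1 + \<bar>d\<bar>))" .
    have "(\<integral>\<^sup>+s. ennreal ((neg_log (gap_map d s))\<^sup>2 + lyap_fun (gap_map d s)) \<partial>P)
        = (\<integral>\<^sup>+s. ennreal ((neg_log (gap_map d s))\<^sup>2) + ennreal (lyap_fun (gap_map d s)) \<partial>P)"
      using lyap_fun_nonneg by (intro nn_integral_cong ennreal_plus) auto
    also have "\<dots> = (\<integral>\<^sup>+s. ennreal ((neg_log (gap_map d s))\<^sup>2) \<partial>P) + (\<integral>\<^sup>+s. ennreal (lyap_fun (gap_map d s)) \<partial>P)"
      by (rule nn_integral_add) auto
    finally have "(\<integral>\<^sup>+s. ennreal ((neg_log (gap_map d s))\<^sup>2 + lyap_fun (gap_map d s)) \<partial>P) + ennreal (min lyap_exp b * gap_weight d)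
       \<le> ((\<integral>\<^sup>+s. ennreal ((neg_log (gap_map d s))\<^sup>2) \<partial>P) + (\<integral>\<^sup>+s. ennreal (lyap_fun (gap_map d s)) \<partial>P))
         + (ennreal (lyap_exp * neg_log d) + ennreal (b * ln (1 + \<bar>d\<bar>)))"
      using 1 by (simp add: add_left_mono)
    also have "\<dots> = ((\<integral>\<^sup>+s. ennreal ((neg_log (gap_map d s))\<^sup>2) \<partial>P) + ennreal (lyap_exp * neg_log d))
       + ((\<integral>\<^sup>+s. ennreal (lyap_fun (gap_map d s)) \<partial>P) + ennreal (b * ln (1 + \<bar>d\<bar>)))"
      by (simp add: ac_simps)
    also have "\<dots> \<le> ennreal ((neg_log d)\<^sup>2 + C) + ennreal (lyap_fun d + D + A * K)"
      by (intro add_mono C_le lyap_fun_le)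
    also have "\<dots> = ennreal ((neg_log d)\<^sup>2 + lyap_fun d + (C + D + A * K))"
      using C D A K lyap_fun_nonneg by (subst ennreal_plus[symmetric]) (auto simp: ac_simps)
    finally show "(\<integral>\<^sup>+s. ennreal ((neg_log (gap_map d s))\<^sup>2 + lyap_fun (gap_map d s)) \<partial>P) + ennreal (min lyap_exp b * gap_weight d)
       \<le> ennreal ((neg_log d)\<^sup>2 + lyap_fun d + (C + D + A * K))" .
  qed
qed

section \<open>The stationary gap\<close>

sublocale seq: sequence_space P
  by unfold_locales

sublocale U: prob_space unit_uniform
  by (rule prob_space_unit_uniform)

sublocale PS: pair_prob_space P seq.S
  by unfold_locales

sublocale SU: pair_prob_space seq.S unit_uniform
  by unfold_locales

text \<open>A past lists innovations from the latest backwards, so prepending a fresh one is one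
  unit of time, and it preserves the law of the past.\<close>

lemma integral_PiM_iter:
  fixes h :: "(nat \<Rightarrow> real) \<Rightarrow> real"
  assumes [measurable]: "h \<in> borel_measurable seq.S" and bd: "\<And>p. \<bar>h p\<bar> \<le> B"
  shows "(\<integral>p. h p \<partial>seq.S) = (\<integral>p. \<integral>s. h (case_nat s p) \<partial>P \<partial>seq.S)"
proof -
  have i: "integrable (P \<Otimes>\<^sub>M seq.S) (\<lambda>(s, p). h (case_nat s p))"
    by (rule PS.integrable_const_bound[where B = B]) (use bd in auto)
  have "(\<integral>p. h p \<partial>seq.S) = (\<integral>p. h p \<partial>distr (P \<Otimes>\<^sub>M seq.S) seq.S (\<lambda>(s, p). case_nat s p))"
    by (simp add: seq.PiM_iter)
  also have "\<dots> = (\<integral>z. h ((\<lambda>(s, p). case_nat s p) z) \<partial>(P \<Otimes>\<^sub>M seq.S))"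
    by (rule integral_distr) measurable
  also have "\<dots> = (\<integral>z. (case z of (s, p) \<Rightarrow> h (case_nat s p)) \<partial>(P \<Otimes>\<^sub>M seq.S))"
    by (simp add: case_prod_beta')
  also have "\<dots> = (\<integral>p. \<integral>s. h (case_nat s p) \<partial>P \<partial>seq.S)"
    by (rule PS.integral_snd[OF i, symmetric])
  finally show ?thesis .
qed

lemma nn_integral_PiM_iter:
  assumes [measurable]: "h \<in> borel_measurable seq.S"
  shows "(\<integral>\<^sup>+p. h p \<partial>seq.S) = (\<integral>\<^sup>+p. \<integral>\<^sup>+s. h (case_nat s p) \<partial>P \<partial>seq.S)"
proof -
  have "(\<integral>\<^sup>+p. h p \<partial>seq.S) = (\<integral>\<^sup>+p. h p \<partial>distr (P \<Otimes>\<^sub>M seq.S) seq.S (\<lambda>(s, p). case_nat s p))"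
    by (simp add: seq.PiM_iter)
  also have "\<dots> = (\<integral>\<^sup>+z. h ((\<lambda>(s, p). case_nat s p) z) \<partial>(P \<Otimes>\<^sub>M seq.S))"
    by (rule nn_integral_distr) measurable
  also have "\<dots> = (\<integral>\<^sup>+p. \<integral>\<^sup>+s. h (case_nat s p) \<partial>P \<partial>seq.S)"
    by (subst PS.nn_integral_snd[symmetric]) auto
  finally show ?thesis .
qed

text \<open>The chain started at \<open>1\<close> at time \<open>-j\<close> and observed at time \<open>0\<close>; the innovation at
  time \<open>-1-i\<close> is \<open>p i\<close>.\<close>
primrec backward_gap :: "nat \<Rightarrow> (nat \<Rightarrow> real) \<Rightarrow> real" where
  "backward_gap 0 p = 1"
| "backward_gap (Suc j) p = gap_map (backward_gap j (\<lambda>i. p (Suc i))) (p 0)"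

lemma backward_gap_case_nat: "backward_gap (Suc j) (case_nat s p) = gap_map (backward_gap j p) s"
  by simp

lemma backward_gap_measurable[measurable]: "backward_gap j \<in> borel_measurable seq.S"
proof (induction j)
  case (Suc j)
  have [measurable]: "(\<lambda>p i. p (Suc i)) \<in> measurable seq.S seq.S"
    by (rule measurable_PiM_single') (auto simp: space_PiM)
  note Suc.IH[measurable]
  have "(\<lambda>p. gap_map (backward_gap j (\<lambda>i. p (Suc i))) (p 0)) \<in> borel_measurable seq.S" by measurable
  then show ?case by simp
qed simp

text \<open>The drift inequality is summed along the chain. As \<open>V\<close> is nonnegative, the
  expected weights up to \<open>m\<close> cost at most the initial value \<open>V 1\<close> plus
  \<open>C\<close> per step.\<close>

lemma cesaro_gap_weight:
  obtains B where "0 \<le> B" "\<And>m. (\<Sum>j\<le>m. \<integral>\<^sup>+p. ennreal (gap_weight (backward_gap j p)) \<partial>seq.S) \<le> ennreal (B * real (Suc m))"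
proof -
  obtain V a C where V[measurable]: "V \<in> borel_measurable borel" and a: "0 < a" and C: "0 \<le> C"
    and V0: "\<And>d. 0 \<le> V d"
    and drift: "\<And>d. (\<integral>\<^sup>+s. ennreal (V (gap_map d s)) \<partial>P) + ennreal (a * gap_weight d) \<le> ennreal (V d + C)"
    by (rule drift) blast
  let ?E = "\<lambda>j. \<integral>\<^sup>+p. ennreal (V (backward_gap j p)) \<partial>seq.S" and ?R = "\<lambda>j. \<integral>\<^sup>+p. ennreal (a * gap_weight (backward_gap j p)) \<partial>seq.S"
  have step: "?E (Suc j) + ?R j \<le> ?E j + ennreal C" for j
  proof -
    have "?E (Suc j) = (\<integral>\<^sup>+p. \<integral>\<^sup>+s. ennreal (V (gap_map (backward_gap j p) s)) \<partial>P \<partial>seq.S)"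
      by (subst nn_integral_PiM_iter) (simp_all del: backward_gap.simps add: backward_gap_case_nat)
    then have "?E (Suc j) + ?R j = (\<integral>\<^sup>+p. (\<integral>\<^sup>+s. ennreal (V (gap_map (backward_gap j p) s)) \<partial>P) + ennreal (a * gap_weight (backward_gap j p)) \<partial>seq.S)"
      by (simp add: nn_integral_add)
    also have "\<dots> \<le> (\<integral>\<^sup>+p. ennreal (V (backward_gap j p)) + ennreal C \<partial>seq.S)"
      by (intro nn_integral_mono order_trans[OF drift]) (simp add: V0 C)
    also have "\<dots> = ?E j + ennreal C"
      by (simp add: nn_integral_add seq.P.emeasure_space_1)
    finally show ?thesis .
  qed
  have tel: "?E (Suc m) + (\<Sum>j\<le>m. ?R j) \<le> ennreal (V 1 + real (Suc m) * C)" for m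
  proof (induction m)
    case 0
    show ?case using step[of 0] V0 C by (simp add: seq.P.emeasure_space_1)
  next
    case (Suc m)
    have "?E (Suc (Suc m)) + (\<Sum>j\<le>Suc m. ?R j) = (?E (Suc (Suc m)) + ?R (Suc m)) + (\<Sum>j\<le>m. ?R j)"
      by (simp only: sum.atMost_Suc ac_simps)
    also have "\<dots> \<le> (?E (Suc m) + ennreal C) + (\<Sum>j\<le>m. ?R j)" by (intro add_right_mono step)
    also have "\<dots> = (?E (Suc m) + (\<Sum>j\<le>m. ?R j)) + ennreal C" by (simp only: ac_simps)
    also have "\<dots> \<le> ennreal (V 1 + real (Suc m) * C) + ennreal C" by (intro add_right_mono Suc.IH)
    also have "\<dots> = ennreal (V 1 + real (Suc (Suc m)) * C)"
      using V0[of 1] C by (subst ennreal_plus[symmetric]) (auto simp: algebra_simps)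
    finally show ?case .
  qed
  show thesis
  proof (rule that[of "(V 1 + C) / a"])
    show "0 \<le> (V 1 + C) / a" using V0[of 1] C a by simp
    fix m
    have "(\<Sum>j\<le>m. ?R j) \<le> ennreal (V 1 + real (Suc m) * C)"
      using tel[of m] by (rule order_trans[rotated]) simp
    also have "\<dots> \<le> ennreal ((V 1 + C) * real (Suc m))"
      using V0[of 1] C by (intro ennreal_leI) (simp add: algebra_simps)
    finally have le: "(\<Sum>j\<le>m. ?R j) \<le> ennreal ((V 1 + C) * real (Suc m))" .
    have "ennreal (gap_weight d) = ennreal (1 / a) * ennreal (a * gap_weight d)" for d
      using a by (simp add: ennreal_mult'[symmetric])
    then have "(\<Sum>j\<le>m. \<integral>\<^sup>+p. ennreal (gap_weight (backward_gap j p)) \<partial>seq.S) = (\<Sum>j\<le>m. ennreal (1 / a) * ?R j)"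
      by (simp add: nn_integral_cmult)
    also have "\<dots> = ennreal (1 / a) * (\<Sum>j\<le>m. ?R j)" by (rule sum_distrib_left[symmetric])
    also have "\<dots> \<le> ennreal (1 / a) * ennreal ((V 1 + C) * real (Suc m))" by (intro mult_left_mono le) simp
    also have "\<dots> = ennreal ((V 1 + C) / a * real (Suc m))"
      using a by (simp add: ennreal_mult'[symmetric])
    finally show "(\<Sum>j\<le>m. \<integral>\<^sup>+p. ennreal (gap_weight (backward_gap j p)) \<partial>seq.S) \<le> ennreal ((V 1 + C) / a * real (Suc m))" .
  qed
qed

text \<open>Markov's inequality, averaged over starting times. It is applied to neighbourhoods of
  infinity and to punctured neighbourhoods of \<open>0\<close>.\<close>

lemma cesaro_prob:
  obtains B where "0 \<le> B"
    "\<And>Q t m. Q \<in> sets borel \<Longrightarrow> 0 < t \<Longrightarrow> (\<And>x. x \<in> Q \<Longrightarrow> t \<le> gap_weight x) \<Longrightarrow>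
      (\<Sum>j\<le>m. measure seq.S {p \<in> space seq.S. backward_gap j p \<in> Q}) \<le> B / t * real (Suc m)"
proof -
  obtain B where B: "0 \<le> B" and B_le: "\<And>m. (\<Sum>j\<le>m. \<integral>\<^sup>+p. ennreal (gap_weight (backward_gap j p)) \<partial>seq.S) \<le> ennreal (B * real (Suc m))"
    by (rule cesaro_gap_weight) blast
  show thesis
  proof (rule that[OF B])
    fix Q :: "real set" and t :: real and m :: nat
    assume [measurable]: "Q \<in> sets borel" and t: "0 < t" and Q: "\<And>x. x \<in> Q \<Longrightarrow> t \<le> gap_weight x"
    have one: "ennreal (measure seq.S {p \<in> space seq.S. backward_gap j p \<in> Q}) \<le> ennreal (1 / t) * (\<integral>\<^sup>+p. ennreal (gap_weight (backward_gap j p)) \<partial>seq.S)" for j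
    proof -
      have "ennreal (measure seq.S {p \<in> space seq.S. backward_gap j p \<in> Q}) = (\<integral>\<^sup>+p. indicator {p \<in> space seq.S. backward_gap j p \<in> Q} p \<partial>seq.S)"
        by (simp add: seq.P.emeasure_eq_measure)
      also have "\<dots> \<le> (\<integral>\<^sup>+p. ennreal (1 / t) * ennreal (gap_weight (backward_gap j p)) \<partial>seq.S)"
      proof (rule nn_integral_mono)
        fix p
        show "indicator {p \<in> space seq.S. backward_gap j p \<in> Q} p \<le> ennreal (1 / t) * ennreal (gap_weight (backward_gap j p))"
        proof (cases "backward_gap j p \<in> Q")
          case True
          then have "1 \<le> 1 / t * gap_weight (backward_gap j p)" using Q[OF True] t by (simp add: field_simps)
          then have "1 \<le> ennreal (1 / t * gap_weight (backward_gap j p))" using ennreal_leI by fastforce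
          also have "\<dots> = ennreal (1 / t) * ennreal (gap_weight (backward_gap j p))" using t by (intro ennreal_mult') simp
          finally show ?thesis by (auto split: split_indicator)
        qed simp
      qed
      also have "\<dots> = ennreal (1 / t) * (\<integral>\<^sup>+p. ennreal (gap_weight (backward_gap j p)) \<partial>seq.S)" by (rule nn_integral_cmult) simp
      finally show ?thesis .
    qed
    have "ennreal (\<Sum>j\<le>m. measure seq.S {p \<in> space seq.S. backward_gap j p \<in> Q}) = (\<Sum>j\<le>m. ennreal (measure seq.S {p \<in> space seq.S. backward_gap j p \<in> Q}))"
      by (rule sum_ennreal[symmetric]) simp
    also have "\<dots> \<le> (\<Sum>j\<le>m. ennreal (1 / t) * (\<integral>\<^sup>+p. ennreal (gap_weight (backward_gap j p)) \<partial>seq.S))" by (rule sum_mono[OF one])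
    also have "\<dots> = ennreal (1 / t) * (\<Sum>j\<le>m. \<integral>\<^sup>+p. ennreal (gap_weight (backward_gap j p)) \<partial>seq.S)" by (rule sum_distrib_left[symmetric])
    also have "\<dots> \<le> ennreal (1 / t) * ennreal (B * real (Suc m))" by (intro mult_left_mono B_le) simp
    also have "\<dots> = ennreal (B / t * real (Suc m))" using t by (simp add: ennreal_mult'[symmetric])
    finally show "(\<Sum>j\<le>m. measure seq.S {p \<in> space seq.S. backward_gap j p \<in> Q}) \<le> B / t * real (Suc m)"
      using B t by (subst (asm) ennreal_le_iff) auto
  qed
qed

text \<open>Fills the hole left by \<open>neg_log 0 = 0\<close>: the weight is blind to the fixed
  point itself, and the chain would never leave it.\<close>

lemma AE_backward_gap_neq_0: "AE p in seq.S. backward_gap j p \<noteq> 0"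
proof (induction j)
  case (Suc j)
  have "AE p in seq.S. AE s in P. backward_gap (Suc j) (case_nat s p) \<noteq> 0"
    using Suc.IH by eventually_elim (unfold backward_gap_case_nat, rule AE_gap_map_neq_0)
  then have "emeasure seq.S {p \<in> space seq.S. backward_gap (Suc j) p = 0} = 0"
  proof -
    assume ae: "AE p in seq.S. AE s in P. backward_gap (Suc j) (case_nat s p) \<noteq> 0"
    have "emeasure seq.S {p \<in> space seq.S. backward_gap (Suc j) p = 0} = (\<integral>\<^sup>+p. indicator {0} (backward_gap (Suc j) p) \<partial>seq.S)"
    proof -
      have "{p \<in> space seq.S. backward_gap (Suc j) p = 0} \<in> sets seq.S" by measurable
      then have "emeasure seq.S {p \<in> space seq.S. backward_gap (Suc j) p = 0}
          = (\<integral>\<^sup>+p. indicator {p \<in> space seq.S. backward_gap (Suc j) p = 0} p \<partial>seq.S)" by (simp del: backward_gap.simps)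
      also have "\<dots> = (\<integral>\<^sup>+p. indicator {0} (backward_gap (Suc j) p) \<partial>seq.S)"
        by (intro nn_integral_cong) (auto simp del: backward_gap.simps split: split_indicator)
      finally show ?thesis .
    qed
    also have "\<dots> = (\<integral>\<^sup>+p. \<integral>\<^sup>+s. indicator {0} (backward_gap (Suc j) (case_nat s p)) \<partial>P \<partial>seq.S)"
      by (rule nn_integral_PiM_iter) measurable
    also have "\<dots> = (\<integral>\<^sup>+p. 0 \<partial>seq.S)"
    proof (rule nn_integral_cong_AE)
      show "AE p in seq.S. (\<integral>\<^sup>+s. indicator {0} (backward_gap (Suc j) (case_nat s p)) \<partial>P) = 0"
        using ae
      proof eventually_elim
        case (elim p)
        have "(\<integral>\<^sup>+s. indicator {0} (backward_gap (Suc j) (case_nat s p)) \<partial>P) = (\<integral>\<^sup>+s. 0 \<partial>P)"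
          using elim by (intro nn_integral_cong_AE) (auto elim: eventually_mono)
        then show ?case by simp
      qed
    qed
    finally show ?thesis by simp
  qed
  then show ?case
    by (intro AE_I[where N = "{p \<in> space seq.S. backward_gap (Suc j) p = 0}"]) (auto simp del: backward_gap.simps)
qed simp

lemma backward_gap_tight:
  assumes e: "0 < e"
  shows "\<exists>R::nat. \<forall>m. (\<Sum>j\<le>m. measure seq.S {p \<in> space seq.S. real R \<le> \<bar>backward_gap j p\<bar>}) \<le> e * real (Suc m)"
proof -
  obtain B where B: "0 \<le> B" and B_le:
    "\<And>Q t m. Q \<in> sets borel \<Longrightarrow> 0 < t \<Longrightarrow> (\<And>x. x \<in> Q \<Longrightarrow> t \<le> gap_weight x) \<Longrightarrow>
      (\<Sum>j\<le>m. measure seq.S {p \<in> space seq.S. backward_gap j p \<in> Q}) \<le> B / t * real (Suc m)"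
    by (rule cesaro_prob) blast
  \<comment> \<open>The summand 1 keeps \<open>t\<close> positive when \<open>B = 0\<close>.\<close>
  define t where "t = B / e + 1"
  have t: "0 < t" using B e by (simp add: t_def add_nonneg_pos)
  have Bt: "B / t \<le> e" using B e by (simp add: t_def field_simps)
  obtain R :: nat where R: "exp t \<le> real R" using real_arch_simple by blast
  have "{x::real. real R \<le> \<bar>x\<bar>} \<in> sets borel" by measurable
  moreover have "t \<le> gap_weight x" if "x \<in> {x. real R \<le> \<bar>x\<bar>}" for x
  proof -
    have "exp t \<le> 1 + \<bar>x\<bar>" using R that by simp
    then have "t \<le> ln (1 + \<bar>x\<bar>)" by (subst ln_ge_iff) auto
    then show ?thesis using neg_log_nonneg[of x] by (simp add: gap_weight_def)
  qed
  ultimately have "(\<Sum>j\<le>m. measure seq.S {p \<in> space seq.S. backward_gap j p \<in> {x. real R \<le> \<bar>x\<bar>}}) \<le> B / t * real (Suc m)" for m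
    using t by (intro B_le)
  moreover have "B / t * real (Suc m) \<le> e * real (Suc m)" for m using Bt by (intro mult_right_mono) auto
  ultimately have "(\<Sum>j\<le>m. measure seq.S {p \<in> space seq.S. backward_gap j p \<in> {x. real R \<le> \<bar>x\<bar>}}) \<le> e * real (Suc m)" for m
    by (meson order_trans)
  then show ?thesis by auto
qed

text \<open>The joint law with the past has to be invariant, since the volatility is a function of
  that past. Appending an innovation to the averaged laws amounts to shifting the starting time by
  one, which the averages barely notice.\<close>

lemma stationary_difference:
  obtains D where "D \<in> borel_measurable (seq.S \<Otimes>\<^sub>M unit_uniform)"
    and "AE z in seq.S \<Otimes>\<^sub>M unit_uniform. D z \<noteq> 0"
    and "distr (P \<Otimes>\<^sub>M (seq.S \<Otimes>\<^sub>M unit_uniform)) (seq.S \<Otimes>\<^sub>M borel) (\<lambda>(s, z). (case_nat s (fst z), gap_map (D z) s))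
       = distr (seq.S \<Otimes>\<^sub>M unit_uniform) (seq.S \<Otimes>\<^sub>M borel) (\<lambda>z. (fst z, D z))"
proof -
  obtain b K D where b: "\<And>n. b n \<in> cesaro_weights n (K n)"
    and D[measurable]: "D \<in> borel_measurable (seq.S \<Otimes>\<^sub>M unit_uniform)"
    and lim: "\<And>f B. f \<in> borel_measurable (seq.S \<Otimes>\<^sub>M borel) \<Longrightarrow> (\<And>\<omega> x. \<omega> \<in> space seq.S \<Longrightarrow> \<bar>f (\<omega>, x)\<bar> \<le> B) \<Longrightarrow>
      (\<And>\<omega>. \<omega> \<in> space seq.S \<Longrightarrow> continuous_on UNIV (\<lambda>x. f (\<omega>, x))) \<Longrightarrow>
      (\<lambda>n. \<Sum>j\<le>K n. b n j * (\<integral>\<omega>. f (\<omega>, backward_gap j \<omega>) \<partial>seq.S)) \<longlonglongrightarrow>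
        (\<integral>\<omega>. \<integral>u. f (\<omega>, D (\<omega>, u)) \<partial>unit_uniform \<partial>seq.S)"
    by (rule seq.P.random_weak_limit[of backward_gap]) (use backward_gap_tight in \<open>blast intro: backward_gap_measurable\<close>)+
  have lim': "(\<lambda>n. \<Sum>j\<le>K n. b n j * (\<integral>\<omega>. f (\<omega>, backward_gap j \<omega>) \<partial>seq.S)) \<longlonglongrightarrow>
        (\<integral>z. f (fst z, D z) \<partial>(seq.S \<Otimes>\<^sub>M unit_uniform))"
    if f[measurable]: "f \<in> borel_measurable (seq.S \<Otimes>\<^sub>M borel)" and bd: "\<And>\<omega> x. \<bar>f (\<omega>, x)\<bar> \<le> B"
      and cont: "\<And>\<omega>. continuous_on UNIV (\<lambda>x. f (\<omega>, x))" for f B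
  proof -
    have i: "integrable (seq.S \<Otimes>\<^sub>M unit_uniform) (\<lambda>z. f (fst z, D z))"
      by (rule SU.integrable_const_bound[where B = B]) (use bd in auto)
    have "(\<integral>z. f (fst z, D z) \<partial>(seq.S \<Otimes>\<^sub>M unit_uniform)) = (\<integral>\<omega>. \<integral>u. f (\<omega>, D (\<omega>, u)) \<partial>unit_uniform \<partial>seq.S)"
      using SU.integral_fst'[OF i] by simp
    then show ?thesis using lim[OF f bd cont] by simp
  qed
  show thesis
  proof (rule that[OF D])
    obtain B where B: "0 \<le> B" and B_le:
      "\<And>Q t m. Q \<in> sets borel \<Longrightarrow> 0 < t \<Longrightarrow> (\<And>x. x \<in> Q \<Longrightarrow> t \<le> gap_weight x) \<Longrightarrow>
        (\<Sum>j\<le>m. measure seq.S {p \<in> space seq.S. backward_gap j p \<in> Q}) \<le> B / t * real (Suc m)"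
      by (rule cesaro_prob) blast
    have le: "SU.prob {z \<in> space (seq.S \<Otimes>\<^sub>M unit_uniform). D z = 0} \<le> B / t" if t: "0 < t" for t
    proof -
      \<comment> \<open>A continuous tent with value 1 at \<open>0\<close>, since indicators do not
        pass to the weak limit.\<close>
      define \<psi> where "\<psi> x = max 0 (1 - \<bar>x\<bar> / exp (- t))" for x :: real
      have \<psi>: "0 \<le> \<psi> x" "\<psi> x \<le> 1" for x by (auto simp: \<psi>_def)
      have \<psi>_cont: "continuous_on UNIV \<psi>" unfolding \<psi>_def by (intro continuous_intros) auto
      then have [measurable]: "\<psi> \<in> borel_measurable borel" by (rule borel_measurable_continuous_onI)
      \<comment> \<open>Before the limit the point \<open>0\<close> has no mass, so the tent is
        dominated by a punctured neighbourhood, where \<open>gap_weight\<close> is at least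
        \<open>t\<close>.\<close>
      have int: "(\<integral>p. \<psi> (backward_gap j p) \<partial>seq.S) \<le> measure seq.S {p \<in> space seq.S. backward_gap j p \<in> {x. x \<noteq> 0 \<and> \<bar>x\<bar> \<le> exp (- t)}}" for j
      proof -
        let ?Q = "{p \<in> space seq.S. backward_gap j p \<in> {x. x \<noteq> 0 \<and> \<bar>x\<bar> \<le> exp (- t)}}"
        have [measurable]: "?Q \<in> sets seq.S" by measurable
        have "(\<integral>p. \<psi> (backward_gap j p) \<partial>seq.S) \<le> (\<integral>p. indicator ?Q p \<partial>seq.S)"
        proof (rule integral_mono_AE)
          show "integrable seq.S (\<lambda>p. \<psi> (backward_gap j p))"
            by (rule seq.P.integrable_const_bound[where B = 1]) (use \<psi> in auto)
          show "integrable seq.S (indicator ?Q :: _ \<Rightarrow> real)"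
            by (rule seq.P.integrable_const_bound[where B = 1]) auto
          show "AE p in seq.S. \<psi> (backward_gap j p) \<le> indicator ?Q p"
            using AE_backward_gap_neq_0[of j] AE_space
          proof eventually_elim
            case (elim p)
            show ?case
            proof (cases "\<bar>backward_gap j p\<bar> \<le> exp (- t)")
              case True
              then have "p \<in> ?Q" using elim by simp
              then show ?thesis using \<psi>(2) by simp
            next
              case False
              then have "1 \<le> \<bar>backward_gap j p\<bar> / exp (- t)" by simp
              then have "\<psi> (backward_gap j p) = 0" unfolding \<psi>_def by (intro max_absorb1) linarith
              then show ?thesis by simp
            qed
          qed
        qed
        also have "\<dots> = measure seq.S (?Q \<inter> space seq.S)" by (rule Bochner_Integration.integral_indicator)
        also have "?Q \<inter> space seq.S = ?Q" by auto
        finally show ?thesis .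
      qed
      have "(\<Sum>j\<le>m. \<integral>p. \<psi> (backward_gap j p) \<partial>seq.S) \<le> B / t * real (Suc m)" for m
      proof (rule order_trans[OF sum_mono[OF int] B_le])
        show "{x::real. x \<noteq> 0 \<and> \<bar>x\<bar> \<le> exp (- t)} \<in> sets borel" by measurable
        fix x :: real assume "x \<in> {x. x \<noteq> 0 \<and> \<bar>x\<bar> \<le> exp (- t)}"
        then have "ln \<bar>x\<bar> \<le> ln (exp (- t))" by (intro ln_mono) auto
        then have "t \<le> neg_log x" by (simp add: neg_log_def)
        then show "t \<le> gap_weight x" by (simp add: gap_weight_def add_increasing2)
      qed (rule t)
      then have up: "(\<Sum>j\<le>K n. b n j * (\<integral>p. \<psi> (backward_gap j p) \<partial>seq.S)) \<le> B / t" for n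
        by (rule cesaro_weights_bound[OF b])
      have "(\<lambda>n. \<Sum>j\<le>K n. b n j * (\<integral>p. (\<lambda>(p, x). \<psi> x) (p, backward_gap j p) \<partial>seq.S)) \<longlonglongrightarrow>
          (\<integral>z. (\<lambda>(p, x). \<psi> x) (fst z, D z) \<partial>(seq.S \<Otimes>\<^sub>M unit_uniform))"
        by (rule lim'[of "\<lambda>(p, x). \<psi> x" 1]) (use \<psi> \<psi>_cont in \<open>auto simp: abs_le_iff intro: order_trans\<close>)
      then have "(\<integral>z. \<psi> (D z) \<partial>(seq.S \<Otimes>\<^sub>M unit_uniform)) \<le> B / t"
        by (intro LIMSEQ_le_const2) (use up in auto)
      moreover have "SU.prob {z \<in> space (seq.S \<Otimes>\<^sub>M unit_uniform). D z = 0} \<le> (\<integral>z. \<psi> (D z) \<partial>(seq.S \<Otimes>\<^sub>M unit_uniform))"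
      proof -
        let ?Z = "{z \<in> space (seq.S \<Otimes>\<^sub>M unit_uniform). D z = 0}"
        have [measurable]: "?Z \<in> sets (seq.S \<Otimes>\<^sub>M unit_uniform)" by measurable
        have "SU.prob ?Z = SU.prob (?Z \<inter> space (seq.S \<Otimes>\<^sub>M unit_uniform))" by (rule arg_cong[where f = SU.prob]) auto
        also have "\<dots> = (\<integral>z. indicator ?Z z \<partial>(seq.S \<Otimes>\<^sub>M unit_uniform))"
          by (rule Bochner_Integration.integral_indicator[symmetric])
        also have "\<dots> \<le> (\<integral>z. \<psi> (D z) \<partial>(seq.S \<Otimes>\<^sub>M unit_uniform))"
        proof (rule integral_mono)
          show "integrable (seq.S \<Otimes>\<^sub>M unit_uniform) (indicator ?Z :: _ \<Rightarrow> real)"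
            by (rule SU.integrable_const_bound[where B = 1]) auto
          show "integrable (seq.S \<Otimes>\<^sub>M unit_uniform) (\<lambda>z. \<psi> (D z))"
            by (rule SU.integrable_const_bound[where B = 1]) (use \<psi> in auto)
          show "indicator ?Z z \<le> \<psi> (D z)" for z
            using \<psi>(1) by (auto simp: \<psi>_def split: split_indicator)
        qed
        finally show ?thesis .
      qed
      ultimately show ?thesis by linarith
    qed
    have "SU.prob {z \<in> space (seq.S \<Otimes>\<^sub>M unit_uniform). D z = 0} \<le> 0"
    proof (rule field_le_epsilon)
      fix e :: real assume e: "0 < e"
      have "B / (B / e + 1) \<le> e" using B e by (simp add: field_simps)
      moreover have "0 < B / e + 1" using B e by (simp add: add_nonneg_pos)
      ultimately show "SU.prob {z \<in> space (seq.S \<Otimes>\<^sub>M unit_uniform). D z = 0} \<le> 0 + e"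
        using le[of "B / e + 1"] by linarith
    qed
    then have z: "SU.prob {z \<in> space (seq.S \<Otimes>\<^sub>M unit_uniform). D z = 0} = 0"
      using measure_nonneg by (rule antisym)
    show "AE z in seq.S \<Otimes>\<^sub>M unit_uniform. D z \<noteq> 0"
    proof (rule AE_I[where N = "{z \<in> space (seq.S \<Otimes>\<^sub>M unit_uniform). D z = 0}"])
      show "{z \<in> space (seq.S \<Otimes>\<^sub>M unit_uniform). D z = 0} \<in> sets (seq.S \<Otimes>\<^sub>M unit_uniform)" by measurable
    qed (auto simp: SU.emeasure_eq_measure z)
    interpret PSU: pair_prob_space P "seq.S \<Otimes>\<^sub>M unit_uniform" by unfold_locales
    show "distr (P \<Otimes>\<^sub>M (seq.S \<Otimes>\<^sub>M unit_uniform)) (seq.S \<Otimes>\<^sub>M borel) (\<lambda>(s, z). (case_nat s (fst z), gap_map (D z) s))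
       = distr (seq.S \<Otimes>\<^sub>M unit_uniform) (seq.S \<Otimes>\<^sub>M borel) (\<lambda>z. (fst z, D z))"
    proof (rule measure_pair_real_eqI)
      show "prob_space (distr (P \<Otimes>\<^sub>M (seq.S \<Otimes>\<^sub>M unit_uniform)) (seq.S \<Otimes>\<^sub>M borel) (\<lambda>(s, z). (case_nat s (fst z), gap_map (D z) s)))"
        by (rule PSU.prob_space_distr) measurable
      show "prob_space (distr (seq.S \<Otimes>\<^sub>M unit_uniform) (seq.S \<Otimes>\<^sub>M borel) (\<lambda>z. (fst z, D z)))"
        by (rule SU.prob_space_distr) measurable
      fix A and \<psi> :: "real \<Rightarrow> real"
      assume A[measurable]: "A \<in> sets seq.S" and \<psi>_cont: "continuous_on UNIV \<psi>" and \<psi>: "\<And>x. \<bar>\<psi> x\<bar> \<le> 1"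
      have [measurable]: "\<psi> \<in> borel_measurable borel" using \<psi>_cont by (rule borel_measurable_continuous_onI)
      define f where "f = (\<lambda>(p, x). indicator A p * \<psi> x)"
      have f_meas[measurable]: "f \<in> borel_measurable (seq.S \<Otimes>\<^sub>M borel)" unfolding f_def by measurable
      have f_bd: "\<bar>f (p, x)\<bar> \<le> 1" for p x using \<psi> by (auto simp: f_def split: split_indicator)
      have f_cont: "continuous_on UNIV (\<lambda>x. f (p, x))" for p
        unfolding f_def by (auto intro!: continuous_intros \<psi>_cont)
      \<comment> \<open>One step of the chain applied to \<open>f\<close>. It is again continuous in
        the gap by the Feller property, so the limit along the averages may be taken for
        \<open>f\<close> and \<open>f'\<close> alike.\<close>
      define f' where "f' = (\<lambda>(p, x). \<integral>s. f (case_nat s p, gap_map x s) \<partial>P)"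
      have f'_meas: "f' \<in> borel_measurable (seq.S \<Otimes>\<^sub>M borel)" unfolding f'_def by measurable
      have f'_bd: "\<bar>f' (p, x)\<bar> \<le> 1" for p x
      proof (cases "integrable P (\<lambda>s. f (case_nat s p, gap_map x s))")
        case True
        have "\<bar>\<integral>s. f (case_nat s p, gap_map x s) \<partial>P\<bar> \<le> (\<integral>s. \<bar>f (case_nat s p, gap_map x s)\<bar> \<partial>P)"
          by (rule integral_abs_bound)
        also have "\<dots> \<le> (\<integral>s. 1 \<partial>P)" using True f_bd by (intro integral_mono) auto
        finally show ?thesis by (simp add: f'_def P.prob_space[simplified])
      qed (simp add: f'_def not_integrable_integral_eq)
      have f'_cont: "continuous_on UNIV (\<lambda>x. f' (p, x))" if p: "p \<in> space seq.S" for p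
      proof (rule continuous_on_sequentiallyI)
        fix u :: "nat \<Rightarrow> real" and a assume u: "u \<longlonglongrightarrow> a"
        have "(\<lambda>n. \<integral>s. f (case_nat s p, gap_map (u n) s) \<partial>P) \<longlonglongrightarrow> (\<integral>s. f (case_nat s p, gap_map a s) \<partial>P)"
        proof (rule integral_dominated_convergence[where w = "\<lambda>_. 1"])
          show "AE s in P. (\<lambda>n. f (case_nat s p, gap_map (u n) s)) \<longlonglongrightarrow> f (case_nat s p, gap_map a s)"
          proof (rule AE_I2)
            fix s
            have "(\<lambda>n. gap_map (u n) s) \<longlonglongrightarrow> gap_map a s" unfolding gap_map_def by (intro tendsto_intros u) simp_all
            then have "(\<lambda>n. \<psi> (gap_map (u n) s)) \<longlonglongrightarrow> \<psi> (gap_map a s)"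
              using \<psi>_cont by (auto intro: isCont_tendsto_compose simp: continuous_on_eq_continuous_at)
            then show "(\<lambda>n. f (case_nat s p, gap_map (u n) s)) \<longlonglongrightarrow> f (case_nat s p, gap_map a s)"
              unfolding f_def by (auto intro!: tendsto_intros)
          qed
        qed (use p f_bd in auto)
        then show "(\<lambda>n. f' (p, u n)) \<longlonglongrightarrow> f' (p, a)" by (simp add: f'_def)
      qed
      let ?a = "\<lambda>j. \<integral>p. f (p, backward_gap j p) \<partial>seq.S"
      \<comment> \<open>Running the chain started at \<open>- j\<close> for one more step is, in
        law, starting it one unit earlier.\<close>
      have shift: "(\<integral>p. f' (p, backward_gap j p) \<partial>seq.S) = ?a (Suc j)" for j
      proof -
        have "?a (Suc j) = (\<integral>p. \<integral>s. f (case_nat s p, backward_gap (Suc j) (case_nat s p)) \<partial>P \<partial>seq.S)"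
          by (rule integral_PiM_iter[where B = 1]) (use f_bd in \<open>auto simp del: backward_gap.simps\<close>)
        then show ?thesis by (simp only: backward_gap_case_nat f'_def prod.case)
      qed
      have a_bd: "\<bar>?a j\<bar> \<le> 1" for j
      proof -
        have "\<bar>?a j\<bar> \<le> (\<integral>p. \<bar>f (p, backward_gap j p)\<bar> \<partial>seq.S)" by (rule integral_abs_bound)
        also have "\<dots> \<le> (\<integral>p. 1 \<partial>seq.S)"
        proof (rule integral_mono)
          show "integrable seq.S (\<lambda>p. \<bar>f (p, backward_gap j p)\<bar>)"
            by (rule seq.P.integrable_const_bound[where B = 1]) (use f_bd in auto)
        qed (use f_bd in auto)
        finally show ?thesis by (simp add: seq.P.prob_space)
      qed
      have l1: "(\<lambda>n. \<Sum>j\<le>K n. b n j * ?a j) \<longlonglongrightarrow> (\<integral>z. f (fst z, D z) \<partial>(seq.S \<Otimes>\<^sub>M unit_uniform))"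
        by (rule lim'[OF f_meas f_bd f_cont])
      have l2: "(\<lambda>n. \<Sum>j\<le>K n. b n j * ?a (Suc j)) \<longlonglongrightarrow> (\<integral>z. f' (fst z, D z) \<partial>(seq.S \<Otimes>\<^sub>M unit_uniform))"
      proof -
        have i: "integrable (seq.S \<Otimes>\<^sub>M unit_uniform) (\<lambda>z. f' (fst z, D z))"
          by (rule SU.integrable_const_bound[where B = 1]) (use f'_bd f'_meas in auto)
        show ?thesis
          using lim[OF f'_meas f'_bd f'_cont] SU.integral_fst'[OF i] unfolding shift by simp
      qed
      have "(\<lambda>n. (\<Sum>j\<le>K n. b n j * ?a (Suc j)) - (\<Sum>j\<le>K n. b n j * ?a j)) \<longlonglongrightarrow> 0"
      proof (rule Lim_null_comparison)
        show "eventually (\<lambda>n. norm ((\<Sum>j\<le>K n. b n j * ?a (Suc j)) - (\<Sum>j\<le>K n. b n j * ?a j)) \<le> 2 * inverse (real (Suc n))) sequentially"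
        proof (rule always_eventually, rule allI)
          fix n
          show "norm ((\<Sum>j\<le>K n. b n j * ?a (Suc j)) - (\<Sum>j\<le>K n. b n j * ?a j)) \<le> 2 * inverse (real (Suc n))"
            using cesaro_weights_almost_invariant[OF b, of ?a 1 n, OF a_bd]
            by (simp only: inverse_eq_divide real_norm_def times_divide_eq_right)
        qed
        show "(\<lambda>n. 2 * inverse (real (Suc n))) \<longlonglongrightarrow> 0"
          using tendsto_mult[OF tendsto_const LIMSEQ_inverse_real_of_nat, of 2] by simp
      qed
      then have "(\<integral>z. f' (fst z, D z) \<partial>(seq.S \<Otimes>\<^sub>M unit_uniform)) - (\<integral>z. f (fst z, D z) \<partial>(seq.S \<Otimes>\<^sub>M unit_uniform)) = 0"
        by (rule LIMSEQ_unique[OF tendsto_diff[OF l2 l1]])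
      moreover have "(\<integral>z. f' (fst z, D z) \<partial>(seq.S \<Otimes>\<^sub>M unit_uniform))
          = (\<integral>(s, z). f (case_nat s (fst z), gap_map (D z) s) \<partial>(P \<Otimes>\<^sub>M (seq.S \<Otimes>\<^sub>M unit_uniform)))"
      proof -
        have i: "integrable (P \<Otimes>\<^sub>M (seq.S \<Otimes>\<^sub>M unit_uniform)) (\<lambda>(s, z). f (case_nat s (fst z), gap_map (D z) s))"
          by (rule PSU.integrable_const_bound[where B = 1]) (use f_bd in auto)
        show ?thesis unfolding f'_def using PSU.integral_snd[OF i] by simp
      qed
      ultimately have eq: "(\<integral>(s, z). f (case_nat s (fst z), gap_map (D z) s) \<partial>(P \<Otimes>\<^sub>M (seq.S \<Otimes>\<^sub>M unit_uniform)))
          = (\<integral>z. f (fst z, D z) \<partial>(seq.S \<Otimes>\<^sub>M unit_uniform))" by simp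
      have [measurable]: "(\<lambda>z. indicator A (fst z) * \<psi> (snd z)) \<in> borel_measurable (seq.S \<Otimes>\<^sub>M borel)" by measurable
      show "(\<integral>z. indicator A (fst z) * \<psi> (snd z) \<partial>distr (P \<Otimes>\<^sub>M (seq.S \<Otimes>\<^sub>M unit_uniform)) (seq.S \<Otimes>\<^sub>M borel) (\<lambda>(s, z). (case_nat s (fst z), gap_map (D z) s)))
          = (\<integral>z. indicator A (fst z) * \<psi> (snd z) \<partial>distr (seq.S \<Otimes>\<^sub>M unit_uniform) (seq.S \<Otimes>\<^sub>M borel) (\<lambda>z. (fst z, D z)))"
        using eq by (simp add: integral_distr f_def case_prod_beta')
    qed simp_all
  qed
qed

section \<open>The stationary system\<close>

text \<open>The recursion for the logarithm of the squared volatility, solved backwards. Where the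
  series diverges its value is arbitrary, so identities are claimed only under summability.\<close>

definition log_vol :: "real \<Rightarrow> (nat \<Rightarrow> real) \<Rightarrow> real" where
  "log_vol \<alpha> p = (\<Sum>i. \<beta> ^ i * (\<alpha> + news (p i)))"

lemma log_vol_measurable[measurable]: "log_vol \<alpha> \<in> borel_measurable seq.S"
  unfolding log_vol_def[abs_def] by measurable

lemma AE_summable: "AE p in seq.S. summable (\<lambda>i. \<beta> ^ i * (\<alpha> + news (p i)))"
proof -
  have comp: "(\<integral>\<^sup>+p. ennreal (\<beta> ^ i * news (p i)) \<partial>seq.S) = ennreal (\<beta> ^ i * (\<integral>s. news s \<partial>P))" for i
  proof -
    have "(\<integral>\<^sup>+p. ennreal (\<beta> ^ i * news (p i)) \<partial>seq.S) = (\<integral>\<^sup>+s. ennreal (\<beta> ^ i * news s) \<partial>distr seq.S P (\<lambda>p. p i))"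
      by (subst nn_integral_distr) auto
    also have "\<dots> = (\<integral>\<^sup>+s. ennreal (\<beta> ^ i * news s) \<partial>P)" by (simp add: seq.PiM_component)
    also have "\<dots> = ennreal (\<integral>s. \<beta> ^ i * news s \<partial>P)"
      using news_integrable news_nonneg \<beta>_pos by (intro nn_integral_eq_integral) auto
    finally show ?thesis by simp
  qed
  have E0: "0 \<le> (\<integral>s. news s \<partial>P)" by (intro integral_nonneg_AE) (simp add: news_nonneg)
  have "(\<integral>\<^sup>+p. (\<Sum>i. ennreal (\<beta> ^ i * news (p i))) \<partial>seq.S) = (\<Sum>i. ennreal (\<beta> ^ i * (\<integral>s. news s \<partial>P)))"
    by (subst nn_integral_suminf) (simp_all add: comp)
  also have "\<dots> < \<infinity>"
    using E0 \<beta>_pos \<beta>_less_1 by (subst suminf_ennreal2) (auto intro!: summable_mult2 summable_geometric)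
  finally have "AE p in seq.S. (\<Sum>i. ennreal (\<beta> ^ i * news (p i))) \<noteq> \<infinity>"
    by (intro nn_integral_noteq_infinite) auto
  then show ?thesis
  proof eventually_elim
    case (elim p)
    then have "summable (\<lambda>i. \<beta> ^ i * news (p i))"
      using news_nonneg \<beta>_pos by (intro summable_suminf_not_top) auto
    then have "summable (\<lambda>i. \<beta> ^ i * \<alpha> + \<beta> ^ i * news (p i))"
      using \<beta>_pos \<beta>_less_1 by (intro summable_add summable_mult2 summable_geometric) auto
    then show ?case by (simp add: distrib_left)
  qed
qed

lemma log_vol_case_nat:
  assumes "summable (\<lambda>i. \<beta> ^ i * (\<alpha> + news (p i)))"
  shows "log_vol \<alpha> (case_nat s p) = \<alpha> + news s + \<beta> * log_vol \<alpha> p"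
proof -
  let ?f = "\<lambda>i. \<beta> ^ i * (\<alpha> + news (case_nat s p i))"
  have S: "(\<lambda>i. ?f (Suc i)) = (\<lambda>i. \<beta> * (\<beta> ^ i * (\<alpha> + news (p i))))" by (simp add: mult.assoc)
  have "summable (\<lambda>i. ?f (Suc i))" unfolding S using assms by (rule summable_mult)
  then have "summable ?f" using summable_Suc_iff[of ?f] by blast
  then have "(\<Sum>i. ?f (Suc i)) = suminf ?f - ?f 0" by (rule suminf_split_head)
  then have "suminf ?f = ?f 0 + (\<Sum>i. ?f (Suc i))" by linarith
  also have "(\<Sum>i. ?f (Suc i)) = \<beta> * log_vol \<alpha> p"
    unfolding S log_vol_def using assms by (rule suminf_mult)
  finally show ?thesis by (simp add: log_vol_def)
qed

text \<open>The factor \<open>exp (h / 2)\<close> of the observation cancels against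
  \<open>x powr (- 1 / 2)\<close> up to \<open>exp (- d / 2)\<close>. This cancellation makes the
  gap autonomous; \<open>d = 0\<close> gives the recursion of the true volatility.\<close>

lemma HE_exp:
  "HE (\<alpha>, \<beta>, \<gamma>, \<delta>) (sqrt (exp h) * e) (exp (h + d)) = exp (\<alpha> + news e + \<beta> * h + gap_map d e)"
proof -
  have "sqrt (exp h) = exp (h / 2)" by (rule real_sqrt_unique) (simp_all flip: exp_double)
  then have y: "\<gamma> * \<bar>sqrt (exp h) * e\<bar> + \<delta> * (sqrt (exp h) * e) = exp (h / 2) * news e"
    by (simp add: news_def abs_mult algebra_simps)
  have x: "exp (h + d) powr (- 1 / 2) = exp (- (h + d) / 2)" by (simp add: powr_def field_simps)
  have "exp (h / 2) * news e * exp (- (h + d) / 2) = news e * (exp (h / 2) * exp (- (h + d) / 2))" by simp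
  also have "exp (h / 2) * exp (- (h + d) / 2) = exp (- d / 2)"
    unfolding exp_add[symmetric] by (rule arg_cong[where f = exp]) (simp add: field_simps)
  finally show ?thesis
    unfolding HE_def prod.case y x by (simp add: gap_map_def algebra_simps)
qed

section \<open>The pair of volatilities as a function of past and gap\<close>

definition sys_step :: "real \<Rightarrow> real \<times> real \<Rightarrow> real \<Rightarrow> real \<times> real" where
  "sys_step \<alpha> z e = (HE (\<alpha>, \<beta>, \<gamma>, \<delta>) (sqrt (fst z) * e) (fst z), HE (\<alpha>, \<beta>, \<gamma>, \<delta>) (sqrt (fst z) * e) (snd z))"

lemma sys_step_measurable[measurable]:
  "(\<lambda>(z, e). sys_step \<alpha> z e) \<in> measurable (borel \<Otimes>\<^sub>M borel) borel"
proof -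
  have "(\<lambda>(z, e). sys_step \<alpha> z e) \<in> measurable ((borel \<Otimes>\<^sub>M borel) \<Otimes>\<^sub>M borel) (borel \<Otimes>\<^sub>M borel)"
    unfolding sys_step_def HE_def prod.case by measurable
  then show ?thesis by (simp only: borel_prod)
qed

definition sys_state :: "real \<Rightarrow> (nat \<Rightarrow> real) \<Rightarrow> real \<Rightarrow> real \<times> real" where
  "sys_state \<alpha> p d = (exp (log_vol \<alpha> p), exp (log_vol \<alpha> p + d))"

lemma sys_state_measurable[measurable]:
  "(\<lambda>(p, d). sys_state \<alpha> p d) \<in> measurable (seq.S \<Otimes>\<^sub>M borel) borel"
proof -
  have "(\<lambda>(p, d). sys_state \<alpha> p d) \<in> measurable (seq.S \<Otimes>\<^sub>M borel) (borel \<Otimes>\<^sub>M borel)"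
    unfolding sys_state_def by measurable
  then show ?thesis by (simp only: borel_prod)
qed

lemma sys_step_state:
  assumes "summable (\<lambda>i. \<beta> ^ i * (\<alpha> + news (p i)))"
  shows "sys_step \<alpha> (sys_state \<alpha> p d) e = sys_state \<alpha> (case_nat e p) (gap_map d e)"
  using HE_exp[of \<alpha> "log_vol \<alpha> p" e 0] HE_exp[of \<alpha> "log_vol \<alpha> p" e d]
  by (simp add: sys_step_def sys_state_def log_vol_case_nat[OF assms] gap_map_0)

text \<open>The invariant law of past and gap is pushed forward to the pair of volatilities. For
  stationarity the past may then be forgotten, the pair being a Markov chain driven by fresh
  innovations.\<close>

lemma stationary_initial_law:
  obtains D where "D \<in> borel_measurable (seq.S \<Otimes>\<^sub>M unit_uniform)"
    and "AE z in seq.S \<Otimes>\<^sub>M unit_uniform. D z \<noteq> 0"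
    and "\<And>f. f \<in> borel_measurable borel \<Longrightarrow>
      (\<integral>\<^sup>+z. \<integral>\<^sup>+s. f (sys_step \<alpha> (sys_state \<alpha> (fst z) (D z)) s) \<partial>P \<partial>(seq.S \<Otimes>\<^sub>M unit_uniform))
       = (\<integral>\<^sup>+z. f (sys_state \<alpha> (fst z) (D z)) \<partial>(seq.S \<Otimes>\<^sub>M unit_uniform))"
proof -
  obtain D where D[measurable]: "D \<in> borel_measurable (seq.S \<Otimes>\<^sub>M unit_uniform)"
    and D0: "AE z in seq.S \<Otimes>\<^sub>M unit_uniform. D z \<noteq> 0"
    and inv: "distr (P \<Otimes>\<^sub>M (seq.S \<Otimes>\<^sub>M unit_uniform)) (seq.S \<Otimes>\<^sub>M borel) (\<lambda>(s, z). (case_nat s (fst z), gap_map (D z) s))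
       = distr (seq.S \<Otimes>\<^sub>M unit_uniform) (seq.S \<Otimes>\<^sub>M borel) (\<lambda>z. (fst z, D z))"
    by (rule stationary_difference)
  interpret PSU: pair_prob_space P "seq.S \<Otimes>\<^sub>M unit_uniform" by unfold_locales
  show thesis
  proof (rule that[OF D D0])
    fix f :: "real \<times> real \<Rightarrow> ennreal" assume f[measurable]: "f \<in> borel_measurable borel"
    let ?h = "\<lambda>(p, d). f (sys_state \<alpha> p d)"
    have sum: "AE z in seq.S \<Otimes>\<^sub>M unit_uniform. summable (\<lambda>i. \<beta> ^ i * (\<alpha> + news (fst z i)))"
    proof -
      obtain N where N: "{p \<in> space seq.S. \<not> summable (\<lambda>i. \<beta> ^ i * (\<alpha> + news (p i)))} \<subseteq> N"
        "emeasure seq.S N = 0" "N \<in> sets seq.S"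
        using AE_summable by (rule AE_E)
      note [measurable] = N(3)
      have "AE p in seq.S. p \<notin> N" using N by (intro AE_not_in) (auto simp: null_sets_def)
      then have "AE z in seq.S \<Otimes>\<^sub>M unit_uniform. fst z \<notin> N"
      proof (intro SU.AE_pair_measure)
        assume "AE p in seq.S. p \<notin> N"
        then show "AE p in seq.S. AE u in unit_uniform. fst (p, u) \<notin> N" by eventually_elim simp
        show "{z \<in> space (seq.S \<Otimes>\<^sub>M unit_uniform). fst z \<notin> N} \<in> sets (seq.S \<Otimes>\<^sub>M unit_uniform)"
          by measurable
      qed
      then show ?thesis using AE_space
      proof eventually_elim
        case (elim z)
        then show ?case using N(1) by (auto simp: space_pair_measure)
      qed
    qed
    have "(\<integral>\<^sup>+z. \<integral>\<^sup>+s. f (sys_step \<alpha> (sys_state \<alpha> (fst z) (D z)) s) \<partial>P \<partial>(seq.S \<Otimes>\<^sub>M unit_uniform))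
        = (\<integral>\<^sup>+z. \<integral>\<^sup>+s. ?h (case_nat s (fst z), gap_map (D z) s) \<partial>P \<partial>(seq.S \<Otimes>\<^sub>M unit_uniform))"
      using sum by (intro nn_integral_cong_AE) (auto elim!: eventually_mono simp: sys_step_state)
    also have "\<dots> = (\<integral>\<^sup>+x. ?h ((\<lambda>(s, z). (case_nat s (fst z), gap_map (D z) s)) x) \<partial>(P \<Otimes>\<^sub>M (seq.S \<Otimes>\<^sub>M unit_uniform)))"
      by (subst PSU.nn_integral_snd[symmetric]) auto
    also have "\<dots> = (\<integral>\<^sup>+x. ?h x \<partial>distr (seq.S \<Otimes>\<^sub>M unit_uniform) (seq.S \<Otimes>\<^sub>M borel) (\<lambda>z. (fst z, D z)))"
      unfolding inv[symmetric] by (rule nn_integral_distr[symmetric]) measurable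
    also have "\<dots> = (\<integral>\<^sup>+z. f (sys_state \<alpha> (fst z) (D z)) \<partial>(seq.S \<Otimes>\<^sub>M unit_uniform))"
      by (subst nn_integral_distr) auto
    finally show "(\<integral>\<^sup>+z. \<integral>\<^sup>+s. f (sys_step \<alpha> (sys_state \<alpha> (fst z) (D z)) s) \<partial>P \<partial>(seq.S \<Otimes>\<^sub>M unit_uniform))
       = (\<integral>\<^sup>+z. f (sys_state \<alpha> (fst z) (D z)) \<partial>(seq.S \<Otimes>\<^sub>M unit_uniform))" .
  qed
qed

text \<open>A step consumes \<open>e 0\<close> alone, which returns the state to the law
  \<open>\<mu>\<close>, while the later innovations stay independent of it.\<close>

lemma step_preserves_law:
  assumes \<mu>: "prob_space \<mu>" and s\<mu>[measurable_cong]: "sets \<mu> = sets borel"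
    and inv: "\<And>f. f \<in> borel_measurable borel \<Longrightarrow>
      (\<integral>\<^sup>+z. \<integral>\<^sup>+s. f (sys_step \<alpha> z s) \<partial>P \<partial>\<mu>) = (\<integral>\<^sup>+z. f z \<partial>\<mu>)"
  shows "distr (\<mu> \<Otimes>\<^sub>M seq.S) (\<mu> \<Otimes>\<^sub>M seq.S) (\<lambda>(z, e). (sys_step \<alpha> z (e 0), \<lambda>t. e (Suc t))) = \<mu> \<Otimes>\<^sub>M seq.S"
proof -
  interpret \<mu>: prob_space \<mu> by (rule \<mu>)
  interpret \<mu>S: pair_prob_space \<mu> seq.S by unfold_locales
  have [measurable]: "(\<lambda>p t. p (Suc t)) \<in> measurable seq.S seq.S"
    by (rule measurable_PiM_single') (auto simp: space_PiM)
  show ?thesis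
  proof (rule measure_eqI)
    fix A assume "A \<in> sets (distr (\<mu> \<Otimes>\<^sub>M seq.S) (\<mu> \<Otimes>\<^sub>M seq.S) (\<lambda>(z, e). (sys_step \<alpha> z (e 0), \<lambda>t. e (Suc t))))"
    then have A[measurable]: "A \<in> sets (\<mu> \<Otimes>\<^sub>M seq.S)" by simp
    let ?I = "\<lambda>z e. indicator A (z, e) :: ennreal"
    have "emeasure (distr (\<mu> \<Otimes>\<^sub>M seq.S) (\<mu> \<Otimes>\<^sub>M seq.S) (\<lambda>(z, e). (sys_step \<alpha> z (e 0), \<lambda>t. e (Suc t)))) A
        = (\<integral>\<^sup>+x. indicator A x \<partial>distr (\<mu> \<Otimes>\<^sub>M seq.S) (\<mu> \<Otimes>\<^sub>M seq.S) (\<lambda>(z, e). (sys_step \<alpha> z (e 0), \<lambda>t. e (Suc t))))"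
      by simp
    also have "\<dots> = (\<integral>\<^sup>+x. (case x of (z, e) \<Rightarrow> ?I (sys_step \<alpha> z (e 0)) (\<lambda>t. e (Suc t))) \<partial>(\<mu> \<Otimes>\<^sub>M seq.S))"
      by (subst nn_integral_distr) (auto simp: case_prod_beta')
    also have "\<dots> = (\<integral>\<^sup>+z. \<integral>\<^sup>+e. ?I (sys_step \<alpha> z (e 0)) (\<lambda>t. e (Suc t)) \<partial>seq.S \<partial>\<mu>)"
      by (subst seq.P.nn_integral_fst[symmetric]) auto
    also have "\<dots> = (\<integral>\<^sup>+z. \<integral>\<^sup>+e. \<integral>\<^sup>+s. ?I (sys_step \<alpha> z s) e \<partial>P \<partial>seq.S \<partial>\<mu>)"
    proof (rule nn_integral_cong)
      fix z assume z: "z \<in> space \<mu>"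
      have "(\<lambda>e. ?I (sys_step \<alpha> z (e 0)) (\<lambda>t. e (Suc t))) \<in> borel_measurable seq.S"
        using z by measurable
      from nn_integral_PiM_iter[OF this]
      show "(\<integral>\<^sup>+e. ?I (sys_step \<alpha> z (e 0)) (\<lambda>t. e (Suc t)) \<partial>seq.S) = (\<integral>\<^sup>+e. \<integral>\<^sup>+s. ?I (sys_step \<alpha> z s) e \<partial>P \<partial>seq.S)"
        by simp
    qed
    \<comment> \<open>With the later innovations held fixed, state and consumed innovation are
      integrated first, so that invariance of \<open>\<mu>\<close> applies inside.\<close>
    also have "\<dots> = (\<integral>\<^sup>+e. \<integral>\<^sup>+z. \<integral>\<^sup>+s. ?I (sys_step \<alpha> z s) e \<partial>P \<partial>\<mu> \<partial>seq.S)"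
      by (rule \<mu>S.Fubini'[symmetric]) measurable
    also have "\<dots> = (\<integral>\<^sup>+e. \<integral>\<^sup>+z. ?I z e \<partial>\<mu> \<partial>seq.S)"
    proof (rule nn_integral_cong)
      fix e assume e: "e \<in> space seq.S"
      then have "(\<lambda>z. ?I z e) \<in> borel_measurable \<mu>" by measurable
      then have "(\<lambda>z. ?I z e) \<in> borel_measurable borel" using measurable_cong_sets[OF s\<mu> refl] by blast
      then show "(\<integral>\<^sup>+z. \<integral>\<^sup>+s. ?I (sys_step \<alpha> z s) e \<partial>P \<partial>\<mu>) = (\<integral>\<^sup>+z. ?I z e \<partial>\<mu>)" by (rule inv)
    qed
    also have "\<dots> = emeasure (\<mu> \<Otimes>\<^sub>M seq.S) A"
      by (subst \<mu>S.nn_integral_snd) auto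
    finally show "emeasure (distr (\<mu> \<Otimes>\<^sub>M seq.S) (\<mu> \<Otimes>\<^sub>M seq.S) (\<lambda>(z, e). (sys_step \<alpha> z (e 0), \<lambda>t. e (Suc t)))) A
        = emeasure (\<mu> \<Otimes>\<^sub>M seq.S) A" .
  qed simp
qed

section \<open>Iterating the system forward\<close>

primrec run :: "real \<Rightarrow> real \<times> real \<Rightarrow> (nat \<Rightarrow> real) \<Rightarrow> nat \<Rightarrow> real \<times> real" where
  "run \<alpha> z e 0 = z"
| "run \<alpha> z e (Suc t) = sys_step \<alpha> (run \<alpha> z e t) (e t)"

lemma run_add: "run \<alpha> z e (t + h) = run \<alpha> (run \<alpha> z e h) (\<lambda>i. e (i + h)) t"
  by (induction t) simp_all

lemma run_measurable[measurable]: "(\<lambda>(z, e). run \<alpha> z e t) \<in> measurable (borel \<Otimes>\<^sub>M seq.S) borel"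
proof (induction t)
  case 0
  show ?case by simp
next
  case (Suc t)
  note Suc.IH[measurable]
  show ?case unfolding run.simps by measurable
qed

lemma run_pos:
  assumes "0 < fst z" "0 < snd z"
  shows "0 < fst (run \<alpha> z e t) \<and> 0 < snd (run \<alpha> z e t)"
  by (cases t) (simp_all add: assms sys_step_def HE_def)

text \<open>The current state together with the whole remaining future determines the rest of the
  path; its invariance therefore gives strict stationarity of the path, not just of single
  times.\<close>

lemma run_shift_law:
  assumes \<mu>: "prob_space \<mu>" and s\<mu>[measurable_cong]: "sets \<mu> = sets borel"
    and inv: "\<And>f. f \<in> borel_measurable borel \<Longrightarrow>
      (\<integral>\<^sup>+z. \<integral>\<^sup>+s. f (sys_step \<alpha> z s) \<partial>P \<partial>\<mu>) = (\<integral>\<^sup>+z. f z \<partial>\<mu>)"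
  shows "distr (\<mu> \<Otimes>\<^sub>M seq.S) (\<mu> \<Otimes>\<^sub>M seq.S) (\<lambda>(z, e). (run \<alpha> z e h, \<lambda>i. e (i + h))) = \<mu> \<Otimes>\<^sub>M seq.S"
proof (induction h)
  case 0
  show ?case by (simp add: case_prod_beta' distr_id)
next
  case (Suc h)
  have [measurable]: "(\<lambda>p t. p (Suc t)) \<in> measurable seq.S seq.S"
    "(\<lambda>p t. p (t + h)) \<in> measurable seq.S seq.S"
    by (rule measurable_PiM_single', auto simp: space_PiM)+
  let ?T = "\<lambda>(z, e). (sys_step \<alpha> z (e 0), \<lambda>t. e (Suc t))"
  have "distr (\<mu> \<Otimes>\<^sub>M seq.S) (\<mu> \<Otimes>\<^sub>M seq.S) (\<lambda>(z, e). (run \<alpha> z e (Suc h), \<lambda>i. e (i + Suc h)))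
      = distr (\<mu> \<Otimes>\<^sub>M seq.S) (\<mu> \<Otimes>\<^sub>M seq.S) (?T \<circ> (\<lambda>(z, e). (run \<alpha> z e h, \<lambda>i. e (i + h))))"
    by (rule arg_cong[where f = "distr (\<mu> \<Otimes>\<^sub>M seq.S) (\<mu> \<Otimes>\<^sub>M seq.S)"]) (auto simp: fun_eq_iff)
  also have "\<dots> = distr (distr (\<mu> \<Otimes>\<^sub>M seq.S) (\<mu> \<Otimes>\<^sub>M seq.S) (\<lambda>(z, e). (run \<alpha> z e h, \<lambda>i. e (i + h)))) (\<mu> \<Otimes>\<^sub>M seq.S) ?T"
    by (rule distr_distr[symmetric]) measurable
  also have "\<dots> = \<mu> \<Otimes>\<^sub>M seq.S"
    unfolding Suc.IH by (rule step_preserves_law[OF assms])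
  finally show ?case .
qed

end

section \<open>Past and future of an i.i.d. family\<close>

lemma (in prob_space) iid_reindex:
  fixes f :: "'i \<Rightarrow> int"
  assumes "iid M \<epsilon>" "inj f"
  shows "distr M (PiM UNIV (\<lambda>_. borel)) (\<lambda>\<omega> i. \<epsilon> (f i) \<omega>) = PiM UNIV (\<lambda>_. distr M borel (\<epsilon> 0))"
proof -
  let ?P = "distr M borel (\<epsilon> 0)"
  have ind: "indep_vars (\<lambda>_. borel) \<epsilon> UNIV" and same: "\<And>t. distr M borel (\<epsilon> t) = ?P"
    using assms(1) by (auto simp: iid_def)
  have rv[measurable]: "\<epsilon> t \<in> borel_measurable M" for t using ind by (auto simp: indep_vars_def)
  have S: "sets (PiM UNIV (\<lambda>_::'j. ?P)) = sets (PiM UNIV (\<lambda>_. borel))" for dummy :: 'j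
    by (rule sets_PiM_cong) auto
  have Z: "distr M (PiM UNIV (\<lambda>_::int. borel)) (\<lambda>\<omega> i. \<epsilon> i \<omega>) = PiM UNIV (\<lambda>_. ?P)"
  proof -
    have eq: "(\<lambda>i. distr M borel (\<epsilon> i)) = (\<lambda>_. ?P)" by (rule ext) (rule same)
    show ?thesis
      using indep_vars_iff_distr_eq_PiM[of "UNIV :: int set" \<epsilon> "\<lambda>_. borel"] ind
      unfolding eq by (simp add: restrict_def)
  qed
  have m1: "(\<lambda>e i. e (f i)) \<in> measurable (PiM UNIV (\<lambda>_. borel)) (PiM UNIV (\<lambda>_. borel :: real measure))"
    by (rule measurable_PiM_single') (auto simp: space_PiM)
  have m2: "(\<lambda>\<omega> i. \<epsilon> i \<omega>) \<in> measurable M (PiM UNIV (\<lambda>_. borel))"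
    by (rule measurable_PiM_single') (auto simp: space_PiM)
  have "distr M (PiM UNIV (\<lambda>_. borel)) (\<lambda>\<omega> i. \<epsilon> (f i) \<omega>)
      = distr (distr M (PiM UNIV (\<lambda>_. borel)) (\<lambda>\<omega> i. \<epsilon> i \<omega>)) (PiM UNIV (\<lambda>_. borel)) (\<lambda>e i. e (f i))"
    by (subst distr_distr[OF m1 m2]) (simp add: comp_def)
  also have "\<dots> = distr (PiM UNIV (\<lambda>_. ?P)) (PiM UNIV (\<lambda>_. ?P)) (\<lambda>e. \<lambda>i\<in>UNIV. e (f i))"
    unfolding Z by (rule distr_cong) (auto intro!: sets_PiM_cong)
  also have "\<dots> = PiM UNIV (\<lambda>_. ?P)"
    by (rule distr_PiM_reindex) (use assms(2) in \<open>auto intro: prob_space_distr\<close>)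
  finally show ?thesis .
qed

text \<open>Disjoint blocks of coordinates are independent. Time 0 belongs to the future, as the
  step from time 0 to time 1 consumes \<open>\<epsilon> 0\<close>.\<close>

lemma (in prob_space) iid_past_future:
  fixes \<epsilon> :: "int \<Rightarrow> 'a \<Rightarrow> real"
  defines "P \<equiv> distr M borel (\<epsilon> 0)"
  assumes iid: "iid M \<epsilon>"
  shows "distr M (PiM UNIV (\<lambda>_. P) \<Otimes>\<^sub>M PiM UNIV (\<lambda>_. P)) (\<lambda>\<omega>. (\<lambda>i::nat. \<epsilon> (- 1 - int i) \<omega>, \<lambda>t::nat. \<epsilon> (int t) \<omega>))
    = PiM UNIV (\<lambda>_. P) \<Otimes>\<^sub>M PiM UNIV (\<lambda>_. P)"
proof -
  let ?B = "PiM (UNIV :: nat set) (\<lambda>_. borel :: real measure)"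
  have sB: "sets (PiM (UNIV :: nat set) (\<lambda>_. P)) = sets ?B"
    by (rule sets_PiM_cong) (auto simp: P_def)
  have ind: "indep_vars (\<lambda>_. borel) \<epsilon> UNIV" using iid by (auto simp: iid_def)
  have "indep_var (PiM {..<0} (\<lambda>_. borel)) (\<lambda>\<omega>. restrict (\<lambda>i. \<epsilon> i \<omega>) {..<0}) (PiM {0..} (\<lambda>_. borel)) (\<lambda>\<omega>. restrict (\<lambda>i. \<epsilon> i \<omega>) {0..})"
    by (rule indep_var_restrict[OF ind]) auto
  then have "indep_var ?B ((\<lambda>e i. e (- 1 - int i)) \<circ> (\<lambda>\<omega>. restrict (\<lambda>i. \<epsilon> i \<omega>) {..<0}))
      ?B ((\<lambda>e t. e (int t)) \<circ> (\<lambda>\<omega>. restrict (\<lambda>i. \<epsilon> i \<omega>) {0..}))"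
  proof (rule indep_var_compose)
    show "(\<lambda>e i. e (- 1 - int i)) \<in> measurable (PiM {..<0} (\<lambda>_. borel)) ?B"
      by (rule measurable_PiM_single') (auto simp: space_PiM intro!: measurable_component_singleton)
    show "(\<lambda>e t. e (int t)) \<in> measurable (PiM {0..} (\<lambda>_. borel)) ?B"
      by (rule measurable_PiM_single') (auto simp: space_PiM intro!: measurable_component_singleton)
  qed
  then have "indep_var ?B (\<lambda>\<omega> i. \<epsilon> (- 1 - int i) \<omega>) ?B (\<lambda>\<omega> t. \<epsilon> (int t) \<omega>)"
    by (simp add: comp_def)
  then have "distr M ?B (\<lambda>\<omega> i. \<epsilon> (- 1 - int i) \<omega>) \<Otimes>\<^sub>M distr M ?B (\<lambda>\<omega> t. \<epsilon> (int t) \<omega>)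
      = distr M (?B \<Otimes>\<^sub>M ?B) (\<lambda>\<omega>. (\<lambda>i. \<epsilon> (- 1 - int i) \<omega>, \<lambda>t. \<epsilon> (int t) \<omega>))"
    unfolding indep_var_distribution_eq by blast
  moreover have "distr M ?B (\<lambda>\<omega> i. \<epsilon> (- 1 - int i) \<omega>) = PiM UNIV (\<lambda>_. P)"
    unfolding P_def by (rule iid_reindex[OF iid]) (auto simp: inj_def)
  moreover have "distr M ?B (\<lambda>\<omega> t. \<epsilon> (int t) \<omega>) = PiM UNIV (\<lambda>_. P)"
    unfolding P_def by (rule iid_reindex[OF iid]) (auto simp: inj_def)
  moreover have "distr M (PiM UNIV (\<lambda>_. P) \<Otimes>\<^sub>M PiM UNIV (\<lambda>_. P)) (\<lambda>\<omega>. (\<lambda>i::nat. \<epsilon> (- 1 - int i) \<omega>, \<lambda>t::nat. \<epsilon> (int t) \<omega>))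
      = distr M (?B \<Otimes>\<^sub>M ?B) (\<lambda>\<omega>. (\<lambda>i. \<epsilon> (- 1 - int i) \<omega>, \<lambda>t. \<epsilon> (int t) \<omega>))"
    by (rule distr_cong) (auto intro!: sets_pair_measure_cong sB)
  ultimately show ?thesis by simp
qed

section \<open>Construction of the solution on the product with the unit interval\<close>

theorem theorem3p1:
  fixes M :: "'a measure" and \<epsilon> :: "int \<Rightarrow> 'a \<Rightarrow> real" and g :: "real \<Rightarrow> real"
    and \<alpha> \<beta> \<gamma> \<delta> :: real
  assumes "prob_space M"
    and "\<gamma> \<ge> \<bar>\<delta>\<bar>" and "\<beta> > 0"
    and "iid M \<epsilon>"
    and "expectation_log_abs_finite M (\<lambda>\<omega>. \<alpha> + \<gamma> * \<bar>\<epsilon> 0 \<omega>\<bar> + \<delta> * \<epsilon> 0 \<omega>)" and "\<beta> < 1"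
    and "distributed M lborel (\<epsilon> 0) (\<lambda>x. ennreal (g x))" and "continuous_on UNIV g"
    and "integrable M (\<epsilon> 0)" and "prob_space.expectation M (\<epsilon> 0) = 0"
    and "integrable M (\<lambda>\<omega>. (\<epsilon> 0 \<omega>)\<^sup>2)" and "prob_space.expectation M (\<lambda>\<omega>. (\<epsilon> 0 \<omega>)\<^sup>2) = 1"
    and "\<And>x. g x > 0" and "bdd_above (range (\<lambda>x. (\<bar>x\<bar> + 1) * g x))"
    and "integrable M (\<lambda>\<omega>. ln \<bar>\<beta> - 1 / 2 * (\<gamma> * \<bar>\<epsilon> 0 \<omega>\<bar> + \<delta> * \<epsilon> 0 \<omega>)\<bar>)"
    and "prob_space.expectation M (\<lambda>\<omega>. ln \<bar>\<beta> - 1 / 2 * (\<gamma> * \<bar>\<epsilon> 0 \<omega>\<bar> + \<delta> * \<epsilon> 0 \<omega>)\<bar>) > 0"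
  shows "\<exists>(N :: ('a \<times> real) measure) \<pi> v w.
           stationary_system_solution M (\<alpha>, \<beta>, \<gamma>, \<delta>) \<epsilon> N \<pi> v w \<and>
           measure N {\<omega> \<in> space N. v 0 \<omega> = w 0 \<omega>} = 0"
proof -
  interpret M: prob_space M by (rule assms(1))
  define P where "P = distr M borel (\<epsilon> 0)"
  have rv[measurable]: "\<epsilon> t \<in> borel_measurable M" for t
    using assms(4) by (auto simp: iid_def M.indep_vars_def)
  obtain G where G: "\<And>x. (\<bar>x\<bar> + 1) * g x \<le> G"
    using assms(14) by (auto simp: bdd_above_def)
  have g_le: "g x \<le> G" for x
  proof -
    have "0 \<le> \<bar>x\<bar> * g x" using assms(13)[of x] by simp
    moreover have "(\<bar>x\<bar> + 1) * g x = \<bar>x\<bar> * g x + g x" by (simp add: distrib_right)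
    ultimately show ?thesis using G[of x] by linarith
  qed
  have g_meas[measurable]: "g \<in> borel_measurable borel"
    using assms(8) by (rule borel_measurable_continuous_onI)
  interpret egarch_noise P g G \<beta> \<gamma> \<delta>
  proof (intro egarch_noise.intro egarch_noise_axioms.intro)
    show "prob_space P"
      unfolding P_def by (rule M.prob_space_distr) simp
    have "distr M lborel (\<epsilon> 0) = density lborel (\<lambda>x. ennreal (g x))"
      using assms(7) by (simp add: distributed_def)
    moreover have "distr M lborel (\<epsilon> 0) = P" unfolding P_def by (rule distr_cong) auto
    ultimately show "P = density lborel (\<lambda>x. ennreal (g x))" by simp
    show "integrable P (\<lambda>x. x\<^sup>2)"
      unfolding P_def using assms(11) by (subst integrable_distr_eq) auto
    show "integrable P (\<lambda>x. ln \<bar>\<beta> - 1 / 2 * (\<gamma> * \<bar>x\<bar> + \<delta> * x)\<bar>)"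
      unfolding P_def using assms(15) by (subst integrable_distr_eq) auto
    show "0 < (\<integral>x. ln \<bar>\<beta> - 1 / 2 * (\<gamma> * \<bar>x\<bar> + \<delta> * x)\<bar> \<partial>P)"
      unfolding P_def using assms(16) by (subst integral_distr) auto
    show "g \<in> borel_measurable borel" by (rule g_meas)
    show "g x \<le> G" for x by (rule g_le)
    show "\<bar>\<delta>\<bar> \<le> \<gamma>" "0 < \<beta>" "\<beta> < 1" by (fact assms)+
  qed
  let ?\<theta> = "(\<alpha>, \<beta>, \<gamma>, \<delta>)"
  have sS: "sets seq.S = sets (PiM UNIV (\<lambda>_. borel))" by (rule sets_PiM_cong) auto
  \<comment> \<open>Innovations strictly before \<open>t\<close>, latest first:
    \<open>\<sigma> t\<close> must not involve \<open>\<epsilon> t\<close>.\<close>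
  define past where "past t \<omega> = (\<lambda>i::nat. \<epsilon> (t - 1 - int i) \<omega>)" for t \<omega>
  have past_meas[measurable]: "past t \<in> measurable M seq.S" for t
    unfolding past_def by (rule measurable_PiM_single') (auto simp: space_PiM)
  have past_law: "distr M seq.S (past t) = seq.S" for t
  proof -
    have "distr M seq.S (past t) = distr M (PiM UNIV (\<lambda>_. borel)) (\<lambda>\<omega> i. \<epsilon> (t - 1 - int i) \<omega>)"
      unfolding past_def by (rule distr_cong) (auto simp: sS)
    also have "\<dots> = seq.S"
      unfolding P_def by (rule M.iid_reindex[OF assms(4)]) (auto simp: inj_def)
    finally show ?thesis .
  qed
  have past_Suc: "past (t + 1) \<omega> = case_nat (\<epsilon> t \<omega>) (past t \<omega>)" for t \<omega>
    by (auto simp: past_def fun_eq_iff algebra_simps split: nat.split)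
  let ?sm = "\<lambda>p. summable (\<lambda>i. \<beta> ^ i * (\<alpha> + news (p i)))"
  have sm_AE: "AE \<omega> in M. \<forall>t. ?sm (past t \<omega>)"
    unfolding AE_all_countable
  proof
    fix t
    show "AE \<omega> in M. ?sm (past t \<omega>)"
      by (rule AE_distrD[OF past_meas[of t]], unfold past_law) (rule AE_summable)
  qed
  define \<sigma> where "\<sigma> t \<omega> = exp (log_vol \<alpha> (past t \<omega>) / 2)" for t \<omega>
  have \<sigma>_meas[measurable]: "\<sigma> t \<in> borel_measurable M" for t unfolding \<sigma>_def by measurable
  have \<sigma>_sq: "(\<sigma> t \<omega>)\<^sup>2 = exp (log_vol \<alpha> (past t \<omega>))" for t \<omega>
    by (simp add: \<sigma>_def flip: exp_double)
  have egarch: "stationary_egarch_volatility M ?\<theta> \<epsilon> \<sigma>"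
    unfolding stationary_egarch_volatility_def prod.case strictly_stationary_def
  proof (intro conjI allI ballI)
    fix h :: int
    \<comment> \<open>The volatility path is one measurable functional of the innovation path that
      commutes with time shifts, so it inherits stationarity.\<close>
    let ?F = "\<lambda>e t. exp (log_vol \<alpha> (\<lambda>i. e (t - 1 - int i)) / 2)"
    have "distr M (PiM UNIV (\<lambda>_. borel)) (\<lambda>\<omega> t. \<sigma> (t + h) \<omega>)
        = distr (PiM UNIV (\<lambda>_. P)) (PiM UNIV (\<lambda>_. borel)) ?F" for h :: int
    proof -
      have "(\<lambda>\<omega> t. \<sigma> (t + h) \<omega>) = ?F \<circ> (\<lambda>\<omega> s. \<epsilon> (s + h) \<omega>)"
        by (auto simp: fun_eq_iff \<sigma>_def past_def algebra_simps)
      moreover have F: "?F \<in> measurable (PiM UNIV (\<lambda>_. borel)) (PiM UNIV (\<lambda>_. borel))"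
      proof (rule measurable_PiM_single')
        fix t :: int
        have [measurable]: "(\<lambda>e i. e (t - 1 - int i)) \<in> measurable (PiM UNIV (\<lambda>_. borel)) seq.S"
          by (rule measurable_PiM_single') (auto simp: space_PiM)
        show "(\<lambda>e. ?F e t) \<in> borel_measurable (PiM UNIV (\<lambda>_. borel))" by measurable
      qed (auto simp: space_PiM)
      moreover have "(\<lambda>\<omega> s. \<epsilon> (s + h) \<omega>) \<in> measurable M (PiM UNIV (\<lambda>_. borel))"
        by (rule measurable_PiM_single') (auto simp: space_PiM)
      ultimately have "distr M (PiM UNIV (\<lambda>_. borel)) (\<lambda>\<omega> t. \<sigma> (t + h) \<omega>)
          = distr (distr M (PiM UNIV (\<lambda>_. borel)) (\<lambda>\<omega> s. \<epsilon> (s + h) \<omega>)) (PiM UNIV (\<lambda>_. borel)) ?F"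
        by (simp add: distr_distr)
      also have "distr M (PiM UNIV (\<lambda>_. borel)) (\<lambda>\<omega> s. \<epsilon> (s + h) \<omega>) = PiM UNIV (\<lambda>_. P)"
        unfolding P_def by (rule M.iid_reindex[OF assms(4)]) (auto simp: inj_def)
      finally show ?thesis .
    qed
    from this[of h] this[of 0]
    show "distr M (PiM UNIV (\<lambda>_. borel)) (\<lambda>\<omega> t. \<sigma> (t + h) \<omega>) = distr M (PiM UNIV (\<lambda>_. borel)) (\<lambda>\<omega> t. \<sigma> t \<omega>)"
      by simp
  next
    show "AE \<omega> in M. \<forall>t. ln ((\<sigma> t \<omega>)\<^sup>2) =
        \<alpha> + \<gamma> * \<bar>\<epsilon> (t - 1) \<omega>\<bar> + \<delta> * \<epsilon> (t - 1) \<omega> + \<beta> * ln ((\<sigma> (t - 1) \<omega>)\<^sup>2)"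
      using sm_AE
    proof eventually_elim
      case (elim \<omega>)
      show ?case
      proof
        fix t
        show "ln ((\<sigma> t \<omega>)\<^sup>2) = \<alpha> + \<gamma> * \<bar>\<epsilon> (t - 1) \<omega>\<bar> + \<delta> * \<epsilon> (t - 1) \<omega> + \<beta> * ln ((\<sigma> (t - 1) \<omega>)\<^sup>2)"
          using past_Suc[of "t - 1" \<omega>] log_vol_case_nat[of \<alpha> "past (t - 1) \<omega>" "\<epsilon> (t - 1) \<omega>"] elim
          by (simp add: \<sigma>_sq news_def)
      qed
    qed
  qed (auto simp: \<sigma>_def)
  obtain D where D[measurable]: "D \<in> borel_measurable (seq.S \<Otimes>\<^sub>M unit_uniform)"
    and D0: "AE z in seq.S \<Otimes>\<^sub>M unit_uniform. D z \<noteq> 0"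
    and D_inv: "\<And>f. f \<in> borel_measurable borel \<Longrightarrow>
      (\<integral>\<^sup>+z. \<integral>\<^sup>+s. f (sys_step \<alpha> (sys_state \<alpha> (fst z) (D z)) s) \<partial>P \<partial>(seq.S \<Otimes>\<^sub>M unit_uniform))
       = (\<integral>\<^sup>+z. f (sys_state \<alpha> (fst z) (D z)) \<partial>(seq.S \<Otimes>\<^sub>M unit_uniform))"
    by (rule stationary_initial_law) blast
  define \<zeta> where "\<zeta> z = sys_state \<alpha> (fst z) (D z)" for z
  have \<zeta>[measurable]: "\<zeta> \<in> measurable (seq.S \<Otimes>\<^sub>M unit_uniform) borel" unfolding \<zeta>_def by measurable
  define \<mu> where "\<mu> = distr (seq.S \<Otimes>\<^sub>M unit_uniform) borel \<zeta>"
  have s\<mu>[measurable_cong]: "sets \<mu> = sets borel" by (simp add: \<mu>_def)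
  interpret \<mu>: prob_space \<mu> unfolding \<mu>_def by (rule SU.prob_space_distr) measurable
  interpret \<mu>S: pair_prob_space \<mu> seq.S by unfold_locales
  have \<mu>_inv: "(\<integral>\<^sup>+z. \<integral>\<^sup>+s. f (sys_step \<alpha> z s) \<partial>P \<partial>\<mu>) = (\<integral>\<^sup>+z. f z \<partial>\<mu>)"
    if [measurable]: "f \<in> borel_measurable borel" for f
    using D_inv[OF that] unfolding \<mu>_def by (simp add: nn_integral_distr \<zeta>_def)
  have shift_law: "distr (\<mu> \<Otimes>\<^sub>M seq.S) (\<mu> \<Otimes>\<^sub>M seq.S) (\<lambda>(z, e). (run \<alpha> z e h, \<lambda>i. e (i + h))) = \<mu> \<Otimes>\<^sub>M seq.S" for h
    by (rule run_shift_law[OF \<mu>.prob_space_axioms s\<mu>]) (rule \<mu>_inv)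
  \<comment> \<open>The second factor supplies the independent uniform variable that
    \<open>D\<close> turns into the initial gap.\<close>
  define N where "N = M \<Otimes>\<^sub>M unit_uniform"
  interpret MU: pair_prob_space M unit_uniform by unfold_locales
  interpret N: prob_space N unfolding N_def by (rule MU.prob_space_axioms)
  define z0 where "z0 x = \<zeta> (past 0 (fst x), snd x)" for x :: "'a \<times> real"
  define fut where "fut \<omega> = (\<lambda>t::nat. \<epsilon> (int t) \<omega>)" for \<omega>
  have fut_meas[measurable]: "fut \<in> measurable M seq.S"
    unfolding fut_def by (rule measurable_PiM_single') (auto simp: space_PiM)
  have sN[measurable_cong]: "sets N = sets (M \<Otimes>\<^sub>M unit_uniform)" unfolding N_def by (rule refl)
  have z0_meas[measurable]: "z0 \<in> measurable N borel"
    unfolding z0_def by measurable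
  \<comment> \<open>The initial pair is a function of the past and the uniform variable, both
    independent of the future.\<close>
  have init_law: "distr N (\<mu> \<Otimes>\<^sub>M seq.S) (\<lambda>x. (z0 x, fut (fst x))) = \<mu> \<Otimes>\<^sub>M seq.S"
  proof (rule measure_eqI)
    fix A assume "A \<in> sets (distr N (\<mu> \<Otimes>\<^sub>M seq.S) (\<lambda>x. (z0 x, fut (fst x))))"
    then have A[measurable]: "A \<in> sets (\<mu> \<Otimes>\<^sub>M seq.S)" by simp
    interpret SS: pair_prob_space seq.S seq.S by unfold_locales
    interpret SUS: pair_prob_space "seq.S \<Otimes>\<^sub>M unit_uniform" seq.S by unfold_locales
    let ?I = "\<lambda>z e. indicator A (z, e) :: ennreal"
    have past_fut: "distr M (seq.S \<Otimes>\<^sub>M seq.S) (\<lambda>\<omega>. (past 0 \<omega>, fut \<omega>)) = seq.S \<Otimes>\<^sub>M seq.S"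
      using M.iid_past_future[OF assms(4)] by (simp add: past_def fut_def P_def)
    have "emeasure (distr N (\<mu> \<Otimes>\<^sub>M seq.S) (\<lambda>x. (z0 x, fut (fst x)))) A
        = (\<integral>\<^sup>+x. indicator A x \<partial>distr N (\<mu> \<Otimes>\<^sub>M seq.S) (\<lambda>x. (z0 x, fut (fst x))))" by simp
    also have "\<dots> = (\<integral>\<^sup>+x. ?I (\<zeta> (past 0 (fst x), snd x)) (fut (fst x)) \<partial>(M \<Otimes>\<^sub>M unit_uniform))"
      unfolding z0_def[symmetric] N_def[symmetric] by (rule nn_integral_distr) measurable
    also have "\<dots> = (\<integral>\<^sup>+\<omega>. \<integral>\<^sup>+u. ?I (\<zeta> (past 0 \<omega>, u)) (fut \<omega>) \<partial>unit_uniform \<partial>M)"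
      by (subst U.nn_integral_fst[symmetric]) auto
    also have "\<dots> = (\<integral>\<^sup>+x. \<integral>\<^sup>+u. ?I (\<zeta> (fst x, u)) (snd x) \<partial>unit_uniform \<partial>distr M (seq.S \<Otimes>\<^sub>M seq.S) (\<lambda>\<omega>. (past 0 \<omega>, fut \<omega>)))"
      by (subst nn_integral_distr) auto
    also have "\<dots> = (\<integral>\<^sup>+e. \<integral>\<^sup>+p. \<integral>\<^sup>+u. ?I (\<zeta> (p, u)) e \<partial>unit_uniform \<partial>seq.S \<partial>seq.S)"
      unfolding past_fut by (subst SS.nn_integral_snd[symmetric]) auto
    also have "\<dots> = (\<integral>\<^sup>+e. \<integral>\<^sup>+x. ?I (\<zeta> x) e \<partial>(seq.S \<Otimes>\<^sub>M unit_uniform) \<partial>seq.S)"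
    proof (rule nn_integral_cong)
      fix e assume e: "e \<in> space seq.S"
      have "(\<lambda>x. ?I (\<zeta> x) e) \<in> borel_measurable (seq.S \<Otimes>\<^sub>M unit_uniform)" using e by measurable
      then show "(\<integral>\<^sup>+p. \<integral>\<^sup>+u. ?I (\<zeta> (p, u)) e \<partial>unit_uniform \<partial>seq.S) = (\<integral>\<^sup>+x. ?I (\<zeta> x) e \<partial>(seq.S \<Otimes>\<^sub>M unit_uniform))"
        by (rule U.nn_integral_fst)
    qed
    also have "\<dots> = (\<integral>\<^sup>+e. \<integral>\<^sup>+z. ?I z e \<partial>\<mu> \<partial>seq.S)"
    proof (rule nn_integral_cong)
      fix e assume e: "e \<in> space seq.S"
      have "(\<lambda>z. ?I z e) \<in> borel_measurable \<mu>" using e by measurable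
      then have "(\<lambda>z. ?I z e) \<in> borel_measurable borel" using measurable_cong_sets[OF s\<mu> refl] by blast
      then show "(\<integral>\<^sup>+x. ?I (\<zeta> x) e \<partial>(seq.S \<Otimes>\<^sub>M unit_uniform)) = (\<integral>\<^sup>+z. ?I z e \<partial>\<mu>)"
        unfolding \<mu>_def by (intro nn_integral_distr[symmetric] \<zeta>) simp
    qed
    also have "\<dots> = emeasure (\<mu> \<Otimes>\<^sub>M seq.S) A"
      by (subst \<mu>S.nn_integral_snd) auto
    finally show "emeasure (distr N (\<mu> \<Otimes>\<^sub>M seq.S) (\<lambda>x. (z0 x, fut (fst x)))) A = emeasure (\<mu> \<Otimes>\<^sub>M seq.S) A" .
  qed simp
  define X where "X t x = run \<alpha> (z0 x) (fut (fst x)) t" for t x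
  have X_meas[measurable]: "X t \<in> measurable N borel" for t unfolding X_def by measurable
  have X_law: "distr N (PiM UNIV (\<lambda>_. borel)) (\<lambda>x t. X (t + h) x)
      = distr (\<mu> \<Otimes>\<^sub>M seq.S) (PiM UNIV (\<lambda>_. borel)) (\<lambda>(z, e) t. run \<alpha> z e t)" for h
  proof -
    let ?R = "\<lambda>(z, e) t. run \<alpha> z e t" and ?Q = "\<lambda>(z, e). (run \<alpha> z e h, \<lambda>i. e (i + h))"
    have R[measurable]: "?R \<in> measurable (\<mu> \<Otimes>\<^sub>M seq.S) (PiM UNIV (\<lambda>_. borel))"
    proof (rule measurable_PiM_single')
      show "(\<lambda>x. ?R x t) \<in> borel_measurable (\<mu> \<Otimes>\<^sub>M seq.S)" for t
        using run_measurable[of \<alpha> t] by (simp add: case_prod_beta')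
    qed (auto simp: space_PiM)
    have [measurable]: "(\<lambda>e i. e (i + h)) \<in> measurable seq.S seq.S"
      by (rule measurable_PiM_single') (auto simp: space_PiM)
    have Q[measurable]: "?Q \<in> measurable (\<mu> \<Otimes>\<^sub>M seq.S) (\<mu> \<Otimes>\<^sub>M seq.S)" by measurable
    have Z[measurable]: "(\<lambda>x. (z0 x, fut (fst x))) \<in> measurable N (\<mu> \<Otimes>\<^sub>M seq.S)" by measurable
    \<comment> \<open>The path from time \<open>h\<close> on is the same functional
      \<open>?R\<close> of state and future, now taken at time \<open>h\<close>, where their joint
      law is unchanged.\<close>
    have "(\<lambda>x t. X (t + h) x) = (?R \<circ> ?Q) \<circ> (\<lambda>x. (z0 x, fut (fst x)))"
      by (auto simp: fun_eq_iff X_def run_add)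
    then have "distr N (PiM UNIV (\<lambda>_. borel)) (\<lambda>x t. X (t + h) x)
        = distr (distr N (\<mu> \<Otimes>\<^sub>M seq.S) (\<lambda>x. (z0 x, fut (fst x)))) (PiM UNIV (\<lambda>_. borel)) (?R \<circ> ?Q)"
      using distr_distr[OF measurable_comp[OF Q R] Z] by simp
    also have "\<dots> = distr (distr (\<mu> \<Otimes>\<^sub>M seq.S) (\<mu> \<Otimes>\<^sub>M seq.S) ?Q) (PiM UNIV (\<lambda>_. borel)) ?R"
      unfolding init_law by (rule distr_distr[OF R Q, symmetric])
    finally show ?thesis unfolding shift_law .
  qed
  have z0_pos: "0 < fst (z0 x)" "0 < snd (z0 x)" for x
    by (simp_all add: z0_def \<zeta>_def sys_state_def)
  define v where "v t x = fst (X t x)" for t x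
  define w where "w t x = snd (X t x)" for t x
  have "stationary_system_solution M ?\<theta> \<epsilon> N fst v w"
    unfolding stationary_system_solution_def
  proof (intro conjI)
    have fst_law: "distr N M fst = M"
      unfolding N_def by (rule U.distr_pair_fst)
    show "prob_space_extension M N fst"
      unfolding prob_space_extension_def using fst_law N.prob_space_axioms by auto
    show "strictly_stationary N (\<lambda>t \<omega>. (v t \<omega>, w t \<omega>))"
      unfolding strictly_stationary_def v_def w_def prod.collapse
      using X_law X_law[of 0] by auto
    show "\<forall>t. \<forall>\<omega>\<in>space N. 0 < v t \<omega> \<and> 0 < w t \<omega>"
      unfolding v_def w_def X_def using run_pos z0_pos by blast
    show "AE \<omega> in N. \<forall>t. v (Suc t) \<omega> = HE ?\<theta> (sqrt (v t \<omega>) * \<epsilon> (int t) (fst \<omega>)) (v t \<omega>) \<and>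
        w (Suc t) \<omega> = HE ?\<theta> (sqrt (v t \<omega>) * \<epsilon> (int t) (fst \<omega>)) (w t \<omega>)"
      by (simp add: v_def w_def X_def sys_step_def fut_def)
    have "AE x in N. \<forall>t. ?sm (past t (fst x))"
    proof (rule AE_distrD[of fst N M])
      show "fst \<in> measurable N M" unfolding N_def by measurable
      show "AE \<omega> in distr N M fst. \<forall>t. ?sm (past t \<omega>)" unfolding fst_law by (rule sm_AE)
    qed
    then have "AE x in N. \<forall>t. v t x = (\<sigma> (int t) (fst x))\<^sup>2"
    proof eventually_elim
      case (elim x)
      \<comment> \<open>The first component depends only on the current past; the gap just has to
        exist along the induction.\<close>
      have "\<exists>d. X t x = sys_state \<alpha> (past (int t) (fst x)) d" for t
      proof (induction t)
        case 0
        show ?case by (auto simp: X_def z0_def \<zeta>_def)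
      next
        case (Suc t)
        then obtain d where d: "X t x = sys_state \<alpha> (past (int t) (fst x)) d" by blast
        have "X (Suc t) x = sys_step \<alpha> (X t x) (\<epsilon> (int t) (fst x))" by (simp add: X_def fut_def)
        also have "\<dots> = sys_state \<alpha> (past (int t + 1) (fst x)) (gap_map d (\<epsilon> (int t) (fst x)))"
          unfolding d past_Suc by (rule sys_step_state) (use elim in blast)
        finally show ?case by (auto simp: add.commute)
      qed
      then show ?case
        unfolding \<sigma>_sq v_def by (metis fst_conv sys_state_def)
    qed
    then show "\<exists>\<sigma>. stationary_egarch_volatility M ?\<theta> \<epsilon> \<sigma> \<and> (AE \<omega> in N. \<forall>t. v t \<omega> = (\<sigma> (int t) (fst \<omega>))\<^sup>2)"
      using egarch by blast
    show "independent_rvs N borel (\<lambda>\<omega>. (v 0 \<omega>, w 0 \<omega>)) (PiM UNIV (\<lambda>_. borel)) (\<lambda>\<omega> t. \<epsilon> (int t) (fst \<omega>))"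
      unfolding independent_rvs_def
    proof (intro conjI)
      have vw: "(\<lambda>\<omega>. (v 0 \<omega>, w 0 \<omega>)) = z0" by (auto simp: v_def w_def X_def)
      have ft: "(\<lambda>x t. \<epsilon> (int t) (fst x)) = (\<lambda>x. fut (fst x))" by (simp add: fut_def)
      have fm: "(\<lambda>x. fut (fst x)) \<in> measurable N (PiM UNIV (\<lambda>_. borel))"
      proof -
        have "(\<lambda>x. fut (fst x)) \<in> measurable N seq.S" by measurable
        then show ?thesis using measurable_cong_sets[OF refl sS] by blast
      qed
      show "(\<lambda>\<omega>. (v 0 \<omega>, w 0 \<omega>)) \<in> measurable N borel" unfolding vw by (rule z0_meas)
      show "(\<lambda>\<omega> t. \<epsilon> (int t) (fst \<omega>)) \<in> measurable N (PiM UNIV (\<lambda>_. borel))" unfolding ft by (rule fm)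
      have prod: "N.prob ((z0 -` A \<inter> space N) \<inter> ((\<lambda>x. fut (fst x)) -` B \<inter> space N)) = \<mu>.prob A * seq.P.prob B"
        if A: "A \<in> sets borel" and B: "B \<in> sets (PiM UNIV (\<lambda>_. borel))" for A B
      proof -
        have AB[measurable]: "A \<in> sets \<mu>" "B \<in> sets seq.S" using A B s\<mu> sS by auto
        have "(z0 -` A \<inter> space N) \<inter> ((\<lambda>x. fut (fst x)) -` B \<inter> space N) = (\<lambda>x. (z0 x, fut (fst x))) -` (A \<times> B) \<inter> space N"
          by auto
        then have "N.prob ((z0 -` A \<inter> space N) \<inter> ((\<lambda>x. fut (fst x)) -` B \<inter> space N))
            = measure (distr N (\<mu> \<Otimes>\<^sub>M seq.S) (\<lambda>x. (z0 x, fut (fst x)))) (A \<times> B)"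
          by (simp add: measure_distr)
        also have "\<dots> = \<mu>.prob A * seq.P.prob B"
          unfolding init_law measure_def seq.P.emeasure_pair_measure_Times[OF AB] by (rule enn2real_mult)
        finally show ?thesis .
      qed
      have sp: "\<mu>.prob UNIV = 1" "seq.P.prob (space (PiM UNIV (\<lambda>_. borel))) = 1"
        using \<mu>.prob_space seq.P.prob_space sets_eq_imp_space_eq[OF s\<mu>] sets_eq_imp_space_eq[OF sS] by auto
      \<comment> \<open>The marginals are the cases of \<open>prod\<close> in which the other set is
        the whole space.\<close>
      have pA: "N.prob (z0 -` A \<inter> space N) = \<mu>.prob A" if A: "A \<in> sets borel" for A
        using prod[OF A sets.top] sp measurable_space[OF fm]
        by (simp add: vimage_def Int_def) (smt (verit, best) Collect_cong)
      have pB: "N.prob ((\<lambda>x. fut (fst x)) -` B \<inter> space N) = seq.P.prob B" if B: "B \<in> sets (PiM UNIV (\<lambda>_. borel))" for B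
        using prod[of UNIV, OF _ B] sp by (simp add: Int_absorb1)
      show "N.indep_set {(\<lambda>\<omega>. (v 0 \<omega>, w 0 \<omega>)) -` A \<inter> space N |A. A \<in> sets borel}
          {(\<lambda>\<omega> t. \<epsilon> (int t) (fst \<omega>)) -` B \<inter> space N |B. B \<in> sets (PiM UNIV (\<lambda>_. borel))}"
        unfolding N.indep_sets2_eq vw ft
        using measurable_sets[OF z0_meas] measurable_sets[OF fm] prod pA pB by auto
    qed
  qed
  moreover have "measure N {\<omega> \<in> space N. v 0 \<omega> = w 0 \<omega>} = 0"
  proof -
    have U_id: "distr unit_uniform unit_uniform (\<lambda>u. u) = unit_uniform" by (rule distr_id)
    \<comment> \<open>Replacing \<open>\<omega>\<close> by its past preserves the law, so
      \<open>D z \<noteq> 0\<close> transfers to \<open>N\<close>; the two initial volatilities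
      agree exactly where \<open>D\<close> vanishes.\<close>
    have "distr N (seq.S \<Otimes>\<^sub>M unit_uniform) (\<lambda>(\<omega>, u). (past 0 \<omega>, u)) = distr M seq.S (past 0) \<Otimes>\<^sub>M distr unit_uniform unit_uniform (\<lambda>u. u)"
      unfolding N_def by (rule pair_measure_distr[symmetric]) (auto simp: U_id U.sigma_finite_measure_axioms)
    then have law: "distr N (seq.S \<Otimes>\<^sub>M unit_uniform) (\<lambda>(\<omega>, u). (past 0 \<omega>, u)) = seq.S \<Otimes>\<^sub>M unit_uniform"
      by (simp add: past_law U_id)
    have "AE x in N. D ((\<lambda>(\<omega>, u). (past 0 \<omega>, u)) x) \<noteq> 0"
      by (rule AE_distrD[where M' = "seq.S \<Otimes>\<^sub>M unit_uniform"]) (measurable, unfold law, rule D0)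
    then have "AE x in N. v 0 x \<noteq> w 0 x"
      by eventually_elim (auto simp: v_def w_def X_def z0_def \<zeta>_def sys_state_def)
    then show ?thesis
      using N.prob_Collect_eq_0[of "\<lambda>x. v 0 x = w 0 x"] measure_notin_sets[of _ N] by blast
  qed
  ultimately show ?thesis by blast
qed

end
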